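(* Let $\eta,t>0$, and let $n,m,p\ge1$ be integers with $\tau(p)\ge(1+\eta)m+\eta t$. Let $b\in\mathbb R^m$ be fixed, let $\bar{\mathcal A}\in(\mathbb S^n)^m$, $\sigma>0$, and let $\mathcal A$ be uniformly distributed on the Euclidean ball $B\subset(\mathbb S^n)^m$ of radius $\sigma$ centered at $\bar{\mathcal A}$. Let $\alpha>0$ and $Y_0\in\mathbb R^{n\times p}$ be such that (for every $\mathcal A\in B$) the set $\mathfrak M_\alpha=\{Y\in\mathbb R^{n\times p}:\|\mathcal A(YY^T)-b\|\le\alpha\}$ is compact and $Y_0\in\mathfrak M_\alpha$, and let $R_Y\in\mathbb R_+$ be a constant with $\|Y\|\le R_Y$ for all $Y\in\mathfrak M_\alpha$. Define $$R_A:=\|\bar{\mathcal A}\|+\sigma,\qquad \kappa:=2(R_AR_Y^2+\|b\|)R_A,\qquad K:=R_A(3\kappa)^{1/\eta}.$$ Let $\rho\in(0,1]$ be arbitrary and set $$\epsilon:=K^{-1}\Big(\frac{\rho\,\sigma^2}{2n^3m}\Big)^{1+1/\eta},\qquad \varepsilon_1:=\epsilon^{3/2},\qquad\varepsilon_2:=\epsilon .$$ Then the adaptive regularization with cubics (ARC) method, applied to $\min_{Y\in\mathbb R^{n\times p}}\|\mathcal A(YY^T)-b\|^2$ with tolerances $(\varepsilon_1,\varepsilon_2)$ and initialized at $Y_0$, returns a point $Y$ after $O(\epsilon^{-3})$ function evaluations, and with probability at least $1-O(\sigma^2/(n^3m))^t$ (over $\mathcal A$) the matrix $YY^T$ is $(\rho\sigma,\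 \epsilon^{3/2}R_Y,\ 5\epsilon)$-approximately optimal for the least squares problem $\min_{X\in\mathbb S^n}\|\mathcal A(X)-b\|^2$ s.t. $X\succeq0$.
   Context: $\mathbb S^n$ is the space of real symmetric $n\times n$ matrices, $A\bullet B=\operatorname{tr}(A^TB)$, all matrix norms are Frobenius norms, $\tau(k)=\binom{k+1}{2}$. A tuple $\mathcal A=(A_1,\dots,A_m)\in(\mathbb S^n)^m$ is identified with the linear map $\mathcal A(X)=(A_1\bullet X,\dots,A_m\bullet X)$; $\|\bar{\mathcal A}\|$ is the operator norm of the corresponding linear map; $\mathcal A^*(\lambda)=\sum_i\lambda_iA_i$. Put $S(X)=2\mathcal A^*(\mathcal A(X)-b)$. $X\in\mathbb S^n$ is $(\varepsilon_0,\varepsilon_1,\varepsilon_2)$-approximately optimal for the least squares problem if $X\succeq0$ and either $\|\mathcal A(X)-b\|\le\varepsilon_0$, or both $\|S(X)X\|\le\varepsilon_1$ and $S(X)\succeq-\varepsilon_2I_n$. ARC method: a known method (Cartis, Gould, Toint 2011) for $\min_y g(y)$ with the following guarantee. If $g(y_0)\le a$ and $g,\nabla g,\nabla^2g$ are uniformly bounded and Lipschitz on $\{y:g(y)\le a\}$, then, initialized at $y_0$, its iterates do not increase $g$ and after $O(\max\{\varepsilon_1^{-2},\varepsilon_2^{-3}\})$ iterations, each using $O(1)$ evaluations of $g$ and its derivatives, it returns $y$ with $\|\nabla g(y)\|\le\varepsilon_1$ and $\nabla^2g(y)\succeq-\varepsilon_2I$. The constant in $O(\epsilon^{-3})$ depends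 only on bounds and Lipschitz constants of the objective and its first two derivatives on $\mathfrak M_\alpha$ and on $\alpha$. The expression $1-O(\sigma^2/(n^3m))^t$ means $1-(c\,\sigma^2/(n^3m))^t$ for a constant $c$ depending only on $\kappa,\eta,t$. *)

theory Defs
  imports "HOL-Probability.Probability" "HOL-Library.Extended_Nat" "Jordan_Normal_Form.Matrix"
begin

text \<open>
  The dimensions \<open>n\<close>, \<open>m\<close>, \<open>p\<close> are quantified inside the theorem (the constants must be
  uniform in them), so matrices and vectors are those of \<open>Jordan_Normal_Form.Matrix\<close>, with
  carriers \<open>carrier_mat n p\<close> and \<open>carrier_vec n\<close>. A tuple \<open>(A_1, ..., A_m)\<close> is a function
  \<open>nat \<Rightarrow> real mat\<close> of which only the values at \<open>k < m\<close> are used.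
\<close>

unbundle no vec_syntax
no_notation inner (infix "\<bullet>" 70)

section \<open>Frobenius geometry and the least squares problem\<close>

definition trace_mat :: "real mat \<Rightarrow> real" where
  "trace_mat M = (\<Sum>i<dim_row M. M $$ (i, i))"

definition frob_inner :: "real mat \<Rightarrow> real mat \<Rightarrow> real" where
  "frob_inner A B = trace_mat (transpose_mat A * B)"

definition frob_norm :: "real mat \<Rightarrow> real" where
  "frob_norm A = sqrt (frob_inner A A)"

definition vnorm :: "real Matrix.vec \<Rightarrow> real" where
  "vnorm v = sqrt (v \<bullet> v)"

definition sym_mats :: "nat \<Rightarrow> real mat set" where
  "sym_mats n = {X \<in> carrier_mat n n. transpose_mat X = X}"

definition psd :: "nat \<Rightarrow> real mat \<Rightarrow> bool" where
  "psd n X \<longleftrightarrow> X \<in> sym_mats n \<and> (\<forall>v\<in>carrier_vec n. 0 \<le> v \<bullet> (X *\<^sub>v v))"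

definition tau :: "nat \<Rightarrow> nat" where
  "tau k = (k + 1) choose 2"

definition lin_map :: "nat \<Rightarrow> (nat \<Rightarrow> real mat) \<Rightarrow> real mat \<Rightarrow> real Matrix.vec" where
  "lin_map m A X = Matrix.vec m (\<lambda>k. frob_inner (A k) X)"

definition adj_map :: "nat \<Rightarrow> nat \<Rightarrow> (nat \<Rightarrow> real mat) \<Rightarrow> real Matrix.vec \<Rightarrow> real mat" where
  "adj_map n m A l = Matrix.mat n n (\<lambda>(i, j). \<Sum>k<m. l $ k * A k $$ (i, j))"

definition op_norm :: "nat \<Rightarrow> nat \<Rightarrow> (nat \<Rightarrow> real mat) \<Rightarrow> real" where
  "op_norm n m A = Sup {vnorm (lin_map m A X) | X. X \<in> sym_mats n \<and> frob_norm X \<le> 1}"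

definition slack :: "nat \<Rightarrow> nat \<Rightarrow> (nat \<Rightarrow> real mat) \<Rightarrow> real Matrix.vec \<Rightarrow> real mat \<Rightarrow> real mat" where
  "slack n m A b X = 2 \<cdot>\<^sub>m adj_map n m A (lin_map m A X - b)"

definition approx_optimal ::
  "nat \<Rightarrow> nat \<Rightarrow> (nat \<Rightarrow> real mat) \<Rightarrow> real Matrix.vec \<Rightarrow> real \<Rightarrow> real \<Rightarrow> real \<Rightarrow> real mat \<Rightarrow> bool" where
  "approx_optimal n m A b e0 e1 e2 X \<longleftrightarrow>
     psd n X \<and>
     (vnorm (lin_map m A X - b) \<le> e0 \<or>
      frob_norm (slack n m A b X * X) \<le> e1 \<and> psd n (slack n m A b X + e2 \<cdot>\<^sub>m 1\<^sub>m n))"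

definition residual :: "nat \<Rightarrow> (nat \<Rightarrow> real mat) \<Rightarrow> real Matrix.vec \<Rightarrow> real mat \<Rightarrow> real" where
  "residual m A b Y = vnorm (lin_map m A (Y * transpose_mat Y) - b)"

definition level_set ::
  "nat \<Rightarrow> nat \<Rightarrow> nat \<Rightarrow> (nat \<Rightarrow> real mat) \<Rightarrow> real Matrix.vec \<Rightarrow> real \<Rightarrow> real mat set" where
  "level_set n p m A b \<alpha> = {Y \<in> carrier_mat n p. residual m A b Y \<le> \<alpha>}"

definition mat_topology :: "nat \<Rightarrow> nat \<Rightarrow> real mat topology" where
  "mat_topology n p =
     Metric_space.mtopology (carrier_mat n p) (\<lambda>X Y. frob_norm (X - Y))"

section \<open>The uniform distribution on a ball of matrix tuples\<close>

definition tuple_ball :: "nat \<Rightarrow> nat \<Rightarrow> (nat \<Rightarrow> real mat) \<Rightarrow> real \<Rightarrow> (nat \<Rightarrow> real mat) set" where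
  "tuple_ball n m Abar \<sigma> =
     {A. (\<forall>k<m. A k \<in> sym_mats n) \<and> sqrt (\<Sum>k<m. (frob_norm (A k - Abar k))\<^sup>2) \<le> \<sigma>}"

text \<open>
  A tuple of \<open>m\<close> symmetric matrices is parametrized by its entries on and above the diagonals.
  The image of Lebesgue measure under this linear parametrization is a constant multiple of the
  Euclidean volume for the Frobenius inner product, so conditioning on the (Frobenius) ball
  gives the uniform distribution on that ball.
\<close>

definition sym_index :: "nat \<Rightarrow> nat \<Rightarrow> (nat \<times> nat \<times> nat) set" where
  "sym_index n m = {(k, i, j). k < m \<and> i \<le> j \<and> j < n}"

definition sym_tuple :: "nat \<Rightarrow> (nat \<times> nat \<times> nat \<Rightarrow> real) \<Rightarrow> nat \<Rightarrow> real mat" where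
  "sym_tuple n a k = Matrix.mat n n (\<lambda>(i, j). a (k, min i j, max i j))"

definition coord_measure :: "nat \<Rightarrow> nat \<Rightarrow> (nat \<times> nat \<times> nat \<Rightarrow> real) measure" where
  "coord_measure n m = PiM (sym_index n m) (\<lambda>_. lborel)"

definition uniform_ball ::
  "nat \<Rightarrow> nat \<Rightarrow> (nat \<Rightarrow> real mat) \<Rightarrow> real \<Rightarrow> (nat \<times> nat \<times> nat \<Rightarrow> real) measure" where
  "uniform_ball n m Abar \<sigma> =
     uniform_measure (coord_measure n m)
       {a \<in> space (coord_measure n m). sym_tuple n a \<in> tuple_ball n m Abar \<sigma>}"

section \<open>Twice continuously differentiable functions of a matrix\<close>

text \<open>
  Frechet derivatives on \<open>carrier_mat n p\<close> with the Frobenius inner product: \<open>G Y\<close> is the gradient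
  of \<open>g\<close> at \<open>Y\<close>, and the linear map \<open>H Y\<close> is the Hessian, i.e. the derivative of \<open>G\<close> at \<open>Y\<close>.
\<close>

definition has_gradient ::
  "nat \<Rightarrow> nat \<Rightarrow> (real mat \<Rightarrow> real) \<Rightarrow> real mat \<Rightarrow> real mat \<Rightarrow> bool" where
  "has_gradient n p g Y D \<longleftrightarrow>
     D \<in> carrier_mat n p \<and>
     (\<forall>e>0. \<exists>d>0. \<forall>Z\<in>carrier_mat n p. frob_norm Z < d \<longrightarrow>
        \<bar>g (Y + Z) - g Y - frob_inner D Z\<bar> \<le> e * frob_norm Z)"

definition lin_op :: "nat \<Rightarrow> nat \<Rightarrow> (real mat \<Rightarrow> real mat) \<Rightarrow> bool" where
  "lin_op n p T \<longleftrightarrow>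
     (\<forall>Z\<in>carrier_mat n p. T Z \<in> carrier_mat n p) \<and>
     (\<forall>Z\<in>carrier_mat n p. \<forall>W\<in>carrier_mat n p. T (Z + W) = T Z + T W) \<and>
     (\<forall>c. \<forall>Z\<in>carrier_mat n p. T (c \<cdot>\<^sub>m Z) = c \<cdot>\<^sub>m T Z)"

definition has_jacobian ::
  "nat \<Rightarrow> nat \<Rightarrow> (real mat \<Rightarrow> real mat) \<Rightarrow> real mat \<Rightarrow> (real mat \<Rightarrow> real mat) \<Rightarrow> bool" where
  "has_jacobian n p G Y T \<longleftrightarrow>
     lin_op n p T \<and>
     (\<forall>e>0. \<exists>d>0. \<forall>Z\<in>carrier_mat n p. frob_norm Z < d \<longrightarrow>
        frob_norm (G (Y + Z) - G Y - T Z) \<le> e * frob_norm Z)"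

definition C2_fun ::
  "nat \<Rightarrow> nat \<Rightarrow> (real mat \<Rightarrow> real) \<Rightarrow> (real mat \<Rightarrow> real mat) \<Rightarrow>
   (real mat \<Rightarrow> real mat \<Rightarrow> real mat) \<Rightarrow> bool" where
  "C2_fun n p g G H \<longleftrightarrow>
     (\<forall>Y\<in>carrier_mat n p. has_gradient n p g Y (G Y) \<and> has_jacobian n p G Y (H Y)) \<and>
     (\<forall>Y\<in>carrier_mat n p. \<forall>e>0. \<exists>d>0. \<forall>Y'\<in>carrier_mat n p. frob_norm (Y' - Y) < d \<longrightarrow>
        (\<forall>Z\<in>carrier_mat n p. frob_norm (H Y' Z - H Y Z) \<le> e * frob_norm Z))"

text \<open>
  \<open>L\<close> bounds \<open>g\<close>, its gradient and its Hessian (in operator norm) on the sublevel set, and is a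
  Lipschitz constant of all three there.
\<close>

definition bounded_lipschitz ::
  "nat \<Rightarrow> nat \<Rightarrow> (real mat \<Rightarrow> real) \<Rightarrow> (real mat \<Rightarrow> real mat) \<Rightarrow>
   (real mat \<Rightarrow> real mat \<Rightarrow> real mat) \<Rightarrow> real \<Rightarrow> real \<Rightarrow> bool" where
  "bounded_lipschitz n p g G H a L \<longleftrightarrow>
     (let D = {Y \<in> carrier_mat n p. g Y \<le> a} in
       (\<forall>Y\<in>D. \<bar>g Y\<bar> \<le> L \<and> frob_norm (G Y) \<le> L \<and>
          (\<forall>Z\<in>carrier_mat n p. frob_norm (H Y Z) \<le> L * frob_norm Z)) \<and>
       (\<forall>Y\<in>D. \<forall>Y'\<in>D.
          \<bar>g Y - g Y'\<bar> \<le> L * frob_norm (Y - Y') \<and>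
          frob_norm (G Y - G Y') \<le> L * frob_norm (Y - Y') \<and>
          (\<forall>Z\<in>carrier_mat n p.
             frob_norm (H Y Z - H Y' Z) \<le> L * frob_norm (Y - Y') * frob_norm Z)))"

section \<open>The ARC method\<close>

text \<open>
  The run of an iterative method: the number of iterations until it stops (\<open>\<infinity>\<close> if it does
  not), the iterates (iteration \<open>k\<close> produces iterate \<open>k + 1\<close>), and the points at which the objective and its first
  two derivatives are evaluated during iteration \<open>k\<close>. The data at the starting point belong to
  the initialization. The returned point is the last iterate; it and the number of evaluations
  are only meaningful for a run that stops.
\<close>

record opt_run =
  iterations :: enat
  iterate :: "nat \<Rightarrow> real mat"
  queries :: "nat \<Rightarrow> real mat list"

definition returned_point :: "opt_run \<Rightarrow> real mat" where
  "returned_point r = iterate r (the_enat (iterations r))"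

definition evaluations :: "opt_run \<Rightarrow> nat" where
  "evaluations r = (\<Sum>k<the_enat (iterations r). length (queries r k))"

text \<open>
  Arguments of a method: the shape \<open>n\<close>, \<open>p\<close> of the variable, the objective, the two tolerances and
  the starting point.
\<close>

type_synonym opt_method =
  "nat \<Rightarrow> nat \<Rightarrow> (real mat \<Rightarrow> real) \<Rightarrow> real \<Rightarrow> real \<Rightarrow> real mat \<Rightarrow> opt_run"

text \<open>
  The run depends on the objective only through the objective's value, gradient and Hessian at
  the starting point and at the queried points; this is what makes \<open>evaluations\<close> count the
  evaluations the method really uses.
\<close>

definition second_order_oracle_method :: "opt_method \<Rightarrow> bool" where
  "second_order_oracle_method M \<longleftrightarrow>
     (\<forall>n p g G H g' G' H' e1 e2. \<forall>Y0\<in>carrier_mat n p.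
        C2_fun n p g G H \<longrightarrow> C2_fun n p g' G' H' \<longrightarrow>
        (let r = M n p g e1 e2 Y0 in
          (\<forall>Y \<in> {Y0} \<union> (\<Union>k\<in>{k. enat k < iterations r}. set (queries r k)).
             g Y = g' Y \<and> G Y = G' Y \<and> (\<forall>Z\<in>carrier_mat n p. H Y Z = H' Y Z)) \<longrightarrow>
          M n p g' e1 e2 Y0 = r))"

text \<open>
  The ARC method enters only through its known convergence guarantee (Cartis, Gould, Toint).
  \<open>C\<close> and \<open>q\<close> are the constants hidden in the \<open>O\<close>-terms: \<open>C a L\<close> depends only on the level and
  on the bounds and Lipschitz constants on the sublevel set, and \<open>q\<close> bounds the number of
  evaluations per iteration.
\<close>

definition arc_method :: "opt_method \<Rightarrow> bool" where
  "arc_method M \<longleftrightarrow>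
     second_order_oracle_method M \<and>
     (\<exists>(C :: real \<Rightarrow> real \<Rightarrow> real) (q :: nat).
       \<forall>n p g G H a L e1 e2. \<forall>Y0\<in>carrier_mat n p.
         1 \<le> n \<longrightarrow> 1 \<le> p \<longrightarrow> 0 < e1 \<longrightarrow> 0 < e2 \<longrightarrow>
         C2_fun n p g G H \<longrightarrow> g Y0 \<le> a \<longrightarrow> bounded_lipschitz n p g G H a L \<longrightarrow>
         (let r = M n p g e1 e2 Y0; N = the_enat (iterations r); Y = returned_point r in
           iterations r \<noteq> \<infinity> \<and>
           iterate r 0 = Y0 \<and>
           (\<forall>k\<le>N. iterate r k \<in> carrier_mat n p) \<and>
           (\<forall>k<N. g (iterate r (k + 1)) \<le> g (iterate r k)) \<and>
           real N \<le> C a L * max (e1 powr (- 2)) (e2 powr (- 3)) \<and>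
           (\<forall>k<N. set (queries r k) \<subseteq> carrier_mat n p \<and> length (queries r k) \<le> q) \<and>
           frob_norm (G Y) \<le> e1 \<and>
           (\<forall>Z\<in>carrier_mat n p. frob_inner Z (H Y Z) \<ge> - e2 * (frob_norm Z)\<^sup>2)))"

text \<open>
  The objective \<open>\<parallel>A(Y Y^T) - b\<parallel>^2\<close>, and the statement that \<open>L\<close> bounds it and its first two
  derivatives, together with their Lipschitz constants, on \<open>level_set n p m A b \<alpha>\<close> (the sublevel
  set of the objective at level \<open>\<alpha>^2\<close>).
\<close>

definition objective :: "nat \<Rightarrow> (nat \<Rightarrow> real mat) \<Rightarrow> real Matrix.vec \<Rightarrow> real mat \<Rightarrow> real" where
  "objective m A b Y = (residual m A b Y)\<^sup>2"

definition objective_bound ::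
  "nat \<Rightarrow> nat \<Rightarrow> nat \<Rightarrow> (nat \<Rightarrow> real mat) \<Rightarrow> real Matrix.vec \<Rightarrow> real \<Rightarrow> real \<Rightarrow> bool" where
  "objective_bound n p m A b \<alpha> L \<longleftrightarrow>
     (\<exists>G H. C2_fun n p (objective m A b) G H \<and>
            bounded_lipschitz n p (objective m A b) G H (\<alpha>\<^sup>2) L)"

end

theory Submission
  imports Defs "Jordan_Normal_Form.Determinant"
begin

text \<open>
  Let \<open>Y\<close> be the returned point, \<open>r\<close> its residual and \<open>S = 2 A\<^sup>*(r)\<close>; the gradient at \<open>Y\<close> is \<open>2 S Y\<close>.
  If \<open>Y u\<close> is short for some unit vector \<open>u\<close>, then testing the Hessian with \<open>v u\<^sup>T\<close> shows that \<open>S\<close>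
  is bounded below by \<open>-5\<epsilon>\<close>. Otherwise \<open>Y\<close> is well conditioned, and if \<open>r\<close> is not small either, then
  \<open>M = A\<^sup>*(r / \<parallel>r\<parallel>)\<close> nearly annihilates the \<open>p\<close>-dimensional column space of \<open>Y\<close>. That this happens
  for some unit vector \<open>w\<close> in place of \<open>r / \<parallel>r\<parallel>\<close> is unlikely:

  Choosing rows \<open>f\<close> of \<open>Y\<close> with a maximal \<open>p \<times> p\<close> minor, the column space is spanned by the columns of
  a matrix \<open>F\<close> with entries in \<open>[-1, 1]\<close> that is the identity on the rows \<open>f\<close>. If \<open>M F\<close> and \<open>M' F'\<close>
  are small and \<open>M - M'\<close> is supported in the block \<open>f \<times> f\<close>, this block equals
  \<open>F'\<^sup>T (M - M') F\<close> and is small. So, given all other entries, the \<open>\<tau>(p)\<close> entries of the block are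
  confined to a small ball, and Fubini's theorem bounds the probability for fixed \<open>w\<close> and \<open>f\<close> by
  a power with exponent \<open>\<tau>(p)\<close>. A union bound over the at most \<open>n\<^sup>p\<close> choices of \<open>f\<close> and over a net of
  the unit sphere of \<open>\<real>\<^sup>m\<close> costs a power of \<open>1 / \<epsilon>\<close> with exponent \<open>m\<close> only, and
  \<open>\<tau>(p) \<ge> (1 + \<eta>) m + \<eta> t\<close> leaves the exponent \<open>t\<close>.
\<close>

section \<open>Frobenius geometry\<close>

text \<open>The obstacle is that \<open>Y\<close> depends on the random tuple. A net over all column
  spaces would cost a number of parameters of order p (n - p), which for large n exceeds what
  \<tau>(p) pays for. Hence the frame stays existentially quantified inside the event: two tuples
  may use different frames, and the identity for the block still holds. Only the rows
  \<open>f\<close> and the direction \<open>w\<close> enter the union bound. The scales: if no unit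
  \<open>u\<close> makes \<open>Y u\<close> short, \<open>Y\<close> is bounded below by a multiple
  of sqrt \<epsilon>. Dividing the gradient tolerance \<epsilon>^(3/2) by this and by the residual,
  which exceeds \<rho>\<sigma>, leaves a quantity \<delta> linear in \<epsilon>. Each block
  coordinate contributes a factor of order m n^2 \<delta> / \<sigma>. The denominator n^3 m in
  \<epsilon> cancels m n^2 and leaves 1 / n, whose powers absorb n^p, so the constant is uniform in
  the dimensions. With z proportional to \<rho>\<sigma>^2 / (n^3 m), the exponent 1 + 1/\<eta> and
  \<open>K\<close> make the net cost z^(-(1 + 1/\<eta>)) per dimension and the block gain
  z^(1/\<eta>) per coordinate, up to constants.\<close>

lemma frob_inner_eq:
  assumes "A \<in> carrier_mat n p" "B \<in> carrier_mat n p"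
  shows "frob_inner A B = (\<Sum>i<n. \<Sum>j<p. A $$ (i, j) * B $$ (i, j))"
proof -
  have "frob_inner A B = (\<Sum>j<p. \<Sum>i<n. A $$ (i, j) * B $$ (i, j))"
    using assms by (auto simp: frob_inner_def trace_mat_def scalar_prod_def atLeast0LessThan intro!: sum.cong)
  also have "\<dots> = (\<Sum>i<n. \<Sum>j<p. A $$ (i, j) * B $$ (i, j))" by (rule sum.swap)
  finally show ?thesis .
qed

lemma frob_inner_commute:
  assumes "A \<in> carrier_mat n p" "B \<in> carrier_mat n p"
  shows "frob_inner A B = frob_inner B A"
  using assms by (simp add: frob_inner_eq mult.commute)

lemma frob_inner_add_right:
  assumes "A \<in> carrier_mat n p" "B \<in> carrier_mat n p" "C \<in> carrier_mat n p"
  shows "frob_inner A (B + C) = frob_inner A B + frob_inner A C"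
  using assms by (simp add: frob_inner_eq[of _ n p] algebra_simps sum.distrib)

lemma frob_inner_smult_right:
  assumes "A \<in> carrier_mat n p" "B \<in> carrier_mat n p"
  shows "frob_inner A (c \<cdot>\<^sub>m B) = c * frob_inner A B"
  using assms by (simp add: frob_inner_eq[of _ n p] algebra_simps sum_distrib_left)

lemma frob_inner_diff_left:
  assumes "A \<in> carrier_mat n p" "B \<in> carrier_mat n p" "C \<in> carrier_mat n p"
  shows "frob_inner (A - B) C = frob_inner A C - frob_inner B C"
proof -
  have "A - B \<in> carrier_mat n p" using assms by auto
  then show ?thesis
  using assms by (simp add: frob_inner_eq[of _ n p] algebra_simps sum_subtractf)
qed

lemma frob_inner_smult_left:
  assumes "A \<in> carrier_mat n p" "B \<in> carrier_mat n p"
  shows "frob_inner (c \<cdot>\<^sub>m A) B = c * frob_inner A B"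
  using assms by (simp add: frob_inner_eq[of _ n p] algebra_simps sum_distrib_left)

lemma frob_norm_L2:
  assumes "A \<in> carrier_mat n p"
  shows "frob_norm A = L2_set (\<lambda>x. A $$ x) ({..<n} \<times> {..<p})"
  using assms
  by (simp add: frob_norm_def L2_set_def frob_inner_eq power2_eq_square sum.cartesian_product case_prod_unfold)

lemma frob_norm_nonneg [simp]: "0 \<le> frob_norm A"
  using frob_norm_L2[of A "dim_row A" "dim_col A"] by simp

lemma frob_norm_square: "(frob_norm A)\<^sup>2 = frob_inner A A"
proof -
  have "0 \<le> frob_inner A A" using frob_norm_nonneg[of A] by (simp add: frob_norm_def)
  then show ?thesis by (simp add: frob_norm_def)
qed

lemma frob_norm_square_sum:
  "A \<in> carrier_mat n p \<Longrightarrow> (frob_norm A)\<^sup>2 = (\<Sum>i<n. \<Sum>j<p. (A $$ (i, j))\<^sup>2)"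
  unfolding frob_norm_square by (simp add: frob_inner_eq power2_eq_square)

lemma frob_norm_zero [simp]: "frob_norm (0\<^sub>m n p) = 0"
  by (simp add: frob_norm_def frob_inner_eq[of _ n p])

lemma entry_le_frob_norm:
  assumes "A \<in> carrier_mat n p" "i < n" "j < p"
  shows "\<bar>A $$ (i, j)\<bar> \<le> frob_norm A"
  unfolding frob_norm_L2[OF assms(1)]
  using member_le_L2_set[of "{..<n} \<times> {..<p}" "(i, j)" "\<lambda>x. \<bar>A $$ x\<bar>"] assms(2,3)
  by (simp add: L2_set_def)

lemma frob_inner_abs_le:
  assumes "A \<in> carrier_mat n p" "B \<in> carrier_mat n p"
  shows "\<bar>frob_inner A B\<bar> \<le> frob_norm A * frob_norm B"
proof -
  have "\<bar>frob_inner A B\<bar> = \<bar>\<Sum>x\<in>{..<n} \<times> {..<p}. A $$ x * B $$ x\<bar>"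
    using assms by (simp add: frob_inner_eq sum.cartesian_product case_prod_unfold)
  also have "\<dots> \<le> (\<Sum>x\<in>{..<n} \<times> {..<p}. \<bar>A $$ x\<bar> * \<bar>B $$ x\<bar>)"
    by (rule order_trans[OF sum_abs]) (simp add: abs_mult)
  also have "\<dots> \<le> frob_norm A * frob_norm B"
    unfolding frob_norm_L2[OF assms(1)] frob_norm_L2[OF assms(2)] by (rule L2_set_mult_ineq)
  finally show ?thesis .
qed

lemma frob_norm_add_le:
  assumes "A \<in> carrier_mat n p" "B \<in> carrier_mat n p"
  shows "frob_norm (A + B) \<le> frob_norm A + frob_norm B"
proof -
  have "frob_norm (A + B) = L2_set (\<lambda>x. A $$ x + B $$ x) ({..<n} \<times> {..<p})"
    using assms by (subst frob_norm_L2[of _ n p]) (auto intro!: L2_set_cong)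
  also have "\<dots> \<le> frob_norm A + frob_norm B"
    unfolding frob_norm_L2[OF assms(1)] frob_norm_L2[OF assms(2)] by (rule L2_set_triangle_ineq)
  finally show ?thesis .
qed

lemma frob_norm_smult: "frob_norm (c \<cdot>\<^sub>m A) = \<bar>c\<bar> * frob_norm A"
proof -
  have A: "A \<in> carrier_mat (dim_row A) (dim_col A)" by simp
  have "(frob_norm (c \<cdot>\<^sub>m A))\<^sup>2 = (\<bar>c\<bar> * frob_norm A)\<^sup>2"
    using A by (simp add: frob_norm_square frob_inner_smult_left[OF A] frob_inner_smult_right[OF A A]
        frob_inner_smult_left[OF A smult_carrier_mat[OF A]] power_mult_distrib)
      (simp add: power2_eq_square)
  then show ?thesis by (simp add: power2_eq_iff_nonneg)
qed

lemma frob_norm_diff_le: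
  assumes "A \<in> carrier_mat n p" "B \<in> carrier_mat n p"
  shows "frob_norm (A - B) \<le> frob_norm A + frob_norm B"
proof -
  have "A - B = A + (-1) \<cdot>\<^sub>m B" using assms by auto
  then show ?thesis
    using frob_norm_add_le[OF assms(1) smult_carrier_mat[OF assms(2)], of "-1"]
    by (simp add: frob_norm_smult)
qed

lemma frob_norm_transpose [simp]: "frob_norm (A\<^sup>T) = frob_norm A"
proof -
  have A: "A \<in> carrier_mat (dim_row A) (dim_col A)"
    and A': "A\<^sup>T \<in> carrier_mat (dim_col A) (dim_row A)" by auto
  have "frob_inner (A\<^sup>T) (A\<^sup>T) =
      (\<Sum>j<dim_col A. \<Sum>i<dim_row A. A $$ (i, j) * A $$ (i, j))"
    by (simp add: frob_inner_eq[OF A' A'])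
  also have "\<dots> = (\<Sum>i<dim_row A. \<Sum>j<dim_col A. A $$ (i, j) * A $$ (i, j))" by (rule sum.swap)
  also have "\<dots> = frob_inner A A" by (simp add: frob_inner_eq[OF A A])
  finally show ?thesis by (simp add: frob_norm_def)
qed

lemma frob_norm_mult_le:
  assumes "A \<in> carrier_mat n q" "B \<in> carrier_mat q p"
  shows "frob_norm (A * B) \<le> frob_norm A * frob_norm B"
proof -
  have AB: "A * B \<in> carrier_mat n p" using assms by auto
  have "(frob_norm (A * B))\<^sup>2 = (\<Sum>i<n. \<Sum>j<p. (\<Sum>k<q. A $$ (i, k) * B $$ (k, j))\<^sup>2)"
    using assms by (simp add: frob_norm_square_sum[OF AB] scalar_prod_def atLeast0LessThan)
  also have "\<dots> \<le> (\<Sum>i<n. \<Sum>j<p. (\<Sum>k<q. (A $$ (i, k))\<^sup>2) * (\<Sum>k<q. (B $$ (k, j))\<^sup>2))"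
    by (intro sum_mono Cauchy_Schwarz_ineq_sum)
  also have "\<dots> = (\<Sum>i<n. \<Sum>k<q. (A $$ (i, k))\<^sup>2) * (\<Sum>j<p. \<Sum>k<q. (B $$ (k, j))\<^sup>2)"
    by (simp add: sum_product)
  also have "\<dots> = (frob_norm A * frob_norm B)\<^sup>2"
    using sum.swap[of "\<lambda>j k. (B $$ (k, j))\<^sup>2" "{..<q}" "{..<p}"]
    by (simp add: power_mult_distrib frob_norm_square_sum[OF assms(1)] frob_norm_square_sum[OF assms(2)])
  finally show ?thesis by (rule power2_le_imp_le) simp
qed

section \<open>Euclidean norm of vectors\<close>

lemma vnorm_L2: "v \<in> carrier_vec n \<Longrightarrow> vnorm v = L2_set (\<lambda>i. v $ i) {..<n}"
  by (simp add: vnorm_def L2_set_def scalar_prod_def atLeast0LessThan power2_eq_square)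

lemma vnorm_square_sum: "v \<in> carrier_vec n \<Longrightarrow> (vnorm v)\<^sup>2 = (\<Sum>i<n. (v $ i)\<^sup>2)"
  by (simp add: vnorm_L2 L2_set_def sum_nonneg)

lemma vnorm_nonneg [simp]: "0 \<le> vnorm v"
  using vnorm_L2[of v "dim_vec v"] by simp

lemma vnorm_square: "(vnorm v)\<^sup>2 = v \<bullet> v"
proof -
  have "0 \<le> v \<bullet> v" using vnorm_nonneg[of v] by (simp add: vnorm_def)
  then show ?thesis by (simp add: vnorm_def)
qed

lemma vnorm_eq_0_iff: "v \<in> carrier_vec n \<Longrightarrow> vnorm v = 0 \<longleftrightarrow> v = 0\<^sub>v n"
  by (auto simp: vnorm_L2 L2_set_eq_0_iff)

lemma scalar_prod_abs_le:
  assumes "v \<in> carrier_vec n" "w \<in> carrier_vec n"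
  shows "\<bar>v \<bullet> w\<bar> \<le> vnorm v * vnorm w"
proof -
  have "\<bar>v \<bullet> w\<bar> \<le> (\<Sum>i<n. \<bar>v $ i\<bar> * \<bar>w $ i\<bar>)"
    using assms by (auto simp: scalar_prod_def atLeast0LessThan abs_mult[symmetric] intro: sum_abs)
  also have "\<dots> \<le> vnorm v * vnorm w"
    unfolding vnorm_L2[OF assms(1)] vnorm_L2[OF assms(2)] by (rule L2_set_mult_ineq)
  finally show ?thesis .
qed

lemma vnorm_add_le:
  assumes "v \<in> carrier_vec n" "w \<in> carrier_vec n"
  shows "vnorm (v + w) \<le> vnorm v + vnorm w"
proof -
  have "vnorm (v + w) = L2_set (\<lambda>i. v $ i + w $ i) {..<n}"
    using assms by (subst vnorm_L2[of _ n]) (auto intro!: L2_set_cong)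
  also have "\<dots> \<le> vnorm v + vnorm w"
    unfolding vnorm_L2[OF assms(1)] vnorm_L2[OF assms(2)] by (rule L2_set_triangle_ineq)
  finally show ?thesis .
qed

lemma vnorm_smult: "vnorm (c \<cdot>\<^sub>v v) = \<bar>c\<bar> * vnorm v"
proof -
  have v: "v \<in> carrier_vec (dim_vec v)" by simp
  have "vnorm (c \<cdot>\<^sub>v v) = L2_set (\<lambda>i. c * v $ i) {..<dim_vec v}"
    by (subst vnorm_L2[of _ "dim_vec v"]) (auto intro!: L2_set_cong)
  also have "\<dots> = \<bar>c\<bar> * vnorm v"
    by (subst vnorm_L2[OF v]) (simp add: L2_set_def power_mult_distrib sum_distrib_left[symmetric] real_sqrt_mult)
  finally show ?thesis .
qed

lemma vnorm_diff_le:
  assumes "v \<in> carrier_vec n" "w \<in> carrier_vec n"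
  shows "vnorm (v - w) \<le> vnorm v + vnorm w"
proof -
  have "v - w = v + (-1) \<cdot>\<^sub>v w" using assms by auto
  then show ?thesis
    using vnorm_add_le[OF assms(1) smult_carrier_vec[THEN iffD2, OF assms(2)], of "-1"]
    by (simp add: vnorm_smult)
qed

lemma vnorm_mult_mat_vec_le:
  assumes "A \<in> carrier_mat n q" "v \<in> carrier_vec q"
  shows "vnorm (A *\<^sub>v v) \<le> frob_norm A * vnorm v"
proof -
  have Av: "A *\<^sub>v v \<in> carrier_vec n" using assms by auto
  have "(vnorm (A *\<^sub>v v))\<^sup>2 = (\<Sum>i<n. (\<Sum>k<q. A $$ (i, k) * v $ k)\<^sup>2)"
    using assms by (simp add: vnorm_L2[OF Av] L2_set_def sum_nonneg scalar_prod_def atLeast0LessThan)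
  also have "\<dots> \<le> (\<Sum>i<n. (\<Sum>k<q. (A $$ (i, k))\<^sup>2) * (\<Sum>k<q. (v $ k)\<^sup>2))"
    by (intro sum_mono Cauchy_Schwarz_ineq_sum)
  also have "\<dots> = (frob_norm A * vnorm v)\<^sup>2"
    using assms
    by (simp add: power_mult_distrib frob_norm_square_sum[OF assms(1)]
        vnorm_square_sum sum_distrib_right[symmetric])
  finally show ?thesis by (rule power2_le_imp_le) simp
qed

lemma frob_inner_mult_right:
  assumes "Z \<in> carrier_mat n p" "B \<in> carrier_mat n q" "Y \<in> carrier_mat q p"
  shows "frob_inner Z (B * Y) = frob_inner (Z * Y\<^sup>T) B"
proof -
  have "frob_inner Z (B * Y) = (\<Sum>i<n. \<Sum>j<p. \<Sum>k<q. Z $$ (i, j) * (B $$ (i, k) * Y $$ (k, j)))"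
    using assms by (subst frob_inner_eq[of _ n p]) (auto simp: scalar_prod_def atLeast0LessThan sum_distrib_left)
  also have "\<dots> = (\<Sum>i<n. \<Sum>k<q. \<Sum>j<p. Z $$ (i, j) * (B $$ (i, k) * Y $$ (k, j)))"
    by (intro sum.cong sum.swap refl)
  also have "\<dots> = frob_inner (Z * Y\<^sup>T) B"
    using assms by (subst frob_inner_eq[of _ n q]) (auto simp: scalar_prod_def atLeast0LessThan sum_distrib_right sum_distrib_left mult_ac)
  finally show ?thesis .
qed

lemma sym_mats_carrier: "X \<in> sym_mats n \<Longrightarrow> X \<in> carrier_mat n n"
  by (simp add: sym_mats_def)

lemma sym_mats_transpose: "X \<in> sym_mats n \<Longrightarrow> X\<^sup>T = X"
  by (simp add: sym_mats_def)

lemma sym_matsI: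
  assumes "X \<in> carrier_mat n n" "\<And>i j. i < n \<Longrightarrow> j < n \<Longrightarrow> X $$ (i, j) = X $$ (j, i)"
  shows "X \<in> sym_mats n"
  using assms by (auto simp: sym_mats_def)

lemma sym_mats_entry:
  assumes "X \<in> sym_mats n" "i < n" "j < n"
  shows "X $$ (i, j) = X $$ (j, i)"
proof -
  have "X\<^sup>T $$ (i, j) = X $$ (j, i)"
    using sym_mats_carrier[OF assms(1)] assms(2,3) by simp
  then show ?thesis by (simp only: sym_mats_transpose[OF assms(1)])
qed

lemma sym_mats_smult: "X \<in> sym_mats n \<Longrightarrow> c \<cdot>\<^sub>m X \<in> sym_mats n"
  using sym_mats_carrier[of X n] sym_mats_entry[of X n] by (intro sym_matsI) auto

lemma sym_mats_add:
  assumes "X \<in> sym_mats n" "X' \<in> sym_mats n"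
  shows "X + X' \<in> sym_mats n"
  using sym_mats_carrier[OF assms(1)] sym_mats_carrier[OF assms(2)]
    sym_mats_entry[OF assms(1)] sym_mats_entry[OF assms(2)]
  by (intro sym_matsI) auto

lemma mult_transpose_sym:
  assumes "Y \<in> carrier_mat n p"
  shows "Y * Y\<^sup>T \<in> sym_mats n"
  using assms by (auto simp: sym_mats_def transpose_mult[of _ n p _ n])

lemma frob_inner_transpose_sym:
  assumes "X \<in> carrier_mat n n" "S \<in> sym_mats n"
  shows "frob_inner (X\<^sup>T) S = frob_inner X S"
proof -
  have S: "S \<in> carrier_mat n n" using assms by (simp add: sym_mats_def)
  have "frob_inner (X\<^sup>T) S = (\<Sum>i<n. \<Sum>j<n. X $$ (j, i) * S $$ (j, i))"
    using assms S by (subst frob_inner_eq[of _ n n]) (auto intro!: sum.cong simp: sym_mats_entry[OF assms(2)])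
  also have "\<dots> = (\<Sum>j<n. \<Sum>i<n. X $$ (j, i) * S $$ (j, i))" by (rule sum.swap)
  finally show ?thesis using assms S by (simp add: frob_inner_eq)
qed

section \<open>The linear map, its adjoint and its operator norm\<close>

lemma lin_map_carrier [simp]: "lin_map m A X \<in> carrier_vec m" "dim_vec (lin_map m A X) = m"
  by (simp_all add: lin_map_def)

lemma adj_map_carrier [simp]: "adj_map n m A l \<in> carrier_mat n n"
    "dim_row (adj_map n m A l) = n" "dim_col (adj_map n m A l) = n"
  by (simp_all add: adj_map_def)

lemma adj_map_sym:
  assumes "\<And>k. k < m \<Longrightarrow> A k \<in> sym_mats n"
  shows "adj_map n m A l \<in> sym_mats n"
  using assms by (intro sym_matsI) (auto simp: adj_map_def intro!: sum.cong sym_mats_entry)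

lemma lin_map_add:
  assumes "\<And>k. k < m \<Longrightarrow> A k \<in> carrier_mat n n" "X \<in> carrier_mat n n" "X' \<in> carrier_mat n n"
  shows "lin_map m A (X + X') = lin_map m A X + lin_map m A X'"
  by (rule eq_vecI) (use assms in \<open>auto simp: lin_map_def intro: frob_inner_add_right\<close>)

lemma lin_map_smult:
  assumes "\<And>k. k < m \<Longrightarrow> A k \<in> carrier_mat n n" "X \<in> carrier_mat n n"
  shows "lin_map m A (c \<cdot>\<^sub>m X) = c \<cdot>\<^sub>v lin_map m A X"
  by (rule eq_vecI) (use assms in \<open>auto simp: lin_map_def intro: frob_inner_smult_right\<close>)

lemma adj_map_add:
  assumes "l \<in> carrier_vec m" "l' \<in> carrier_vec m"
  shows "adj_map n m A (l + l') = adj_map n m A l + adj_map n m A l'"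
  using assms by (auto simp: adj_map_def algebra_simps sum.distrib)

lemma adj_map_smult:
  assumes "l \<in> carrier_vec m"
  shows "adj_map n m A (c \<cdot>\<^sub>v l) = c \<cdot>\<^sub>m adj_map n m A l"
  using assms by (auto simp: adj_map_def sum_distrib_left mult_ac)

lemma frob_inner_adj_map:
  assumes "\<And>k. k < m \<Longrightarrow> A k \<in> carrier_mat n n" "l \<in> carrier_vec m" "X \<in> carrier_mat n n"
  shows "frob_inner (adj_map n m A l) X = l \<bullet> lin_map m A X"
proof -
  have "frob_inner (adj_map n m A l) X = (\<Sum>i<n. \<Sum>j<n. \<Sum>k<m. l $ k * A k $$ (i, j) * X $$ (i, j))"
    using assms by (subst frob_inner_eq[of _ n n]) (auto simp: adj_map_def sum_distrib_right)
  also have "\<dots> = (\<Sum>i<n. \<Sum>k<m. \<Sum>j<n. l $ k * A k $$ (i, j) * X $$ (i, j))"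
    by (intro sum.cong refl sum.swap)
  also have "\<dots> = (\<Sum>k<m. \<Sum>i<n. \<Sum>j<n. l $ k * A k $$ (i, j) * X $$ (i, j))"
    by (rule sum.swap)
  also have "\<dots> = l \<bullet> lin_map m A X"
    using assms by (auto simp: lin_map_def scalar_prod_def atLeast0LessThan frob_inner_eq[of _ n n] sum_distrib_left mult_ac intro!: sum.cong)
  finally show ?thesis .
qed

text \<open>Componentwise Cauchy-Schwarz. The constant is the Euclidean norm of the tuple: it makes
  the set in \<open>op_norm\<close> bounded above, so that \<open>Sup\<close> is a true supremum,
  and it is the quantity that a ball of tuples controls.\<close>

lemma vnorm_lin_map_le:
  assumes "\<And>k. k < m \<Longrightarrow> A k \<in> carrier_mat n n" "X \<in> carrier_mat n n"
  shows "vnorm (lin_map m A X) \<le> sqrt (\<Sum>k<m. (frob_norm (A k))\<^sup>2) * frob_norm X"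
proof -
  have "(vnorm (lin_map m A X))\<^sup>2 = (\<Sum>k<m. (frob_inner (A k) X)\<^sup>2)"
    by (simp add: vnorm_L2[of _ m] L2_set_def sum_nonneg) (simp add: lin_map_def)
  also have "\<dots> \<le> (\<Sum>k<m. (frob_norm (A k) * frob_norm X)\<^sup>2)"
  proof (intro sum_mono)
    fix k assume k: "k \<in> {..<m}"
    then have "\<bar>frob_inner (A k) X\<bar> \<le> frob_norm (A k) * frob_norm X"
      using assms by (intro frob_inner_abs_le) auto
    then show "(frob_inner (A k) X)\<^sup>2 \<le> (frob_norm (A k) * frob_norm X)\<^sup>2"
      by (metis abs_ge_zero power2_abs power_mono)
  qed
  also have "\<dots> = (sqrt (\<Sum>k<m. (frob_norm (A k))\<^sup>2) * frob_norm X)\<^sup>2"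
    by (simp add: power_mult_distrib sum_nonneg sum_distrib_right)
  finally show ?thesis by (rule power2_le_imp_le) (simp add: sum_nonneg)
qed

lemma vnorm_lin_map_le_op_norm:
  assumes A: "\<And>k. k < m \<Longrightarrow> A k \<in> sym_mats n" and X: "X \<in> sym_mats n"
  shows "vnorm (lin_map m A X) \<le> op_norm n m A * frob_norm X"
proof -
  let ?S = "{vnorm (lin_map m A X) | X. X \<in> sym_mats n \<and> frob_norm X \<le> 1}"
  have Ac: "\<And>k. k < m \<Longrightarrow> A k \<in> carrier_mat n n" using A sym_mats_carrier by auto
  have Xc: "X \<in> carrier_mat n n" using X sym_mats_carrier by auto
  have bdd: "bdd_above ?S"
  proof (rule bdd_aboveI)
    fix x assume "x \<in> ?S"
    then obtain X where X: "X \<in> sym_mats n" "frob_norm X \<le> 1" "x = vnorm (lin_map m A X)" by auto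
    have "x \<le> sqrt (\<Sum>k<m. (frob_norm (A k))\<^sup>2) * frob_norm X"
      using vnorm_lin_map_le[OF Ac sym_mats_carrier[OF X(1)]] X by simp
    also have "\<dots> \<le> sqrt (\<Sum>k<m. (frob_norm (A k))\<^sup>2) * 1"
      using X by (intro mult_left_mono) (auto intro: sum_nonneg)
    finally show "x \<le> sqrt (\<Sum>k<m. (frob_norm (A k))\<^sup>2) * 1" .
  qed
  show ?thesis
  proof (cases "frob_norm X = 0")
    case True
    then show ?thesis using vnorm_lin_map_le[OF Ac Xc] by simp
  next
    case False
    then have pos: "0 < frob_norm X" by (simp add: order_less_le)
    let ?X = "(1 / frob_norm X) \<cdot>\<^sub>m X"
    have "?X \<in> sym_mats n" using X by (rule sym_mats_smult)
    moreover have "frob_norm ?X \<le> 1" using pos by (simp add: frob_norm_smult)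
    ultimately have "vnorm (lin_map m A ?X) \<le> op_norm n m A"
      unfolding op_norm_def by (intro cSup_upper[OF _ bdd]) auto
    then show ?thesis using pos
      by (simp add: lin_map_smult[OF Ac Xc] vnorm_smult field_simps)
  qed
qed

lemma op_norm_nonneg:
  assumes A: "\<And>k. k < m \<Longrightarrow> A k \<in> sym_mats n" and n: "1 \<le> n"
  shows "0 \<le> op_norm n m A"
proof -
  have I: "1\<^sub>m n \<in> sym_mats n" by (intro sym_matsI) auto
  have "\<bar>1\<^sub>m n $$ (0, 0)\<bar> \<le> frob_norm (1\<^sub>m n)"
    using n by (intro entry_le_frob_norm) auto
  then have "0 < frob_norm (1\<^sub>m n)" using n by simp
  then show ?thesis
    using order_trans[OF vnorm_nonneg vnorm_lin_map_le_op_norm[where A = A and m = m, OF A I]]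
    by (simp add: zero_le_mult_iff)
qed

text \<open>This is where \<open>R_A\<close> comes from: the center contributes its operator norm,
  the deviation at most its Euclidean norm, which the ball bounds by \<sigma>.\<close>

lemma vnorm_lin_map_ball_le:
  assumes Abar: "\<And>k. k < m \<Longrightarrow> Abar k \<in> sym_mats n" and A: "A \<in> tuple_ball n m Abar \<sigma>"
    and X: "X \<in> sym_mats n"
  shows "vnorm (lin_map m A X) \<le> (op_norm n m Abar + \<sigma>) * frob_norm X"
proof -
  have Asym: "\<And>k. k < m \<Longrightarrow> A k \<in> sym_mats n" using A by (simp add: tuple_ball_def)
  have c: "\<And>k. k < m \<Longrightarrow> A k \<in> carrier_mat n n" "\<And>k. k < m \<Longrightarrow> Abar k \<in> carrier_mat n n"
    using Asym Abar sym_mats_carrier by auto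
  have Xc: "X \<in> carrier_mat n n" using X sym_mats_carrier by auto
  have dif: "\<And>k. k < m \<Longrightarrow> A k - Abar k \<in> carrier_mat n n" using c by (simp add: minus_carrier_mat)
  have "lin_map m A X = lin_map m Abar X + lin_map m (\<lambda>k. A k - Abar k) X"
    using c Xc by (intro eq_vecI) (auto simp: lin_map_def frob_inner_diff_left[of _ n n])
  then have "vnorm (lin_map m A X) \<le> vnorm (lin_map m Abar X) + vnorm (lin_map m (\<lambda>k. A k - Abar k) X)"
    using vnorm_add_le[of "lin_map m Abar X" m "lin_map m (\<lambda>k. A k - Abar k) X"] by simp
  also have "vnorm (lin_map m Abar X) \<le> op_norm n m Abar * frob_norm X"
    by (rule vnorm_lin_map_le_op_norm[OF Abar X])
  also have "vnorm (lin_map m (\<lambda>k. A k - Abar k) X) \<le> \<sigma> * frob_norm X"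
    by (rule order_trans[OF vnorm_lin_map_le[OF dif Xc] mult_right_mono])
      (use A in \<open>auto simp: tuple_ball_def\<close>)
  finally show ?thesis by (simp add: algebra_simps)
qed

section \<open>Sets with thin sections and nets of the sphere\<close>

interpretation lborel_prod: product_sigma_finite "\<lambda>_::'i. lborel :: real measure"
  by standard

abbreviation "lborel_on I \<equiv> PiM I (\<lambda>_. lborel :: real measure)"

text \<open>Translation and scaling act on each coordinate separately, and a product measure is
  determined by its values on boxes, so the one-dimensional change of variables suffices. The factor
  \<open>c ^ card I\<close> is the Jacobian.\<close>

lemma emeasure_PiM_lborel_affine:
  fixes c :: real
  assumes I: "finite I" and c: "0 < c" and B: "B \<in> sets (lborel_on I)"
  shows "emeasure (lborel_on I) B =
    ennreal (c ^ card I) * emeasure (lborel_on I)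
      ((\<lambda>a. \<lambda>i\<in>I. t i + c * a i) -` B \<inter> space (lborel_on I))"
proof -
  let ?M = "lborel_on I"
  let ?T = "\<lambda>a. \<lambda>i\<in>I. t i + c * a i"
  have T[measurable]: "?T \<in> measurable ?M ?M"
    by measurable
  let ?P = "density (distr ?M ?M ?T) (\<lambda>_. ennreal (c ^ card I))"
  have "?M = ?P"
  proof (rule lborel_prod.PiM_eqI[OF I, symmetric])
    fix A assume A: "\<And>i. i \<in> I \<Longrightarrow> A i \<in> sets (lborel :: real measure)"
    have vim: "?T -` (Pi\<^sub>E I A) \<inter> space ?M = Pi\<^sub>E I (\<lambda>i. (\<lambda>x. t i + c * x) -` A i)"
      by (auto simp: space_PiM PiE_iff extensional_def)
    have one: "ennreal c * emeasure lborel ((\<lambda>x. t i + c * x) -` A i) = emeasure lborel (A i)"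
      if "i \<in> I" for i
    proof -
      have [measurable]: "A i \<in> sets borel" using A[OF that] by simp
      have "emeasure lborel (A i) =
          emeasure (density (distr lborel borel (\<lambda>x. t i + c * x)) (\<lambda>_. ennreal \<bar>c\<bar>)) (A i)"
        using c lborel_real_affine[of c "t i"] by simp
      also have "\<dots> = ennreal c * emeasure lborel ((\<lambda>x. t i + c * x) -` A i)"
        using c by (simp add: emeasure_density_const emeasure_distr)
      finally show ?thesis by simp
    qed
    have "emeasure ?P (Pi\<^sub>E I A) = ennreal (c ^ card I) * emeasure ?M (Pi\<^sub>E I (\<lambda>i. (\<lambda>x. t i + c * x) -` A i))"
      using I A by (simp add: emeasure_density_const emeasure_distr vim)
    also have "\<dots> = ennreal (c ^ card I) * (\<Prod>i\<in>I. emeasure lborel ((\<lambda>x. t i + c * x) -` A i))"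
    proof -
      have "(\<lambda>x. t i + c * x) -` A i \<in> sets lborel" if "i \<in> I" for i
        using measurable_sets[of "\<lambda>x. t i + c * x" lborel lborel "A i"] A[OF that] by simp
      then show ?thesis using I by (simp add: lborel_prod.emeasure_PiM)
    qed
    also have "\<dots> = (\<Prod>i\<in>I. ennreal c * emeasure lborel ((\<lambda>x. t i + c * x) -` A i))"
      using c by (simp add: prod.distrib ennreal_power)
    also have "\<dots> = (\<Prod>i\<in>I. emeasure lborel (A i))"
      using one by (intro prod.cong) auto
    finally show "emeasure ?P (Pi\<^sub>E I A) = (\<Prod>i\<in>I. emeasure lborel (A i))" .
  qed simp
  then have "emeasure ?M B = emeasure ?P B" by metis
  then show ?thesis
    using B by (simp add: emeasure_density_const emeasure_distr)
qed

text \<open>In coordinates on and above the diagonal, a Frobenius ball of symmetric matrices is an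
  ellipsoid, because an off-diagonal coordinate stands for two entries. The weights \<open>w\<close>
  record this.\<close>

definition ellipsoid :: "'i set \<Rightarrow> ('i \<Rightarrow> real) \<Rightarrow> ('i \<Rightarrow> real) \<Rightarrow> real \<Rightarrow> ('i \<Rightarrow> real) set" where
  "ellipsoid I w c r = {a \<in> space (lborel_on I). (\<Sum>i\<in>I. w i * (a i - c i)\<^sup>2) \<le> r\<^sup>2}"

lemma sets_ellipsoid [measurable]:
  "finite I \<Longrightarrow> ellipsoid I w c r \<in> sets (lborel_on I)"
  unfolding ellipsoid_def by measurable

text \<open>Dilation about the center. The alternative \<open>I = {}\<close> admits radius 0, which
  occurs when the block exhausts all coordinates and nothing is left for the complement.\<close>

lemma emeasure_ellipsoid:
  assumes I: "finite I" and r: "0 < r \<or> I = {}"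
  shows "emeasure (lborel_on I) (ellipsoid I w c r) =
    ennreal (r ^ card I) * emeasure (lborel_on I) (ellipsoid I w (\<lambda>_. 0) 1)"
proof (cases "I = {}")
  case True
  then show ?thesis by (simp add: ellipsoid_def)
next
  case False
  with r have r: "0 < r" by simp
  have "(\<Sum>i\<in>I. w i * (r * a i)\<^sup>2) = r\<^sup>2 * (\<Sum>i\<in>I. w i * (a i)\<^sup>2)" for a :: "_ \<Rightarrow> real"
    by (simp add: sum_distrib_left power_mult_distrib mult_ac)
  then have "(\<Sum>i\<in>I. w i * (r * a i)\<^sup>2) \<le> r\<^sup>2 \<longleftrightarrow> (\<Sum>i\<in>I. w i * (a i)\<^sup>2) \<le> 1" for a :: "_ \<Rightarrow> real"
    using r by simp
  then have "(\<lambda>a. \<lambda>i\<in>I. c i + r * a i) -` ellipsoid I w c r \<inter> space (lborel_on I) =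
      ellipsoid I w (\<lambda>_. 0) 1"
    by (auto simp: ellipsoid_def space_PiM)
  then show ?thesis
    using emeasure_PiM_lborel_affine[OF I r sets_ellipsoid[OF I, of w c r], of c] by simp
qed

text \<open>Comparison with an outer and an inner cube. The volume itself is never computed: it will
  occur in a numerator and in a denominator and only has to be cancellable.\<close>

lemma emeasure_unit_ellipsoid:
  assumes I: "finite I" and w: "\<And>i. i \<in> I \<Longrightarrow> 1 \<le> w i"
  shows "emeasure (lborel_on I) (ellipsoid I w (\<lambda>_. 0) 1) < \<infinity>"
    and "0 < emeasure (lborel_on I) (ellipsoid I w (\<lambda>_. 0) 1)"
proof -
  let ?M = "lborel_on I"
  have "ellipsoid I w (\<lambda>_. 0) 1 \<subseteq> Pi\<^sub>E I (\<lambda>_. {-1..1})"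
  proof
    fix a assume a: "a \<in> ellipsoid I w (\<lambda>_. 0) 1"
    have "a i \<in> {-1..1}" if i: "i \<in> I" for i
    proof -
      have "(a i)\<^sup>2 \<le> w i * (a i)\<^sup>2" using w[OF i] by (simp add: mult_le_cancel_right1)
      also have "\<dots> \<le> (\<Sum>i\<in>I. w i * (a i)\<^sup>2)"
        using I i w by (intro member_le_sum) (auto intro!: mult_nonneg_nonneg order_trans[OF _ w])
      also have "\<dots> \<le> 1" using a by (simp add: ellipsoid_def)
      finally show ?thesis using abs_square_le_1 abs_le_iff by (auto simp: abs_le_iff)
    qed
    then show "a \<in> Pi\<^sub>E I (\<lambda>_. {-1..1})"
      using a by (auto simp: ellipsoid_def space_PiM PiE_iff)
  qed
  then have "emeasure ?M (ellipsoid I w (\<lambda>_. 0) 1) \<le> emeasure ?M (Pi\<^sub>E I (\<lambda>_. {-1..1}))"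
    using I by (intro emeasure_mono sets_PiM_I_finite) auto
  also have "\<dots> < \<infinity>"
    using I by (simp add: lborel_prod.emeasure_PiM power_less_top_ennreal)
  finally show "emeasure ?M (ellipsoid I w (\<lambda>_. 0) 1) < \<infinity>" .
  \<comment> \<open>Half-side of the inner cube: since \<open>q \<le> 1\<close>, the weighted sum of
    squares is at most \<open>q\<close> times the sum of the weights, hence at most 1.\<close>
  define q where "q = 1 / (1 + (\<Sum>i\<in>I. w i))"
  have w0: "0 \<le> (\<Sum>i\<in>I. w i)" by (intro sum_nonneg) (auto intro: order_trans[OF _ w])
  have q: "0 < q" "q \<le> 1" using w0 by (auto simp: q_def)
  have "Pi\<^sub>E I (\<lambda>_. {-q..q}) \<subseteq> ellipsoid I w (\<lambda>_. 0) 1"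
  proof
    fix a assume a: "a \<in> Pi\<^sub>E I (\<lambda>_. {-q..q})"
    have "(\<Sum>i\<in>I. w i * (a i)\<^sup>2) \<le> (\<Sum>i\<in>I. w i * q)"
    proof (intro sum_mono mult_left_mono)
      fix i assume i: "i \<in> I"
      then have "\<bar>a i\<bar> \<le> q" using a by (auto simp: PiE_iff)
      then have "(a i)\<^sup>2 \<le> q\<^sup>2" by (metis abs_ge_zero power2_abs power_mono)
      also have "\<dots> \<le> q" using q by (simp add: power2_eq_square mult_left_le_one_le)
      finally show "(a i)\<^sup>2 \<le> q" .
      show "0 \<le> w i" using w[OF i] by simp
    qed
    also have "\<dots> \<le> 1" using w0 by (simp add: q_def sum_divide_distrib[symmetric])
    finally show "a \<in> ellipsoid I w (\<lambda>_. 0) 1"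
      using a by (auto simp: ellipsoid_def space_PiM PiE_iff)
  qed
  then have "emeasure ?M (Pi\<^sub>E I (\<lambda>_. {-q..q})) \<le> emeasure ?M (ellipsoid I w (\<lambda>_. 0) 1)"
    using I by (intro emeasure_mono) auto
  moreover have "0 < emeasure ?M (Pi\<^sub>E I (\<lambda>_. {-q..q}))"
    using I q by (simp add: lborel_prod.emeasure_PiM zero_less_iff_neq_zero)
  ultimately show "0 < emeasure ?M (ellipsoid I w (\<lambda>_. 0) 1)" by order
qed

lemma sum_merge:
  assumes "I \<inter> J = {}" "finite I" "finite J"
  shows "(\<Sum>i\<in>I \<union> J. h i (merge I J (x, y) i)) = (\<Sum>i\<in>I. h i (x i)) + (\<Sum>i\<in>J. h i (y i) :: real)"
proof -
  have "(\<Sum>i\<in>I. h i (merge I J (x, y) i)) = (\<Sum>i\<in>I. h i (x i))"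
    by (intro sum.cong) (auto simp: merge_def)
  moreover have "(\<Sum>i\<in>J. h i (merge I J (x, y) i)) = (\<Sum>i\<in>J. h i (y i))"
    using assms by (intro sum.cong) (auto simp: merge_def)
  ultimately show ?thesis using assms by (simp add: sum.union_disjoint)
qed

lemma sets_PiM_section:
  assumes "I \<inter> J = {}" "finite I" "finite J" and x: "x \<in> space (lborel_on I)"
    and B: "B \<in> sets (lborel_on (I \<union> J))"
  shows "{y \<in> space (lborel_on J). merge I J (x, y) \<in> B} \<in> sets (lborel_on J)"
proof -
  have "(\<lambda>y. merge I J (x, y)) \<in> measurable (lborel_on J) (lborel_on (I \<union> J))"
    using x by measurable
  from measurable_sets[OF this B] show ?thesis by (simp add: vimage_def Int_def conj_commute)
qed

lemma emeasure_PiM_fold: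
  assumes IJ: "I \<inter> J = {}" "finite I" "finite J" and B: "B \<in> sets (lborel_on (I \<union> J))"
  shows "emeasure (lborel_on (I \<union> J)) B =
    (\<integral>\<^sup>+x. emeasure (lborel_on J) {y \<in> space (lborel_on J). merge I J (x, y) \<in> B} \<partial>lborel_on I)"
proof -
  have "emeasure (lborel_on (I \<union> J)) B =
     (\<integral>\<^sup>+x. (\<integral>\<^sup>+y. indicator B (merge I J (x, y)) \<partial>lborel_on J) \<partial>lborel_on I)"
    using IJ B by (subst lborel_prod.product_nn_integral_fold[symmetric]) auto
  also have "\<dots> = (\<integral>\<^sup>+x. emeasure (lborel_on J) {y \<in> space (lborel_on J). merge I J (x, y) \<in> B} \<partial>lborel_on I)"
  proof (rule nn_integral_cong)
    fix x assume "x \<in> space (lborel_on I)"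
    note S = sets_PiM_section[OF IJ this B]
    show "(\<integral>\<^sup>+y. indicator B (merge I J (x, y)) \<partial>lborel_on J) =
        emeasure (lborel_on J) {y \<in> space (lborel_on J). merge I J (x, y) \<in> B}"
      unfolding nn_integral_indicator[OF S, symmetric]
      by (intro nn_integral_cong) (auto simp: indicator_def)
  qed
  finally show ?thesis .
qed

text \<open>Fubini with \<open>J\<close> as the inner variables. The hypothesis \<open>thin\<close>
  confines each section of \<open>B\<close> to an ellipsoid of radius \<open>r\<close>, while the
  other coordinates range over one of radius \<sigma>; each of the \<open>card J\<close> thin
  directions thus saves a factor of order \<open>r / \<sigma>\<close>.\<close>

lemma prob_thin_sections_le:
  fixes w :: "'i \<Rightarrow> real"
  assumes I: "finite I" and J: "J \<subseteq> I" "J \<noteq> {}" and w: "\<And>i. i \<in> I \<Longrightarrow> 1 \<le> w i"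
    and \<sigma>: "0 < \<sigma>" and r: "0 < r" and B: "B \<in> sets (lborel_on I)"
    and thin: "\<And>a a'. a \<in> B \<Longrightarrow> a' \<in> B \<Longrightarrow> (\<And>i. i \<in> I - J \<Longrightarrow> a i = a' i) \<Longrightarrow>
      (\<Sum>i\<in>J. w i * (a i - a' i)\<^sup>2) \<le> r\<^sup>2"
  shows "measure (uniform_measure (lborel_on I) (ellipsoid I w c \<sigma>)) B \<le>
    (sqrt (exp 1 * real (card I) / real (card J)) * r / \<sigma>) ^ card J"
proof -
  define R where "R = I - J"
  have RJ: "R \<inter> J = {}" "finite R" "finite J" "R \<union> J = I"
    using I J finite_subset by (auto simp: R_def)
  define N D where "N = card I" and "D = card J"
  have D: "0 < D" "D \<le> N" using I J RJ by (auto simp: N_def D_def card_gt_0_iff card_mono)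
  have cR: "card R = N - D" using J RJ I by (simp add: R_def N_def D_def card_Diff_subset)
  let ?MI = "lborel_on I"
  let ?MJ = "lborel_on J"
  let ?MR = "lborel_on R"
  define vR where "vR = measure ?MR (ellipsoid R w (\<lambda>_. 0) 1)"
  define vJ where "vJ = measure ?MJ (ellipsoid J w (\<lambda>_. 0) 1)"
  have wR: "\<And>i. i \<in> R \<Longrightarrow> 1 \<le> w i" and wJ: "\<And>i. i \<in> J \<Longrightarrow> 1 \<le> w i" using w J by (auto simp: R_def)
  have evR: "emeasure ?MR (ellipsoid R w (\<lambda>_. 0) 1) = ennreal vR"
    using emeasure_unit_ellipsoid(1)[of R w, OF RJ(2) wR] by (simp add: vR_def emeasure_eq_ennreal_measure)
  have evJ: "emeasure ?MJ (ellipsoid J w (\<lambda>_. 0) 1) = ennreal vJ"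
    using emeasure_unit_ellipsoid(1)[of J w, OF RJ(3) wJ] by (simp add: vJ_def emeasure_eq_ennreal_measure)
  have vpos: "0 < vR" "0 < vJ"
    using emeasure_unit_ellipsoid(2)[of J w, OF RJ(3) wJ] emeasure_unit_ellipsoid(2)[of R w, OF RJ(2) wR]
    by (auto simp: evR evJ)
  let ?E = "ellipsoid I w c \<sigma>"
  have E[measurable]: "?E \<in> sets ?MI" using I by simp
  have inE: "merge R J (x, y) \<in> ?E \<longleftrightarrow>
      (\<Sum>i\<in>R. w i * (x i - c i)\<^sup>2) + (\<Sum>i\<in>J. w i * (y i - c i)\<^sup>2) \<le> \<sigma>\<^sup>2"
    if "x \<in> space ?MR" "y \<in> space ?MJ" for x y
  proof -
    have "merge R J (x, y) \<in> space ?MI"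
      using that RJ(4) by (auto simp: space_PiM)
    then show ?thesis using sum_merge[OF RJ(1-3), of "\<lambda>i z. w i * (z - c i)\<^sup>2" x y]
      by (simp add: ellipsoid_def RJ(4))
  qed
  have upper: "emeasure ?MI (?E \<inter> B) \<le> ennreal (r ^ D * vJ * (\<sigma> ^ (N - D) * vR))"
  proof -
    have "emeasure ?MI (?E \<inter> B) = (\<integral>\<^sup>+x. emeasure ?MJ {y \<in> space ?MJ. merge R J (x, y) \<in> ?E \<inter> B} \<partial>?MR)"
      using emeasure_PiM_fold[OF RJ(1-3), of "?E \<inter> B"] B by (simp add: RJ(4))
    also have "\<dots> \<le> (\<integral>\<^sup>+x. ennreal (r ^ D * vJ) * indicator (ellipsoid R w c \<sigma>) x \<partial>?MR)"
    proof (rule nn_integral_mono)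
      fix x assume x: "x \<in> space ?MR"
      show "emeasure ?MJ {y \<in> space ?MJ. merge R J (x, y) \<in> ?E \<inter> B} \<le>
          ennreal (r ^ D * vJ) * indicator (ellipsoid R w c \<sigma>) x" (is "emeasure _ ?S \<le> _")
      proof (cases "?S = {}")
        case False
        then obtain y where y: "y \<in> space ?MJ" "merge R J (x, y) \<in> ?E" "merge R J (x, y) \<in> B" by auto
        have "0 \<le> (\<Sum>i\<in>J. w i * (y i - c i)\<^sup>2)"
          by (intro sum_nonneg mult_nonneg_nonneg) (auto intro: order_trans[OF _ wJ])
        then have xE: "x \<in> ellipsoid R w c \<sigma>"
          using inE[OF x y(1)] y(2) x by (auto simp: ellipsoid_def)
        \<comment> \<open>The center is a point \<open>y\<close> of the section itself, because
          \<open>thin\<close> only controls distances between points of \<open>B\<close>.\<close>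
        have "?S \<subseteq> ellipsoid J w y r"
        proof
          fix z assume z: "z \<in> ?S"
          have "(\<Sum>i\<in>J. w i * (merge R J (x, z) i - merge R J (x, y) i)\<^sup>2) \<le> r\<^sup>2"
            using z y by (intro thin) (auto simp: merge_def R_def)
          moreover have "(\<Sum>i\<in>J. w i * (merge R J (x, z) i - merge R J (x, y) i)\<^sup>2) =
              (\<Sum>i\<in>J. w i * (z i - y i)\<^sup>2)"
            using RJ(1) by (intro sum.cong) (auto simp: merge_def)
          ultimately show "z \<in> ellipsoid J w y r" using z by (simp add: ellipsoid_def)
        qed
        then have "emeasure ?MJ ?S \<le> emeasure ?MJ (ellipsoid J w y r)"
          using RJ by (intro emeasure_mono) auto
        also have "\<dots> = ennreal (r ^ D * vJ)"
          using r vpos by (simp add: emeasure_ellipsoid[OF RJ(3)] evJ D_def ennreal_mult)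
        finally show ?thesis using xE by simp
      qed (simp only: emeasure_empty zero_le)
    qed
    also have "\<dots> = ennreal (r ^ D * vJ) * emeasure ?MR (ellipsoid R w c \<sigma>)"
      using RJ by (intro nn_integral_cmult_indicator) auto
    also have "\<dots> = ennreal (r ^ D * vJ * (\<sigma> ^ (N - D) * vR))"
      using r \<sigma> vpos by (simp add: emeasure_ellipsoid[OF RJ(2)] evR cR ennreal_mult)
    finally show ?thesis .
  qed
  \<comment> \<open>The ellipsoid contains a product of ellipsoids in the coordinates \<open>R\<close> and \<open>J\<close>. Comparing it with
    the product bounding \<open>B\<close> from above cancels the volumes of the unit ellipsoids, so that they
    need not be computed; the radii below nearly optimize the comparison.\<close>
  define q where "q = real D / real N"
  have q: "0 < q" "q \<le> 1" using D by (auto simp: q_def)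
  define s1 s2 where "s1 = \<sigma> * sqrt (1 - q)" and "s2 = \<sigma> * sqrt q"
  have s1: "0 < s1 \<or> R = {}"
  proof (cases "R = {}")
    case False
    then have "D < N" using cR RJ card_gt_0_iff by fastforce
    then show ?thesis using \<sigma> by (simp add: s1_def q_def)
  qed simp
  have s10: "0 \<le> s1" using \<sigma> q by (simp add: s1_def)
  have s2: "0 < s2" using \<sigma> q by (simp add: s2_def)
  have ss: "s1\<^sup>2 + s2\<^sup>2 = \<sigma>\<^sup>2" using q by (simp add: s1_def s2_def power_mult_distrib algebra_simps)
  have lower: "ennreal (s2 ^ D * vJ * (s1 ^ (N - D) * vR)) \<le> emeasure ?MI ?E"
  proof -
    have "ennreal (s2 ^ D * vJ * (s1 ^ (N - D) * vR)) = ennreal (s2 ^ D * vJ) * emeasure ?MR (ellipsoid R w c s1)"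
      using s1 s10 s2 vpos by (simp add: emeasure_ellipsoid[OF RJ(2) s1] evR cR ennreal_mult)
    also have "\<dots> = (\<integral>\<^sup>+x. ennreal (s2 ^ D * vJ) * indicator (ellipsoid R w c s1) x \<partial>?MR)"
      using RJ by (intro nn_integral_cmult_indicator[symmetric]) auto
    also have "\<dots> \<le> (\<integral>\<^sup>+x. emeasure ?MJ {y \<in> space ?MJ. merge R J (x, y) \<in> ?E} \<partial>?MR)"
    proof (rule nn_integral_mono)
      fix x assume x: "x \<in> space ?MR"
      show "ennreal (s2 ^ D * vJ) * indicator (ellipsoid R w c s1) x \<le>
        emeasure ?MJ {y \<in> space ?MJ. merge R J (x, y) \<in> ?E}"  (is "_ \<le> emeasure _ ?S")
      proof (cases "x \<in> ellipsoid R w c s1")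
        case True
        have "ellipsoid J w c s2 \<subseteq> ?S"
        proof
          fix y assume y: "y \<in> ellipsoid J w c s2"
          then have "y \<in> space ?MJ" by (simp add: ellipsoid_def)
          then show "y \<in> ?S"
            using True y ss inE[OF x] by (simp add: ellipsoid_def)
        qed
        moreover have "?S \<in> sets ?MJ"
          using sets_PiM_section[OF RJ(1-3) x] E by (simp add: RJ(4))
        ultimately have "emeasure ?MJ (ellipsoid J w c s2) \<le> emeasure ?MJ ?S" by (intro emeasure_mono)
        moreover have "emeasure ?MJ (ellipsoid J w c s2) = ennreal (s2 ^ D * vJ)"
          using s2 vpos by (simp add: emeasure_ellipsoid[OF RJ(3)] evJ D_def ennreal_mult)
        ultimately show ?thesis using True by simp
      qed simp
    qed
    also have "\<dots> = emeasure ?MI ?E"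
      using emeasure_PiM_fold[OF RJ(1-3), of "?E"] E by (simp add: RJ(4))
    finally show ?thesis .
  qed
  have Efin: "emeasure ?MI ?E < \<infinity>"
  proof -
    have "emeasure ?MI (ellipsoid I w (\<lambda>_. 0) 1) < \<infinity>"
      using I w by (rule emeasure_unit_ellipsoid(1))
    moreover have "emeasure ?MI ?E = ennreal (\<sigma> ^ card I) * emeasure ?MI (ellipsoid I w (\<lambda>_. 0) 1)"
      using \<sigma> by (intro emeasure_ellipsoid[OF I]) simp
    ultimately show ?thesis by (simp add: ennreal_mult_less_top)
  qed
  have m_up: "measure ?MI (?E \<inter> B) \<le> r ^ D * vJ * (\<sigma> ^ (N - D) * vR)"
    unfolding measure_def using upper r \<sigma> vpos by (intro enn2real_leI) auto
  have m_lo: "s2 ^ D * vJ * (s1 ^ (N - D) * vR) \<le> measure ?MI ?E"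
  proof -
    have "ennreal (s2 ^ D * vJ * (s1 ^ (N - D) * vR)) \<le> ennreal (measure ?MI ?E)"
      using lower Efin by (simp add: emeasure_eq_ennreal_measure)
    then show ?thesis by (simp only: ennreal_le_iff measure_nonneg)
  qed
  \<comment> \<open>From 1 / (1 - q) = 1 + D / (N - D) \<le> exp (D / (N - D)): shrinking the
    complementary ellipsoid costs only a factor sqrt e per coordinate in \<open>J\<close>, however
    many other coordinates there are.\<close>
  have exp_bound: "1 \<le> exp (real D) * (1 - q) ^ (N - D)"
  proof (cases "D = N")
    case False
    then have DN: "0 < real N - real D" using D by simp
    have "1 / (1 - q) = 1 + real D / (real N - real D)"
      using D False by (simp add: q_def field_simps)
    also have "\<dots> \<le> exp (real D / (real N - real D))" using exp_ge_add_one_self by auto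
    finally have "(1 / (1 - q)) ^ (N - D) \<le> exp (real D / (real N - real D)) ^ (N - D)"
      using q by (intro power_mono) auto
    also have "\<dots> = exp (real D)"
    proof -
      have "exp (real D / (real N - real D)) ^ (N - D) = exp (real (N - D) * (real D / (real N - real D)))"
        by (rule exp_of_nat_mult[symmetric])
      also have "real (N - D) * (real D / (real N - real D)) = real D"
        using D DN by (simp add: of_nat_diff)
      finally show ?thesis .
    qed
    finally show ?thesis
      using D False by (simp add: power_one_over q_def field_simps)
  qed (simp add: q_def)
  have pos: "0 < s2 ^ D * vJ * (s1 ^ (N - D) * vR)"
  proof -
    have "0 < s1 ^ (N - D)" using s1 cR by (auto simp: zero_less_power)
    then show ?thesis using s2 vpos by simp
  qed
  have Ipos: "0 < measure ?MI ?E" using m_lo pos by linarith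
  have "measure (uniform_measure ?MI ?E) B = measure ?MI (?E \<inter> B) / measure ?MI ?E"
    using Efin Ipos by (subst measure_uniform_measure) (auto simp: measure_def B emeasure_eq_0_AE)
  also have "\<dots> \<le> (r ^ D * vJ * (\<sigma> ^ (N - D) * vR)) / (s2 ^ D * vJ * (s1 ^ (N - D) * vR))"
    using m_up m_lo pos r \<sigma> vpos by (intro frac_le) auto
  also have "\<dots> = (r ^ D * \<sigma> ^ (N - D)) / (s2 ^ D * s1 ^ (N - D))"
    using vpos by simp
  also have "\<dots> = (r / \<sigma>) ^ D / (sqrt q ^ D * sqrt (1 - q) ^ (N - D))"
    using \<sigma> by (simp add: s1_def s2_def power_mult_distrib power_divide)
  also have "\<dots> \<le> (sqrt (exp 1 / q) * (r / \<sigma>)) ^ D"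
  proof -
    have nz: "0 < sqrt (1 - q) ^ (N - D)"
    proof (cases "R = {}")
      case False
      then have "0 < sqrt (1 - q)" using s1 \<sigma> by (simp add: s1_def zero_less_mult_iff)
      then show ?thesis by simp
    qed (use cR in simp)
    have "1 \<le> sqrt (exp (real D) * (1 - q) ^ (N - D))" using exp_bound by simp
    also have "\<dots> = sqrt (exp 1) ^ D * sqrt (1 - q) ^ (N - D)"
      using exp_of_nat_mult[of D "1::real"] by (simp add: real_sqrt_mult real_sqrt_power)
    finally have "1 / sqrt (1 - q) ^ (N - D) \<le> sqrt (exp 1) ^ D"
      using nz by (simp add: field_simps)
    then have "1 / sqrt (1 - q) ^ (N - D) * ((r / \<sigma>) ^ D / sqrt q ^ D) \<le> sqrt (exp 1) ^ D * ((r / \<sigma>) ^ D / sqrt q ^ D)"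
      using r \<sigma> q by (intro mult_right_mono) auto
    then show ?thesis by (simp add: power_mult_distrib power_divide real_sqrt_divide mult_ac)
  qed
  also have "exp 1 / q = exp 1 * real (card I) / real (card J)" using D by (simp add: q_def N_def D_def)
  finally show ?thesis by (simp add: D_def)
qed

section \<open>Packing bound and nets of the unit sphere\<close>

definition unit_sphere :: "nat \<Rightarrow> (nat \<Rightarrow> real) set" where
  "unit_sphere m = {u \<in> extensional {..<m}. L2_set u {..<m} = 1}"

text \<open>Balls of radius \<theta> / 2 around the points of \<open>T\<close> are disjoint and lie
  in the ball of radius 1 + \<theta> / 2; comparing volumes bounds their number.\<close>

lemma sphere_separated_card_le:
  assumes \<theta>: "0 < \<theta>" and T: "finite T" "T \<subseteq> unit_sphere m"
    and sep: "\<And>u v. u \<in> T \<Longrightarrow> v \<in> T \<Longrightarrow> u \<noteq> v \<Longrightarrow> \<theta> < L2_set (\<lambda>i. u i - v i) {..<m}"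
  shows "real (card T) \<le> (1 + 2 / \<theta>) ^ m"
proof -
  let ?M = "lborel_on {..<m}"
  let ?B = "\<lambda>c r. ellipsoid {..<m} (\<lambda>_. 1) c r"
  define V where "V = measure ?M (?B (\<lambda>_. 0) 1)"
  have eV: "emeasure ?M (?B (\<lambda>_. 0) 1) = ennreal V"
    using emeasure_unit_ellipsoid(1)[of "{..<m}" "\<lambda>_. 1"] by (simp add: V_def emeasure_eq_ennreal_measure)
  have V: "0 < V" using emeasure_unit_ellipsoid(2)[of "{..<m}" "\<lambda>_. 1"] by (simp add: eV)
  have eB: "emeasure ?M (?B c r) = ennreal (r ^ m * V)" if "0 < r" for c r
    using emeasure_ellipsoid[of "{..<m}" r "\<lambda>_. 1" c] that V by (simp add: eV ennreal_mult)
  have inB: "L2_set (\<lambda>i. a i - c i) {..<m} \<le> r \<longleftrightarrow> a \<in> ?B c r"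
    if "a \<in> space ?M" "0 < r" for a c r
    using that real_sqrt_le_iff[of "\<Sum>i<m. (a i - c i)\<^sup>2" "r\<^sup>2"]
    by (simp add: ellipsoid_def L2_set_def)
  have disj: "disjoint_family_on (\<lambda>v. ?B v (\<theta> / 2)) T"
    unfolding disjoint_family_on_def
  proof (intro ballI impI, rule ccontr)
    fix u v assume uv: "u \<in> T" "v \<in> T" "u \<noteq> v" and "?B u (\<theta> / 2) \<inter> ?B v (\<theta> / 2) \<noteq> {}"
    then obtain a where a: "a \<in> ?B u (\<theta> / 2)" "a \<in> ?B v (\<theta> / 2)" by auto
    have "a \<in> space ?M" using a by (simp add: ellipsoid_def)
    then have *: "L2_set (\<lambda>i. a i - u i) {..<m} \<le> \<theta> / 2" "L2_set (\<lambda>i. a i - v i) {..<m} \<le> \<theta> / 2"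
      using a inB[of a "\<theta> / 2" u] inB[of a "\<theta> / 2" v] \<theta> by simp_all
    have "L2_set (\<lambda>i. u i - v i) {..<m} = L2_set (\<lambda>i. (a i - v i) + (u i - a i)) {..<m}"
      by (simp add: algebra_simps)
    also have "\<dots> \<le> L2_set (\<lambda>i. a i - v i) {..<m} + L2_set (\<lambda>i. u i - a i) {..<m}"
      by (rule L2_set_triangle_ineq)
    also have "L2_set (\<lambda>i. u i - a i) {..<m} = L2_set (\<lambda>i. a i - u i) {..<m}"
      by (simp add: L2_set_def power2_commute)
    finally show False using sep[OF uv] * by simp
  qed
  have sub: "(\<Union>v\<in>T. ?B v (\<theta> / 2)) \<subseteq> ?B (\<lambda>_. 0) (1 + \<theta> / 2)"
  proof
    fix a assume "a \<in> (\<Union>v\<in>T. ?B v (\<theta> / 2))"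
    then obtain v where v: "v \<in> T" "a \<in> ?B v (\<theta> / 2)" by auto
    have a: "a \<in> space ?M" using v by (simp add: ellipsoid_def)
    have "L2_set a {..<m} = L2_set (\<lambda>i. (a i - v i) + v i) {..<m}" by simp
    also have "\<dots> \<le> L2_set (\<lambda>i. a i - v i) {..<m} + L2_set v {..<m}" by (rule L2_set_triangle_ineq)
    also have "\<dots> \<le> \<theta> / 2 + 1"
    proof (rule add_mono)
      show "L2_set (\<lambda>i. a i - v i) {..<m} \<le> \<theta> / 2" using inB[OF a, of "\<theta> / 2" v] v(2) \<theta> by simp
      show "L2_set v {..<m} \<le> 1" using v(1) T(2) by (auto simp: unit_sphere_def)
    qed
    finally show "a \<in> ?B (\<lambda>_. 0) (1 + \<theta> / 2)" using inB[OF a, of "1 + \<theta> / 2" "\<lambda>_. 0"] \<theta> by simp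
  qed
  have "ennreal (real (card T) * ((\<theta> / 2) ^ m * V)) = (\<Sum>v\<in>T. emeasure ?M (?B v (\<theta> / 2)))"
    using \<theta> V by (simp add: eB ennreal_mult ennreal_of_nat_eq_real_of_nat)
  also have "\<dots> = emeasure ?M (\<Union>v\<in>T. ?B v (\<theta> / 2))"
    using disj T(1) by (intro sum_emeasure) auto
  also have "\<dots> \<le> emeasure ?M (?B (\<lambda>_. 0) (1 + \<theta> / 2))"
    using sub by (intro emeasure_mono) auto
  also have "\<dots> = ennreal ((1 + \<theta> / 2) ^ m * V)" using \<theta> by (simp add: eB)
  finally have "real (card T) * ((\<theta> / 2) ^ m * V) \<le> (1 + \<theta> / 2) ^ m * V"
    using \<theta> V by (subst (asm) ennreal_le_iff) auto
  then have "real (card T) * (\<theta> / 2) ^ m \<le> (1 + \<theta> / 2) ^ m" using V by simp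
  then have "real (card T) \<le> ((1 + \<theta> / 2) / (\<theta> / 2)) ^ m"
    using \<theta> by (simp only: power_divide[of "1 + \<theta> / 2"] pos_le_divide_eq zero_less_power half_gt_zero)
  also have "(1 + \<theta> / 2) / (\<theta> / 2) = 1 + 2 / \<theta>" using \<theta> by (simp add: field_simps)
  finally show ?thesis .
qed

text \<open>A separated set of largest cardinality is a net, since an uncovered point could be
  added; the packing bound makes a largest cardinality exist. The net lies on the sphere itself, so
  each of its points has a coordinate of square at least 1 / m.\<close>

lemma sphere_net:
  assumes \<theta>: "0 < \<theta>"
  obtains T where "finite T" "T \<subseteq> unit_sphere m" "real (card T) \<le> (1 + 2 / \<theta>) ^ m"
    "\<And>u. u \<in> unit_sphere m \<Longrightarrow> \<exists>v\<in>T. L2_set (\<lambda>i. u i - v i) {..<m} \<le> \<theta>"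
proof -
  define sep where "sep T \<longleftrightarrow> finite T \<and> T \<subseteq> unit_sphere m \<and>
    (\<forall>u\<in>T. \<forall>v\<in>T. u \<noteq> v \<longrightarrow> \<theta> < L2_set (\<lambda>i. u i - v i) {..<m})" for T
  have bound: "real (card T) \<le> (1 + 2 / \<theta>) ^ m" if "sep T" for T
    using that by (intro sphere_separated_card_le[OF \<theta>]) (auto simp: sep_def)
  have "\<forall>T. sep T \<longrightarrow> card T < Suc (nat \<lfloor>(1 + 2 / \<theta>) ^ m\<rfloor>)"
    using bound by (simp add: le_nat_floor less_Suc_eq_le)
  moreover have "sep {}" by (simp add: sep_def)
  ultimately obtain T where T: "sep T" and max: "\<And>T'. sep T' \<Longrightarrow> card T' \<le> card T"
    using ex_has_greatest_nat[of sep "{}" card] by blast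
  have cover: "\<exists>v\<in>T. L2_set (\<lambda>i. u i - v i) {..<m} \<le> \<theta>" if u: "u \<in> unit_sphere m" for u
  proof (rule ccontr)
    assume "\<not> ?thesis"
    then have far: "\<And>v. v \<in> T \<Longrightarrow> \<theta> < L2_set (\<lambda>i. u i - v i) {..<m}" by (auto simp: not_le)
    have far': "\<And>v. v \<in> T \<Longrightarrow> \<theta> < L2_set (\<lambda>i. v i - u i) {..<m}"
      using far by (simp add: L2_set_def power2_commute)
    have "u \<notin> T" using far \<theta> by (force simp: L2_set_def)
    moreover have "sep (insert u T)" using T u far far' by (auto simp: sep_def)
    ultimately show False using max[of "insert u T"] T by (simp add: sep_def)
  qed
  show ?thesis using that[of T] T bound cover by (auto simp: sep_def)
qed

section \<open>Frames from maximal minors\<close>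

text \<open>Rows are selected by an arbitrary function instead of an increasing one or a set, so
  that a single row can be exchanged by \<open>f(a := i)\<close>, as Cramer's rule demands. Repeated
  rows merely make the determinant vanish.\<close>

definition row_minor :: "real mat \<Rightarrow> nat \<Rightarrow> (nat \<Rightarrow> nat) \<Rightarrow> real mat" where
  "row_minor Y p f = Matrix.mat p p (\<lambda>(a, b). Y $$ (f a, b))"

lemma row_minor_carrier [simp]: "row_minor Y p f \<in> carrier_mat p p"
  "dim_row (row_minor Y p f) = p" "dim_col (row_minor Y p f) = p"
  by (simp_all add: row_minor_def)

lemma det_nonzero_inverse:
  fixes W :: "real mat"
  assumes "W \<in> carrier_mat q q" "det W \<noteq> 0"
  obtains B where "B \<in> carrier_mat q q" "W * B = 1\<^sub>m q" "B * W = 1\<^sub>m q"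
  using det_non_zero_imp_unit[OF assms, of undefined] by (auto simp: Units_def ring_mat_def)

text \<open>A nonsingular minor on the first \<open>q\<close> columns is enlarged by a row on which the vector of the
  kernel of these \<open>q\<close> rows does not vanish.\<close>

lemma ex_nonsingular_minor_aux:
  fixes Y :: "real mat"
  assumes Y: "Y \<in> carrier_mat n p"
    and inj: "\<And>u. u \<in> carrier_vec p \<Longrightarrow> Y *\<^sub>v u = 0\<^sub>v n \<Longrightarrow> u = 0\<^sub>v p"
    and q: "q \<le> p"
  shows "\<exists>f. (\<forall>a<q. f a < n) \<and> det (row_minor Y q f) \<noteq> 0"
  using q
proof (induction q)
  case 0
  then show ?case by (simp add: det_dim_zero[OF row_minor_carrier(1)])
next
  case (Suc q)
  then obtain f where f: "\<And>a. a < q \<Longrightarrow> f a < n" and det: "det (row_minor Y q f) \<noteq> 0"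
    using Suc_leD by blast
  let ?W = "row_minor Y q f"
  have W: "(row_minor Y l g *\<^sub>v v) $ a = (\<Sum>b<l. Y $$ (g a, b) * v $ b)"
    if "v \<in> carrier_vec l" "a < l" for l g v a
    using that by (simp add: row_minor_def scalar_prod_def atLeast0LessThan)
  obtain B where B: "B \<in> carrier_mat q q" "?W * B = 1\<^sub>m q" "B * ?W = 1\<^sub>m q"
    using det_nonzero_inverse[OF row_minor_carrier(1) det] by blast
  \<comment> \<open>On the rows \<open>f\<close>, column \<open>q\<close> is the combination of the
    first \<open>q\<close> columns with coefficients \<open>c\<close>; hence (c, -1), padded by
    zeros, is the kernel vector.\<close>
  define c where "c = B *\<^sub>v Matrix.vec q (\<lambda>a. Y $$ (f a, q))"
  have c: "c \<in> carrier_vec q" using B by (simp add: c_def)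
  have Wc: "?W *\<^sub>v c = Matrix.vec q (\<lambda>a. Y $$ (f a, q))"
    unfolding c_def using B by (subst assoc_mult_mat_vec[symmetric, of _ q q _ q]) auto
  have cq: "(\<Sum>b<q. Y $$ (f a, b) * c $ b) = Y $$ (f a, q)" if "a < q" for a
    using W[OF c that, of f] that unfolding Wc by simp
  define u where "u = Matrix.vec p (\<lambda>b. if b < q then c $ b else if b = q then -1 else 0)"
  have u: "u \<in> carrier_vec p" by (simp add: u_def)
  have "u $ q = -1" using Suc.prems by (simp add: u_def)
  then have "u \<noteq> 0\<^sub>v p" using Suc.prems by auto
  then have "Y *\<^sub>v u \<noteq> 0\<^sub>v n" using inj[OF u] by auto
  moreover have "Y *\<^sub>v u = 0\<^sub>v n" if "\<And>i. i < n \<Longrightarrow> (Y *\<^sub>v u) $ i = 0"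
    using Y that by (intro eq_vecI) (auto simp del: index_mult_mat_vec)
  ultimately obtain i where i: "i < n" "(Y *\<^sub>v u) $ i \<noteq> 0" by blast
  have Yu: "(Y *\<^sub>v u) $ i = (\<Sum>b<q. Y $$ (i, b) * c $ b) - Y $$ (i, q)"
  proof -
    have "(Y *\<^sub>v u) $ i = (\<Sum>b<p. Y $$ (i, b) * u $ b)"
      using i Y u by (simp add: scalar_prod_def atLeast0LessThan)
    also have "\<dots> = (\<Sum>b<Suc q. Y $$ (i, b) * u $ b)"
      using Suc.prems by (intro sum.mono_neutral_right) (auto simp: u_def)
    finally show ?thesis using Suc.prems by (simp add: u_def)
  qed
  let ?g = "f(q := i)"
  have "det (row_minor Y (Suc q) ?g) \<noteq> 0"
  proof
    assume "det (row_minor Y (Suc q) ?g) = 0"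
    then obtain x where x: "x \<in> carrier_vec (Suc q)" "x \<noteq> 0\<^sub>v (Suc q)" "row_minor Y (Suc q) ?g *\<^sub>v x = 0\<^sub>v (Suc q)"
      using det_0_iff_vec_prod_zero_field[of "row_minor Y (Suc q) ?g" "Suc q"] by auto
    have x0: "(\<Sum>b<q. Y $$ (?g a, b) * x $ b) + Y $$ (?g a, q) * x $ q = 0" if "a < Suc q" for a
      using W[OF x(1) that, of ?g] that unfolding x(3) by simp
    \<comment> \<open>Eliminating column \<open>q\<close> by means of \<open>c\<close> leaves a
      kernel vector of the nonsingular \<open>?W\<close>, so \<open>z\<close> vanishes and
      \<open>x\<close> is a multiple of (c, -1). The new row \<open>i\<close> then forces
      \<open>x $ q = 0\<close>.\<close>
    define z where "z = Matrix.vec q (\<lambda>b. x $ b + x $ q * c $ b)"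
    have z: "z \<in> carrier_vec q" by (simp add: z_def)
    have "?W *\<^sub>v z = 0\<^sub>v q"
    proof (rule eq_vecI)
      fix a assume "a < dim_vec (0\<^sub>v q)"
      then have a: "a < q" by simp
      have "(\<Sum>b<q. Y $$ (f a, b) * (x $ b + x $ q * c $ b)) =
          (\<Sum>b<q. Y $$ (f a, b) * x $ b) + x $ q * (\<Sum>b<q. Y $$ (f a, b) * c $ b)"
        by (simp add: algebra_simps sum.distrib sum_distrib_left)
      also have "\<dots> = 0" unfolding cq[OF a] using x0[of a] a by (simp add: mult.commute)
      finally have "(\<Sum>b<q. Y $$ (f a, b) * (x $ b + x $ q * c $ b)) = 0" .
      then show "(?W *\<^sub>v z) $ a = 0\<^sub>v q $ a" using W[OF z a, of f] a by (simp add: z_def)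
    qed simp
    then have "B *\<^sub>v (?W *\<^sub>v z) = 0\<^sub>v q" using B by auto
    then have zz: "z = 0\<^sub>v q"
      using B z by (subst (asm) assoc_mult_mat_vec[symmetric, of _ q q _ q]) auto
    have z0: "x $ b = - x $ q * c $ b" if "b < q" for b
    proof -
      have "z $ b = 0" unfolding zz using that by simp
      then show ?thesis using that by (simp add: z_def eq_neg_iff_add_eq_0)
    qed
    have "0 = (\<Sum>b<q. Y $$ (i, b) * x $ b) + Y $$ (i, q) * x $ q" using x0[of q] by simp
    also have "(\<Sum>b<q. Y $$ (i, b) * x $ b) = (\<Sum>b<q. Y $$ (i, b) * (- x $ q * c $ b))"
      using z0 by (intro sum.cong) auto
    also have "\<dots> + Y $$ (i, q) * x $ q = - x $ q * (Y *\<^sub>v u) $ i"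
      by (simp add: Yu algebra_simps sum_distrib_left sum_negf)
    finally have "x $ q = 0" using i by simp
    then have "x = 0\<^sub>v (Suc q)" using z0 x(1) by (intro eq_vecI) (auto simp: less_Suc_eq)
    then show False using x(2) by simp
  qed
  moreover have "\<forall>a<Suc q. ?g a < n" using f i by (auto simp: less_Suc_eq)
  ultimately show ?case by blast
qed

lemma ex_nonsingular_row_minor:
  assumes Y: "Y \<in> carrier_mat n p"
    and inj: "\<And>u. u \<in> carrier_vec p \<Longrightarrow> Y *\<^sub>v u = 0\<^sub>v n \<Longrightarrow> u = 0\<^sub>v p"
  obtains f where "f \<in> {..<p} \<rightarrow>\<^sub>E {..<n}" "det (row_minor Y p f) \<noteq> 0"
proof -
  obtain f where f: "\<And>a. a < p \<Longrightarrow> f a < n" "det (row_minor Y p f) \<noteq> 0"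
    using ex_nonsingular_minor_aux[OF Y inj order_refl] by blast
  have "row_minor Y p (restrict f {..<p}) = row_minor Y p f"
    by (intro eq_matI) (auto simp: row_minor_def)
  then show ?thesis using that[of "restrict f {..<p}"] f by auto
qed

text \<open>These matrices parametrize subspaces of dimension \<open>p\<close> that project
  isomorphically onto the coordinates \<open>f\<close>, as in the usual charts of the Grassmannian.
  The bound 1 is what a maximal minor guarantees, so every subspace has bounded coordinates in some
  chart.\<close>

definition normalized_frames :: "nat \<Rightarrow> nat \<Rightarrow> (nat \<Rightarrow> nat) \<Rightarrow> real mat set" where
  "normalized_frames n p f = {F \<in> carrier_mat n p.
     (\<forall>i<n. \<forall>a<p. \<bar>F $$ (i, a)\<bar> \<le> 1) \<and>
     (\<forall>a<p. \<forall>b<p. F $$ (f a, b) = (if a = b then 1 else 0))}"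

lemma frob_norm_frame_le:
  assumes "F \<in> carrier_mat n p" "\<And>i a. i < n \<Longrightarrow> a < p \<Longrightarrow> \<bar>F $$ (i, a)\<bar> \<le> 1"
  shows "frob_norm F \<le> sqrt (real (p * n))"
proof -
  have "(frob_norm F)\<^sup>2 \<le> (\<Sum>i<n. \<Sum>a<p. 1)"
    unfolding frob_norm_square_sum[OF assms(1)]
    using assms(2) by (intro sum_mono) (simp add: abs_square_le_1)
  then show ?thesis by (simp add: real_le_rsqrt mult.commute)
qed

text \<open>For rows \<open>f\<close> with a minor of maximal modulus, Cramer's rule bounds the coefficients by which
  the other rows are expressed through the rows \<open>f\<close>.\<close>

lemma frame_factorization:
  assumes Y: "Y \<in> carrier_mat n p" and s: "0 < s"
    and lower: "\<And>u. u \<in> carrier_vec p \<Longrightarrow> s * vnorm u \<le> vnorm (Y *\<^sub>v u)"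
  obtains f F where "f \<in> {..<p} \<rightarrow>\<^sub>E {..<n}" "inj_on f {..<p}" "F \<in> normalized_frames n p f"
    "\<And>S. S \<in> carrier_mat n n \<Longrightarrow> frob_norm (S * F) \<le> frob_norm (S * Y) * (sqrt (real (p * n)) / s)"
proof -
  have inj: "u = 0\<^sub>v p" if "u \<in> carrier_vec p" "Y *\<^sub>v u = 0\<^sub>v n" for u
  proof -
    have "vnorm (Y *\<^sub>v u) = 0" using that(2) vnorm_eq_0_iff[of "0\<^sub>v n" n] by simp
    then have "vnorm u = 0" using lower[OF that(1)] s by (simp add: mult_le_0_iff order_antisym)
    then show ?thesis using vnorm_eq_0_iff[OF that(1)] by simp
  qed
  obtain f0 where f0: "f0 \<in> {..<p} \<rightarrow>\<^sub>E {..<n}" "det (row_minor Y p f0) \<noteq> 0"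
    using ex_nonsingular_row_minor[OF Y inj] by blast
  let ?Fs = "{..<p} \<rightarrow>\<^sub>E {..<n}"
  have fin: "finite ?Fs" by (intro finite_PiE) auto
  define d where "d f = \<bar>det (row_minor Y p f)\<bar>" for f
  obtain f where f: "f \<in> ?Fs" and max: "\<And>g. g \<in> ?Fs \<Longrightarrow> d g \<le> d f"
  proof -
    have "Max (d ` ?Fs) \<in> d ` ?Fs" using fin f0 by (intro Max_in) auto
    then obtain f where "f \<in> ?Fs" "d f = Max (d ` ?Fs)" by auto
    then show ?thesis using that fin by (metis Max_ge finite_imageI imageI)
  qed
  have det: "det (row_minor Y p f) \<noteq> 0" using max[OF f0(1)] f0(2) by (auto simp: d_def)
  have fn: "f a < n" if "a < p" for a using f that by auto
  let ?G = "row_minor Y p f"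
  obtain B where B: "B \<in> carrier_mat p p" "?G * B = 1\<^sub>m p" "B * ?G = 1\<^sub>m p"
    using det_nonzero_inverse[OF row_minor_carrier(1) det] by blast
  have injf: "inj_on f {..<p}"
  proof (rule inj_onI, rule ccontr)
    fix a b assume ab: "a \<in> {..<p}" "b \<in> {..<p}" "f a = f b" "a \<noteq> b"
    have "(1\<^sub>m p :: real mat) $$ (a, a) = (?G * B) $$ (a, a)" using B by simp
    also have "\<dots> = (?G * B) $$ (b, a)"
      using ab B(1) by (simp add: row_minor_def scalar_prod_def)
    also have "\<dots> = (1\<^sub>m p) $$ (b, a)" using B by simp
    finally show False using ab by simp
  qed
  define F where "F = Y * B"
  have F: "F \<in> carrier_mat n p" using Y B by (simp add: F_def)
  have row_id: "F $$ (f a, b) = (if a = b then 1 else 0)" if "a < p" "b < p" for a b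
  proof -
    have "F $$ (f a, b) = (?G * B) $$ (a, b)"
      using that fn Y B(1) by (simp add: F_def row_minor_def scalar_prod_def)
    then show ?thesis using that by (simp add: B(2))
  qed
  have FG: "F * ?G = Y"
    using Y B by (simp add: F_def assoc_mult_mat[of _ n p _ p _ p])
  \<comment> \<open>\<open>F $$ (i, a)\<close> is a quotient of two minors: the one with row
    \<open>f a\<close> replaced by row \<open>i\<close>, over the maximal one.\<close>
  have entry: "\<bar>F $$ (i, a)\<bar> \<le> 1" if ia: "i < n" "a < p" for i a
  proof -
    let ?H = "transpose_mat ?G"
    have "?H *\<^sub>v row F i = row Y i"
    proof (rule eq_vecI)
      show "dim_vec (?H *\<^sub>v row F i) = dim_vec (row Y i)" using Y by simp
      fix b assume "b < dim_vec (row Y i)"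
      then have b: "b < p" using Y by simp
      have "(?H *\<^sub>v row F i) $ b = (F * ?G) $$ (i, b)"
        using b ia F by (simp add: comm_scalar_prod[of _ p])
      then show "(?H *\<^sub>v row F i) $ b = row Y i $ b" using FG b ia Y by simp
    qed
    moreover have "row F i \<in> carrier_vec p" using F ia by auto
    ultimately have "det (replace_col ?H (row Y i) a) = row F i $ a * det ?H"
      using cramer_lemma_mat[of ?H p "row F i" a] ia by simp
    also have "replace_col ?H (row Y i) a = transpose_mat (row_minor Y p (f(a := i)))"
      using ia Y fn by (intro eq_matI) (auto simp: replace_col_def row_minor_def)
    finally have "det (row_minor Y p (f(a := i))) = F $$ (i, a) * det ?G"
      using ia F by (simp add: det_transpose[of _ p])
    moreover have "f(a := i) \<in> ?Fs" using f ia by (auto simp: PiE_iff extensional_def)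
    ultimately have "\<bar>F $$ (i, a)\<bar> * \<bar>det ?G\<bar> \<le> 1 * \<bar>det ?G\<bar>"
      using max[of "f(a := i)"] by (simp add: d_def abs_mult)
    then show ?thesis using det by (simp only: mult_le_cancel_right zero_less_abs_iff) auto
  qed
  have inF: "F \<in> normalized_frames n p f"
    using F row_id entry by (simp add: normalized_frames_def)
  \<comment> \<open>The operator norm of \<open>B\<close> is bounded because \<open>Y\<close>
    stretches \<open>B w\<close> by at least \<open>s\<close>, while \<open>Y B = F\<close> is
    bounded. Using the Frobenius norm of \<open>B\<close> instead could lose another factor sqrt
    p.\<close>
  have Bw: "vnorm (B *\<^sub>v w) \<le> sqrt (real (p * n)) / s * vnorm w" if w: "w \<in> carrier_vec p" for w
  proof -
    have "s * vnorm (B *\<^sub>v w) \<le> vnorm (Y *\<^sub>v (B *\<^sub>v w))"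
      using B w by (intro lower) auto
    also have "Y *\<^sub>v (B *\<^sub>v w) = F *\<^sub>v w"
      using Y B w by (simp add: F_def)
    also have "vnorm (F *\<^sub>v w) \<le> frob_norm F * vnorm w"
      by (rule vnorm_mult_mat_vec_le[OF F w])
    also have "\<dots> \<le> sqrt (real (p * n)) * vnorm w"
      using frob_norm_frame_le[OF F entry] by (intro mult_right_mono) auto
    finally show ?thesis using s by (simp add: field_simps)
  qed
  \<comment> \<open>\<open>B\<close> multiplies \<open>S * Y\<close> from the right, so it acts on
    the rows through its transpose, which has the same operator norm.\<close>
  have BT: "vnorm (B\<^sup>T *\<^sub>v w) \<le> sqrt (real (p * n)) / s * vnorm w" if w: "w \<in> carrier_vec p" for w
  proof -
    let ?z = "B\<^sup>T *\<^sub>v w"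
    have z: "?z \<in> carrier_vec p" using B w by simp
    have "(vnorm ?z)\<^sup>2 = ?z \<bullet> ?z" by (rule vnorm_square)
    also have "\<dots> = w \<bullet> (B *\<^sub>v ?z)"
      using transpose_vec_mult_scalar[OF B(1) z w] by (simp add: comm_scalar_prod[OF _ z] comm_scalar_prod[OF w])
    also have "\<dots> \<le> vnorm w * vnorm (B *\<^sub>v ?z)"
      using scalar_prod_abs_le[OF w, of "B *\<^sub>v ?z"] B z by (simp add: abs_le_iff)
    also have "\<dots> \<le> vnorm w * (sqrt (real (p * n)) / s * vnorm ?z)"
      using Bw[OF z] by (intro mult_left_mono) auto
    finally have "vnorm ?z * vnorm ?z \<le> (sqrt (real (p * n)) / s * vnorm w) * vnorm ?z"
      by (simp add: power2_eq_square mult_ac)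
    then show ?thesis
    proof (cases "vnorm ?z = 0")
      case False
      then have "0 < vnorm ?z" by (simp add: order_less_le)
      then show ?thesis
        using \<open>vnorm ?z * vnorm ?z \<le> _\<close> by (rule mult_right_le_imp_le[rotated])
    qed (use s in simp)
  qed
  have "frob_norm (S * F) \<le> frob_norm (S * Y) * (sqrt (real (p * n)) / s)" if S: "S \<in> carrier_mat n n" for S
  proof -
    have SY: "S * Y \<in> carrier_mat n p" and SF: "S * F \<in> carrier_mat n p" using S Y F by auto
    have eq: "S * F = (S * Y) * B" using S Y B by (simp add: F_def assoc_mult_mat[of _ n n _ p _ p])
    have rows: "row (S * F) i = B\<^sup>T *\<^sub>v row (S * Y) i" if i: "i < n" for i
    proof (rule eq_vecI)
      show "dim_vec (row (S * F) i) = dim_vec (B\<^sup>T *\<^sub>v row (S * Y) i)"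
        using F B by simp
      fix j assume "j < dim_vec (B\<^sup>T *\<^sub>v row (S * Y) i)"
      then have j: "j < p" using B by simp
      have "row (S * F) i $ j = (S * F) $$ (i, j)" using i j S F by (intro index_row) auto
      also have "\<dots> = ((S * Y) * B) $$ (i, j)" by (simp only: eq)
      also have "\<dots> = row (S * Y) i \<bullet> col B j" using i j S Y B by (subst index_mult_mat) auto
      also have "\<dots> = col B j \<bullet> row (S * Y) i"
        using B(1) j SY by (intro comm_scalar_prod[of _ p]) (auto intro!: carrier_vecI)
      also have "\<dots> = (B\<^sup>T *\<^sub>v row (S * Y) i) $ j" using B j by simp
      finally show "row (S * F) i $ j = (B\<^sup>T *\<^sub>v row (S * Y) i) $ j" .
    qed
    have nr: "(frob_norm M)\<^sup>2 = (\<Sum>i<n. (vnorm (row M i))\<^sup>2)" if M: "M \<in> carrier_mat n p" for M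
    proof -
      have "(vnorm (row M i))\<^sup>2 = (\<Sum>j<p. (M $$ (i, j))\<^sup>2)" if "i < n" for i
        using M that by (subst vnorm_square_sum[of _ p]) (auto intro!: carrier_vecI)
      then show ?thesis by (simp add: frob_norm_square_sum[OF M])
    qed
    have "(frob_norm (S * F))\<^sup>2 = (\<Sum>i<n. (vnorm (B\<^sup>T *\<^sub>v row (S * Y) i))\<^sup>2)"
      by (simp add: nr[OF SF] rows)
    also have "\<dots> \<le> (\<Sum>i<n. (sqrt (real (p * n)) / s * vnorm (row (S * Y) i))\<^sup>2)"
      using SY by (intro sum_mono power_mono BT) (auto intro!: carrier_vecI)
    also have "\<dots> = (frob_norm (S * Y) * (sqrt (real (p * n)) / s))\<^sup>2"
      by (simp only: power_mult_distrib nr[OF SY] sum_distrib_left sum_distrib_right mult.commute)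
    finally show ?thesis by (rule power2_le_imp_le) (use s in simp)
  qed
  then show ?thesis using that f injf inF by blast
qed

section \<open>Derivatives of the objective\<close>

text \<open>\<open>R\<close> is any bound for the operator norm on symmetric matrices rather than
  the norm itself, so that the single value \<open>R_A\<close> serves all tuples in the
  ball.\<close>

locale least_squares =
  fixes n p m :: nat and A :: "nat \<Rightarrow> real mat" and b :: "real Matrix.vec" and R :: real
  assumes A_sym: "\<And>k. k < m \<Longrightarrow> A k \<in> sym_mats n"
    and b_carrier: "b \<in> carrier_vec m"
    and R_nonneg: "0 \<le> R"
    and lin_bound: "\<And>X. X \<in> sym_mats n \<Longrightarrow> vnorm (lin_map m A X) \<le> R * frob_norm X"
begin

abbreviation "res Y \<equiv> lin_map m A (Y * Y\<^sup>T) - b"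
abbreviation "adj l \<equiv> adj_map n m A l"
abbreviation "bil Y Z \<equiv> lin_map m A (Y * Z\<^sup>T + Z * Y\<^sup>T)"
abbreviation "quad Z \<equiv> lin_map m A (Z * Z\<^sup>T)"
abbreviation mats :: "real mat set" where "mats \<equiv> carrier_mat n p"

definition grad :: "real mat \<Rightarrow> real mat" where
  "grad Y = 4 \<cdot>\<^sub>m (adj (res Y) * Y)"

text \<open>Product rule: \<open>bil Y Z\<close> is the derivative of A(Y Y^T) at \<open>Y\<close>
  in direction \<open>Z\<close>, so the second summand comes from varying the residual.\<close>

definition hess :: "real mat \<Rightarrow> real mat \<Rightarrow> real mat" where
  "hess Y Z = 4 \<cdot>\<^sub>m (adj (res Y) * Z + adj (bil Y Z) * Y)"

lemma A_carrier: "k < m \<Longrightarrow> A k \<in> carrier_mat n n"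
  using A_sym sym_mats_carrier by auto

lemma res_carrier [simp]: "res Y \<in> carrier_vec m"
  using b_carrier by simp

lemma adj_mult_carrier [simp]: "Y \<in> mats \<Longrightarrow> adj l * Y \<in> mats"
  by (rule mult_carrier_mat) auto

lemma grad_carrier: "Y \<in> mats \<Longrightarrow> grad Y \<in> mats"
  by (simp add: grad_def)

lemma hess_carrier: "Y \<in> mats \<Longrightarrow> Z \<in> mats \<Longrightarrow> hess Y Z \<in> mats"
  by (simp add: hess_def)

text \<open>Duality: pair \<open>adj l\<close> with itself and cancel one factor of its norm.
  \<open>lin_bound\<close> applies because \<open>adj l\<close> is symmetric.\<close>

lemma frob_norm_adj_le:
  assumes "l \<in> carrier_vec m"
  shows "frob_norm (adj l) \<le> R * vnorm l"
proof -
  have sym: "adj l \<in> sym_mats n" using A_sym by (rule adj_map_sym)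
  have "(frob_norm (adj l))\<^sup>2 = l \<bullet> lin_map m A (adj l)"
    unfolding frob_norm_square using assms A_carrier by (intro frob_inner_adj_map) auto
  also have "\<dots> \<le> vnorm l * vnorm (lin_map m A (adj l))"
    using scalar_prod_abs_le[OF assms, of "lin_map m A (adj l)"] by (simp add: abs_le_iff)
  also have "\<dots> \<le> vnorm l * (R * frob_norm (adj l))"
    using lin_bound[OF sym] by (intro mult_left_mono) auto
  finally have *: "frob_norm (adj l) * frob_norm (adj l) \<le> (R * vnorm l) * frob_norm (adj l)"
    by (simp add: power2_eq_square mult_ac)
  show ?thesis
  proof (cases "frob_norm (adj l) = 0")
    case False
    then have "0 < frob_norm (adj l)" by (simp add: order_less_le)
    then show ?thesis using * by (rule mult_right_le_imp_le[rotated])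
  qed (use R_nonneg in simp)
qed

lemma frob_norm_adj_mult_le:
  assumes "l \<in> carrier_vec m" "Y \<in> mats"
  shows "frob_norm (adj l * Y) \<le> R * vnorm l * frob_norm Y"
proof -
  have "frob_norm (adj l * Y) \<le> frob_norm (adj l) * frob_norm Y"
    using assms(2) by (intro frob_norm_mult_le) auto
  also have "\<dots> \<le> R * vnorm l * frob_norm Y"
    using frob_norm_adj_le[OF assms(1)] by (intro mult_right_mono) auto
  finally show ?thesis .
qed

lemma frob_norm_adj_mult_le':
  assumes "l \<in> carrier_vec m" "Y \<in> mats" "vnorm l \<le> c"
  shows "frob_norm (adj l * Y) \<le> R * c * frob_norm Y"
  using frob_norm_adj_mult_le[OF assms(1,2)] assms(3) R_nonneg
  by (meson frob_norm_nonneg mult_left_mono mult_right_mono order_trans)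

lemma sym_product_carrier:
  assumes "Y \<in> mats" "Z \<in> mats"
  shows "Y * Z\<^sup>T + Z * Y\<^sup>T \<in> sym_mats n"
proof (rule sym_matsI)
  fix i j assume "i < n" "j < n"
  then show "(Y * Z\<^sup>T + Z * Y\<^sup>T) $$ (i, j) =
      (Y * Z\<^sup>T + Z * Y\<^sup>T) $$ (j, i)"
    using assms by (simp add: scalar_prod_def mult.commute add.commute)
qed (use assms in auto)

lemma vnorm_bil_le:
  assumes Y: "Y \<in> mats" and Z: "Z \<in> mats"
  shows "vnorm (bil Y Z) \<le> 2 * R * frob_norm Y * frob_norm Z"
proof -
  have "vnorm (bil Y Z) \<le> R * frob_norm (Y * Z\<^sup>T + Z * Y\<^sup>T)"
    using sym_product_carrier[OF assms] by (rule lin_bound)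
  also have "\<dots> \<le> R * (frob_norm (Y * Z\<^sup>T) + frob_norm (Z * Y\<^sup>T))"
    using assms R_nonneg by (intro mult_left_mono frob_norm_add_le[of _ n n]) auto
  also have "\<dots> \<le> R * (frob_norm Y * frob_norm (Z\<^sup>T) + frob_norm Z * frob_norm (Y\<^sup>T))"
    using assms R_nonneg by (intro mult_left_mono add_mono frob_norm_mult_le[of _ n p _ n]) auto
  finally show ?thesis by (simp add: algebra_simps)
qed

lemma vnorm_quad_le:
  assumes Z: "Z \<in> mats"
  shows "vnorm (quad Z) \<le> R * (frob_norm Z)\<^sup>2"
proof -
  have "vnorm (quad Z) \<le> R * frob_norm (Z * Z\<^sup>T)"
    using mult_transpose_sym[OF Z] by (rule lin_bound)
  also have "\<dots> \<le> R * (frob_norm Z * frob_norm (Z\<^sup>T))"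
    using Z R_nonneg by (intro mult_left_mono frob_norm_mult_le[of _ n p _ n]) auto
  finally show ?thesis by (simp add: power2_eq_square)
qed

text \<open>The residual is a quadratic polynomial in \<open>Y\<close>, so this expansion is exact;
  the remainders and Lipschitz estimates below are read off from it.\<close>

lemma res_add:
  assumes Y: "Y \<in> mats" and Z: "Z \<in> mats"
  shows "res (Y + Z) = res Y + (bil Y Z + quad Z)"
proof -
  have c: "Y * Y\<^sup>T \<in> carrier_mat n n" "Y * Z\<^sup>T + Z * Y\<^sup>T \<in> carrier_mat n n"
    "Z * Z\<^sup>T \<in> carrier_mat n n" using assms by auto
  have "(Y + Z) * (Y + Z)\<^sup>T =
      Y * Y\<^sup>T + ((Y * Z\<^sup>T + Z * Y\<^sup>T) + Z * Z\<^sup>T)"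
    using assms by (intro eq_matI) (auto simp: scalar_prod_def algebra_simps sum.distrib)
  then have "lin_map m A ((Y + Z) * (Y + Z)\<^sup>T) = quad Y + (bil Y Z + quad Z)"
    using c by (simp add: lin_map_add[of m A n] A_carrier)
  then show ?thesis using b_carrier by (intro eq_vecI) auto
qed

lemma bil_add_right:
  assumes "Y \<in> mats" "Z \<in> mats" "W \<in> mats"
  shows "bil Y (Z + W) = bil Y Z + bil Y W"
proof -
  have "Y * (Z + W)\<^sup>T + (Z + W) * Y\<^sup>T =
     (Y * Z\<^sup>T + Z * Y\<^sup>T) + (Y * W\<^sup>T + W * Y\<^sup>T)"
    using assms by (intro eq_matI) (auto simp: scalar_prod_def algebra_simps sum.distrib)
  then show ?thesis
    using assms sym_product_carrier[THEN sym_mats_carrier] by (simp add: lin_map_add[of m A n] A_carrier)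
qed

lemma bil_commute:
  assumes "Y \<in> mats" "Z \<in> mats"
  shows "bil Y Z = bil Z Y"
proof -
  have "Y * Z\<^sup>T + Z * Y\<^sup>T = Z * Y\<^sup>T + Y * Z\<^sup>T"
    using assms by (intro comm_add_mat[of _ n n]) auto
  then show ?thesis by simp
qed

lemma bil_add_left:
  assumes "Y \<in> mats" "Z \<in> mats" "W \<in> mats"
  shows "bil (Z + W) Y = bil Z Y + bil W Y"
proof -
  have "Z + W \<in> mats" using assms by auto
  then have "bil (Z + W) Y = bil Y (Z + W)" using assms by (intro bil_commute)
  also have "\<dots> = bil Y Z + bil Y W" using assms by (rule bil_add_right)
  also have "bil Y Z = bil Z Y" using assms(1,2) by (rule bil_commute)
  also have "bil Y W = bil W Y" using assms(1,3) by (rule bil_commute)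
  finally show ?thesis .
qed

lemma bil_smult_right:
  assumes "Y \<in> mats" "Z \<in> mats"
  shows "bil Y (c \<cdot>\<^sub>m Z) = c \<cdot>\<^sub>v bil Y Z"
proof -
  have "Y * (c \<cdot>\<^sub>m Z)\<^sup>T + (c \<cdot>\<^sub>m Z) * Y\<^sup>T =
     c \<cdot>\<^sub>m (Y * Z\<^sup>T + Z * Y\<^sup>T)"
    using assms by (intro eq_matI) (auto simp: scalar_prod_def algebra_simps sum_distrib_left)
  then show ?thesis
    using assms sym_product_carrier[OF assms, THEN sym_mats_carrier] by (simp add: lin_map_smult[of m A n] A_carrier)
qed

text \<open>The products Y Z^T and Z Y^T are transposes of each other and pair equally with the
  symmetric matrix \<open>adj l\<close>, whence the factor 2.\<close>

lemma frob_inner_adj_mult: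
  assumes "l \<in> carrier_vec m" "Y \<in> mats" "Z \<in> mats"
  shows "2 * frob_inner Z (adj l * Y) = l \<bullet> bil Y Z"
proof -
  have ZY: "Z * Y\<^sup>T \<in> carrier_mat n n" using assms by auto
  have YZ: "Y * Z\<^sup>T = (Z * Y\<^sup>T)\<^sup>T"
    using assms by (subst transpose_mult[of _ n p _ n]) auto
  have "l \<bullet> bil Y Z = frob_inner (adj l) (Y * Z\<^sup>T + Z * Y\<^sup>T)"
    using assms A_carrier by (intro frob_inner_adj_map[symmetric]) auto
  also have "\<dots> = frob_inner (adj l) ((Z * Y\<^sup>T)\<^sup>T) + frob_inner (adj l) (Z * Y\<^sup>T)"
    unfolding YZ using ZY by (intro frob_inner_add_right[of _ n n]) auto
  also have "\<dots> = 2 * frob_inner (Z * Y\<^sup>T) (adj l)"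
    using ZY frob_inner_transpose_sym[OF ZY adj_map_sym[OF A_sym, where l = l]]
      frob_inner_commute[of "adj l" n n "Z * Y\<^sup>T"]
      frob_inner_commute[of "adj l" n n "(Z * Y\<^sup>T)\<^sup>T"] by simp
  also have "\<dots> = 2 * frob_inner Z (adj l * Y)"
    using assms by (simp add: frob_inner_mult_right[of Z n p "adj l" n Y])
  finally show ?thesis by simp
qed

lemma objective_eq: "objective m A b Y = res Y \<bullet> res Y"
  by (simp add: objective_def residual_def vnorm_square)

lemma frob_inner_grad:
  assumes "Y \<in> mats" "Z \<in> mats"
  shows "frob_inner (grad Y) Z = 2 * (res Y \<bullet> bil Y Z)"
  using assms frob_inner_adj_mult[OF res_carrier assms, of Y]
    frob_inner_commute[of "adj (res Y) * Y" n p Z]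
  by (simp add: grad_def frob_inner_smult_left[of _ n p])

text \<open>The first term is a multiple of the quadratic form of the slack. The second is
  nonnegative, so it has to be made small before a lower bound on the Hessian says anything about
  the slack.\<close>

lemma frob_inner_hess:
  assumes "Y \<in> mats" "Z \<in> mats"
  shows "frob_inner Z (hess Y Z) = 4 * frob_inner Z (adj (res Y) * Z) + 2 * (vnorm (bil Y Z))\<^sup>2"
proof -
  have "frob_inner Z (hess Y Z) = 4 * (frob_inner Z (adj (res Y) * Z) + frob_inner Z (adj (bil Y Z) * Y))"
    using assms by (simp add: hess_def frob_inner_smult_right[of _ n p] frob_inner_add_right[of _ n p])
  moreover have "2 * frob_inner Z (adj (bil Y Z) * Y) = (vnorm (bil Y Z))\<^sup>2"
    unfolding vnorm_square using assms by (intro frob_inner_adj_mult) auto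
  ultimately show ?thesis by simp
qed

lemma vnorm_increment_le:
  assumes "Y \<in> mats" "Z \<in> mats"
  shows "vnorm (bil Y Z + quad Z) \<le> R * (2 * frob_norm Y + frob_norm Z) * frob_norm Z"
proof -
  have "vnorm (bil Y Z + quad Z) \<le> vnorm (bil Y Z) + vnorm (quad Z)"
    by (rule vnorm_add_le[of _ m]) auto
  also have "\<dots> \<le> 2 * R * frob_norm Y * frob_norm Z + R * (frob_norm Z)\<^sup>2"
    using vnorm_bil_le[OF assms] vnorm_quad_le[OF assms(2)] by (rule add_mono)
  finally show ?thesis by (simp add: algebra_simps power2_eq_square)
qed

text \<open>Turns a remainder of second order into the o(|Z|) form demanded by
  \<open>has_gradient\<close> and \<open>has_jacobian\<close>; the \<open>M + 1\<close> in the
  radius avoids a division by zero.\<close>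

lemma quadratic_remainder:
  assumes "0 \<le> M" "0 < (e::real)" and err: "\<And>Z. Z \<in> mats \<Longrightarrow> frob_norm Z < 1 \<Longrightarrow> err Z \<le> M * (frob_norm Z)\<^sup>2"
  shows "\<exists>d>0. \<forall>Z\<in>mats. frob_norm Z < d \<longrightarrow> err Z \<le> e * frob_norm Z"
proof (intro exI[of _ "min 1 (e / (M + 1))"] conjI ballI impI)
  show "0 < min 1 (e / (M + 1))" using assms by simp
  fix Z assume Z: "Z \<in> mats" "frob_norm Z < min 1 (e / (M + 1))"
  have "M * frob_norm Z \<le> (M + 1) * (e / (M + 1))"
    using Z(2) assms by (intro mult_mono) auto
  then have "M * frob_norm Z \<le> e" using assms by simp
  then have "(M * frob_norm Z) * frob_norm Z \<le> e * frob_norm Z" by (intro mult_right_mono) auto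
  then show "err Z \<le> e * frob_norm Z" using err[OF Z(1)] Z(2) by (simp add: power2_eq_square mult_ac)
qed

lemma has_gradient_grad:
  assumes Y: "Y \<in> mats"
  shows "has_gradient n p (objective m A b) Y (grad Y)"
  unfolding has_gradient_def
proof (intro conjI allI impI)
  show "grad Y \<in> mats" using Y by (rule grad_carrier)
  fix e :: real assume e: "0 < e"
  let ?a = "vnorm (res Y)" and ?y = "frob_norm Y"
  let ?M = "2 * ?a * R + (R * (2 * ?y + 1))\<^sup>2"
  show "\<exists>d>0. \<forall>Z\<in>mats. frob_norm Z < d \<longrightarrow>
      \<bar>objective m A b (Y + Z) - objective m A b Y - frob_inner (grad Y) Z\<bar> \<le> e * frob_norm Z"
  proof (rule quadratic_remainder[OF _ e, of ?M])
    show "0 \<le> ?M" using R_nonneg by simp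
    fix Z assume Z: "Z \<in> mats" "frob_norm Z < 1"
    let ?z = "frob_norm Z" and ?v = "bil Y Z + quad Z"
    have v: "?v \<in> carrier_vec m" by simp
    have "objective m A b (Y + Z) = (res Y + ?v) \<bullet> (res Y + ?v)"
      by (simp add: objective_eq res_add[OF Y Z(1)])
    also have "\<dots> = res Y \<bullet> res Y + 2 * (res Y \<bullet> ?v) + ?v \<bullet> ?v"
      using v res_carrier[of Y] comm_scalar_prod[OF v res_carrier[of Y]]
        add_scalar_prod_distrib[OF res_carrier[of Y] v, of "res Y + ?v"]
        scalar_prod_add_distrib[OF res_carrier[of Y] res_carrier[of Y] v]
        scalar_prod_add_distrib[OF v res_carrier[of Y] v] by simp
    also have "res Y \<bullet> ?v = res Y \<bullet> bil Y Z + res Y \<bullet> quad Z"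
      by (rule scalar_prod_add_distrib[of _ m]) auto
    finally have eq: "objective m A b (Y + Z) - objective m A b Y - frob_inner (grad Y) Z =
        2 * (res Y \<bullet> quad Z) + (vnorm ?v)\<^sup>2"
      by (simp add: frob_inner_grad[OF Y Z(1)] vnorm_square objective_eq)
    have "\<bar>res Y \<bullet> quad Z\<bar> \<le> ?a * vnorm (quad Z)"
      by (rule scalar_prod_abs_le[of _ m]) auto
    also have "\<dots> \<le> ?a * (R * ?z\<^sup>2)"
      using vnorm_quad_le[OF Z(1)] by (intro mult_left_mono) auto
    finally have 1: "\<bar>res Y \<bullet> quad Z\<bar> \<le> ?a * R * ?z\<^sup>2" by (simp add: mult_ac)
    have "vnorm ?v \<le> R * (2 * ?y + ?z) * ?z" by (rule vnorm_increment_le[OF Y Z(1)])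
    also have "\<dots> \<le> R * (2 * ?y + 1) * ?z"
      using Z(2) R_nonneg by (intro mult_right_mono mult_left_mono) auto
    finally have "(vnorm ?v)\<^sup>2 \<le> (R * (2 * ?y + 1) * ?z)\<^sup>2" by (intro power_mono) auto
    then have 2: "(vnorm ?v)\<^sup>2 \<le> (R * (2 * ?y + 1))\<^sup>2 * ?z\<^sup>2" by (simp add: power_mult_distrib)
    have "\<bar>2 * (res Y \<bullet> quad Z) + (vnorm ?v)\<^sup>2\<bar> \<le> 2 * \<bar>res Y \<bullet> quad Z\<bar> + (vnorm ?v)\<^sup>2"
      by (rule order_trans[OF abs_triangle_ineq]) (simp add: abs_mult)
    also have "\<dots> \<le> ?M * ?z\<^sup>2" using 1 2 by (simp add: algebra_simps)
    finally show "\<bar>objective m A b (Y + Z) - objective m A b Y - frob_inner (grad Y) Z\<bar> \<le> ?M * ?z\<^sup>2"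
      by (simp only: eq)
  qed
qed

lemma adj_add: "l \<in> carrier_vec m \<Longrightarrow> l' \<in> carrier_vec m \<Longrightarrow> adj (l + l') = adj l + adj l'"
  by (rule adj_map_add)

lemma frob_norm_sum3_le:
  assumes "B \<in> mats" "C \<in> mats" "D \<in> mats"
  shows "frob_norm (4 \<cdot>\<^sub>m (B + C + D)) \<le> 4 * (frob_norm B + frob_norm C + frob_norm D)"
  using frob_norm_add_le[OF assms(1,2)] frob_norm_add_le[of "B + C" n p D] assms
  by (simp add: frob_norm_smult)

lemma lin_op_hess:
  assumes Y: "Y \<in> mats"
  shows "lin_op n p (hess Y)"
  unfolding lin_op_def
proof (intro conjI ballI allI)
  fix Z W assume ZW: "Z \<in> mats" "W \<in> mats"
  show "hess Y Z \<in> mats" using Y ZW(1) by (rule hess_carrier)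
  have "adj (res Y) * (Z + W) = adj (res Y) * Z + adj (res Y) * W"
    using ZW by (intro mult_add_distrib_mat[of _ n n _ p]) auto
  moreover have "adj (bil Y (Z + W)) * Y = adj (bil Y Z) * Y + adj (bil Y W) * Y"
    using Y ZW by (simp add: bil_add_right adj_add add_mult_distrib_mat[of _ n n])
  ultimately show "hess Y (Z + W) = hess Y Z + hess Y W"
    using Y ZW unfolding hess_def
    by (intro eq_matI) (auto simp del: index_mult_mat(1) simp: algebra_simps)
next
  fix c Z assume Z: "Z \<in> mats"
  have "adj (res Y) * (c \<cdot>\<^sub>m Z) = c \<cdot>\<^sub>m (adj (res Y) * Z)"
    using Z by (intro mult_smult_distrib[of _ n n _ p]) auto
  moreover have "adj (bil Y (c \<cdot>\<^sub>m Z)) * Y = c \<cdot>\<^sub>m (adj (bil Y Z) * Y)"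
    using Y Z by (simp add: bil_smult_right adj_map_smult[of _ m] mult_smult_assoc_mat[of _ n n _ p])
  ultimately show "hess Y (c \<cdot>\<^sub>m Z) = c \<cdot>\<^sub>m hess Y Z"
    using Y Z unfolding hess_def
    by (intro eq_matI) (auto simp del: index_mult_mat(1) simp: algebra_simps)
qed

lemma adj_add_mult:
  assumes "l \<in> carrier_vec m" "l' \<in> carrier_vec m" "Y \<in> mats" "Z \<in> mats"
  shows "adj (l + l') * (Y + Z) = adj l * Y + adj l * Z + adj l' * (Y + Z)"
proof -
  have YZ: "Y + Z \<in> mats" using assms by auto
  have "adj (l + l') * (Y + Z) = adj l * (Y + Z) + adj l' * (Y + Z)"
    using assms(1,2) YZ by (simp add: adj_add add_mult_distrib_mat[of _ n n _ _ p])
  also have "adj l * (Y + Z) = adj l * Y + adj l * Z"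
    using assms(3,4) by (intro mult_add_distrib_mat[of _ n n _ p]) auto
  finally show ?thesis .
qed

lemma grad_diff:
  assumes Y: "Y \<in> mats" and Z: "Z \<in> mats"
  shows "grad (Y + Z) - grad Y = 4 \<cdot>\<^sub>m (adj (res Y) * Z + adj (bil Y Z + quad Z) * (Y + Z))"
  unfolding grad_def res_add[OF assms] using assms
  by (subst adj_add_mult)
    (auto intro!: eq_matI simp del: index_mult_mat(1) simp: algebra_simps)

text \<open>Arranged so that every summand contains the increment \<open>D\<close>: a single
  estimate then yields both the continuity of the Hessian and its Lipschitz constant.\<close>

lemma hess_diff:
  assumes Y: "Y \<in> mats" and D: "D \<in> mats" and Z: "Z \<in> mats"
  shows "hess (Y + D) Z - hess Y Z =
    4 \<cdot>\<^sub>m (adj (bil Y D + quad D) * Z + adj (bil Y Z) * D + adj (bil D Z) * (Y + D))"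
proof -
  have "adj (res (Y + D)) * Z = adj (res Y) * Z + adj (bil Y D + quad D) * Z"
    unfolding res_add[OF Y D] using Z by (subst adj_add) (auto intro!: add_mult_distrib_mat[of _ n n])
  moreover have "adj (bil (Y + D) Z) * (Y + D) = adj (bil Y Z) * Y + adj (bil Y Z) * D + adj (bil D Z) * (Y + D)"
    using assms by (simp add: bil_add_left[OF Z Y D] adj_add_mult)
  ultimately show ?thesis
    unfolding hess_def using assms
    by (auto intro!: eq_matI simp del: index_mult_mat(1) simp: algebra_simps)
qed

lemma frob_norm_hess_diff_le:
  assumes Y: "Y \<in> mats" and D: "D \<in> mats" and Z: "Z \<in> mats"
  shows "frob_norm (hess (Y + D) Z - hess Y Z) \<le>
    4 * R\<^sup>2 * (4 * frob_norm Y + frob_norm D + 2 * frob_norm (Y + D)) * frob_norm D * frob_norm Z"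
proof -
  have YD: "Y + D \<in> mats" using Y D by auto
  have "frob_norm (hess (Y + D) Z - hess Y Z) \<le>
    4 * (frob_norm (adj (bil Y D + quad D) * Z) + frob_norm (adj (bil Y Z) * D) + frob_norm (adj (bil D Z) * (Y + D)))"
    unfolding hess_diff[OF assms] using assms YD by (intro frob_norm_sum3_le) auto
  also have "\<dots> \<le> 4 * (R * (R * (2 * frob_norm Y + frob_norm D) * frob_norm D) * frob_norm Z +
      R * (2 * R * frob_norm Y * frob_norm Z) * frob_norm D + R * (2 * R * frob_norm D * frob_norm Z) * frob_norm (Y + D))"
  proof (intro mult_left_mono add_mono)
    show "frob_norm (adj (bil Y D + quad D) * Z) \<le> R * (R * (2 * frob_norm Y + frob_norm D) * frob_norm D) * frob_norm Z"
      using Z vnorm_increment_le[OF Y D] by (intro frob_norm_adj_mult_le') auto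
    show "frob_norm (adj (bil Y Z) * D) \<le> R * (2 * R * frob_norm Y * frob_norm Z) * frob_norm D"
      using D vnorm_bil_le[OF Y Z] by (intro frob_norm_adj_mult_le') auto
    show "frob_norm (adj (bil D Z) * (Y + D)) \<le> R * (2 * R * frob_norm D * frob_norm Z) * frob_norm (Y + D)"
      using YD vnorm_bil_le[OF D Z] by (intro frob_norm_adj_mult_le') auto
  qed simp
  finally show ?thesis by (simp add: algebra_simps power2_eq_square)
qed

lemma has_jacobian_hess:
  assumes Y: "Y \<in> mats"
  shows "has_jacobian n p grad Y (hess Y)"
  unfolding has_jacobian_def
proof (intro conjI allI impI)
  show "lin_op n p (hess Y)" using Y by (rule lin_op_hess)
  fix e :: real assume e: "0 < e"
  let ?y = "frob_norm Y"
  let ?M = "4 * R\<^sup>2 * (3 * ?y + 1)"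
  show "\<exists>d>0. \<forall>Z\<in>mats. frob_norm Z < d \<longrightarrow> frob_norm (grad (Y + Z) - grad Y - hess Y Z) \<le> e * frob_norm Z"
  proof (rule quadratic_remainder[OF _ e, of ?M])
    show "0 \<le> ?M" by (intro mult_nonneg_nonneg) auto
    fix Z assume Z: "Z \<in> mats" "frob_norm Z < 1"
    let ?z = "frob_norm Z"
    have "adj (bil Y Z + quad Z) * (Y + Z) =
        adj (bil Y Z) * Y + adj (quad Z) * Y + adj (bil Y Z + quad Z) * Z"
      using Y Z by (simp add: adj_add add_mult_distrib_mat[of _ n n _ _ p] mult_add_distrib_mat[of _ n n _ p])
    then have "grad (Y + Z) - grad Y - hess Y Z = 4 \<cdot>\<^sub>m (adj (quad Z) * Y + adj (bil Y Z + quad Z) * Z)"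
      unfolding grad_diff[OF Y Z(1)] hess_def using Y Z
      by (auto intro!: eq_matI simp del: index_mult_mat(1) simp: algebra_simps)
    then have "frob_norm (grad (Y + Z) - grad Y - hess Y Z) \<le>
        4 * (frob_norm (adj (quad Z) * Y) + frob_norm (adj (bil Y Z + quad Z) * Z))"
      using frob_norm_add_le[OF adj_mult_carrier[OF Y, of "quad Z"] adj_mult_carrier[OF Z(1), of "bil Y Z + quad Z"]]
      by (simp add: frob_norm_smult)
    also have "\<dots> \<le> 4 * (R * (R * ?z\<^sup>2) * ?y + R * (R * (2 * ?y + 1) * ?z) * ?z)"
    proof (intro mult_left_mono add_mono)
      show "frob_norm (adj (quad Z) * Y) \<le> R * (R * ?z\<^sup>2) * ?y"
        using Y vnorm_quad_le[OF Z(1)] by (intro frob_norm_adj_mult_le') auto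
      have "vnorm (bil Y Z + quad Z) \<le> R * (2 * ?y + ?z) * ?z" by (rule vnorm_increment_le[OF Y Z(1)])
      also have "\<dots> \<le> R * (2 * ?y + 1) * ?z"
        using R_nonneg Z by (intro mult_right_mono mult_left_mono add_mono) auto
      finally show "frob_norm (adj (bil Y Z + quad Z) * Z) \<le> R * (R * (2 * ?y + 1) * ?z) * ?z"
        using Z by (intro frob_norm_adj_mult_le') auto
    qed simp
    finally show "frob_norm (grad (Y + Z) - grad Y - hess Y Z) \<le> ?M * ?z\<^sup>2"
      by (simp add: algebra_simps power2_eq_square)
  qed
qed

lemma add_diff_mats: "Y \<in> mats \<Longrightarrow> Y' \<in> mats \<Longrightarrow> Y + (Y' - Y) = Y'"
  by (intro eq_matI) auto

lemma C2_objective: "C2_fun n p (objective m A b) grad hess"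
  unfolding C2_fun_def
proof (intro conjI ballI allI impI)
  fix Y assume Y: "Y \<in> mats"
  show "has_gradient n p (objective m A b) Y (grad Y)" "has_jacobian n p grad Y (hess Y)"
    using Y by (rule has_gradient_grad, rule has_jacobian_hess)
  fix e :: real assume e: "0 < e"
  let ?M = "4 * R\<^sup>2 * (6 * frob_norm Y + 3)"
  have M: "0 \<le> ?M" by (intro mult_nonneg_nonneg) auto
  show "\<exists>d>0. \<forall>Y'\<in>mats. frob_norm (Y' - Y) < d \<longrightarrow>
      (\<forall>Z\<in>mats. frob_norm (hess Y' Z - hess Y Z) \<le> e * frob_norm Z)"
  proof (intro exI[of _ "min 1 (e / (?M + 1))"] conjI ballI impI)
    show "0 < min 1 (e / (?M + 1))" using M e by (simp add: add_nonneg_pos)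
    fix Y' Z assume Y': "Y' \<in> mats" and d: "frob_norm (Y' - Y) < min 1 (e / (?M + 1))" and Z: "Z \<in> mats"
    define D where "D = Y' - Y"
    have D: "D \<in> mats" using Y Y' by (auto simp: D_def)
    have eq: "Y' = Y + D" using Y Y' by (simp add: D_def add_diff_mats)
    have YD: "frob_norm (Y + D) \<le> frob_norm Y + frob_norm D" by (rule frob_norm_add_le[OF Y D])
    have dD: "frob_norm D < 1" "frob_norm D < e / (?M + 1)" using d by (simp_all add: D_def)
    have "frob_norm (hess Y' Z - hess Y Z) \<le>
        4 * R\<^sup>2 * (4 * frob_norm Y + frob_norm D + 2 * frob_norm (Y + D)) * frob_norm D * frob_norm Z"
      unfolding eq by (rule frob_norm_hess_diff_le[OF Y D Z])
    also have "\<dots> \<le> ?M * frob_norm D * frob_norm Z"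
      using YD dD by (intro mult_right_mono mult_left_mono) auto
    also have "\<dots> \<le> e * frob_norm Z"
    proof (intro mult_right_mono)
      have "?M * frob_norm D \<le> (?M + 1) * (e / (?M + 1))"
        using dD M e by (intro mult_mono) auto
      also have "\<dots> = e"
      proof -
        have "0 < ?M + 1" using M by linarith
        then show ?thesis by (metis less_irrefl nonzero_mult_div_cancel_left times_divide_eq_right)
      qed
      finally show "?M * frob_norm D \<le> e" .
    qed simp
    finally show "frob_norm (hess Y' Z - hess Y Z) \<le> e * frob_norm Z" .
  qed
qed

section \<open>Bounds and Lipschitz constants on the level set\<close>

lemma level_set_eq:
  assumes "0 \<le> \<alpha>"
  shows "{Y \<in> mats. objective m A b Y \<le> \<alpha>\<^sup>2} = level_set n p m A b \<alpha>"
  using assms by (auto simp: level_set_def objective_def residual_def abs_le_square_iff[symmetric])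

text \<open>The level set need not be convex, so the Lipschitz constants are taken from the exact
  difference formulas, which need bounds only at the two points, and not from a mean value argument
  along the segment.\<close>

lemma bounded_lipschitz_objective:
  assumes \<alpha>: "0 \<le> \<alpha>" and \<rho>: "0 \<le> \<rho>" "\<And>Y. Y \<in> level_set n p m A b \<alpha> \<Longrightarrow> frob_norm Y \<le> \<rho>"
  shows "\<exists>L. bounded_lipschitz n p (objective m A b) grad hess (\<alpha>\<^sup>2) L"
proof -
  \<comment> \<open>The sum of the six bounds derived below, for the objective, the gradient, the
    Hessian and then their Lipschitz constants, so that each of them is at most
    \<open>L\<close>.\<close>
  define L where "L = \<alpha>\<^sup>2 + 4 * (R * \<alpha> * \<rho>) + 4 * (R * \<alpha> + 2 * R\<^sup>2 * \<rho>\<^sup>2) + 8 * R * \<rho> * \<alpha> +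
    4 * (R * \<alpha> + 4 * R\<^sup>2 * \<rho>\<^sup>2) + 32 * R\<^sup>2 * \<rho>"
  note nn = R_nonneg \<alpha> \<rho>(1)
  have L: "\<alpha>\<^sup>2 \<le> L" "4 * (R * \<alpha> * \<rho>) \<le> L" "4 * (R * \<alpha> + 2 * R\<^sup>2 * \<rho>\<^sup>2) \<le> L" "8 * R * \<rho> * \<alpha> \<le> L"
    "4 * (R * \<alpha> + 4 * R\<^sup>2 * \<rho>\<^sup>2) \<le> L" "32 * R\<^sup>2 * \<rho> \<le> L"
    using nn by (simp_all add: L_def)
  have "bounded_lipschitz n p (objective m A b) grad hess (\<alpha>\<^sup>2) L"
    unfolding bounded_lipschitz_def Let_def level_set_eq[OF \<alpha>]
  proof (intro conjI ballI)
    fix Y assume YD: "Y \<in> level_set n p m A b \<alpha>"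
    have Y: "Y \<in> mats" "vnorm (res Y) \<le> \<alpha>" "frob_norm Y \<le> \<rho>"
      using YD \<rho> by (auto simp: level_set_def residual_def)
    have "(vnorm (res Y))\<^sup>2 \<le> \<alpha>\<^sup>2" using Y(2) by (intro power_mono) auto
    then show "\<bar>objective m A b Y\<bar> \<le> L" using L(1) by (simp add: objective_def residual_def)
    have "frob_norm (grad Y) \<le> 4 * (R * vnorm (res Y) * frob_norm Y)"
      using frob_norm_adj_mult_le[OF res_carrier Y(1), of Y] by (simp add: grad_def frob_norm_smult)
    also have "\<dots> \<le> 4 * (R * \<alpha> * \<rho>)" using Y nn by (intro mult_left_mono mult_mono) auto
    finally show "frob_norm (grad Y) \<le> L" using L(2) by linarith
    fix Z assume Z: "Z \<in> mats"
    have "frob_norm (hess Y Z) \<le> 4 * (frob_norm (adj (res Y) * Z) + frob_norm (adj (bil Y Z) * Y))"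
      using frob_norm_add_le[OF adj_mult_carrier[OF Z, of "res Y"] adj_mult_carrier[OF Y(1), of "bil Y Z"]]
      by (simp add: hess_def frob_norm_smult)
    also have "\<dots> \<le> 4 * (R * vnorm (res Y) * frob_norm Z + R * vnorm (bil Y Z) * frob_norm Y)"
      using Y Z by (intro mult_left_mono add_mono frob_norm_adj_mult_le) auto
    also have "\<dots> \<le> 4 * (R * \<alpha> * frob_norm Z + R * (2 * R * \<rho> * frob_norm Z) * \<rho>)"
    proof (intro mult_left_mono add_mono)
      show "R * vnorm (res Y) * frob_norm Z \<le> R * \<alpha> * frob_norm Z"
        using Y nn by (intro mult_right_mono mult_left_mono) auto
      have "vnorm (bil Y Z) \<le> 2 * R * frob_norm Y * frob_norm Z" by (rule vnorm_bil_le[OF Y(1) Z])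
      also have "\<dots> \<le> 2 * R * \<rho> * frob_norm Z" using Y nn by (intro mult_right_mono mult_left_mono) auto
      finally show "R * vnorm (bil Y Z) * frob_norm Y \<le> R * (2 * R * \<rho> * frob_norm Z) * \<rho>"
        using Y nn by (intro mult_mono mult_left_mono) auto
    qed simp
    also have "\<dots> = (4 * (R * \<alpha> + 2 * R\<^sup>2 * \<rho>\<^sup>2)) * frob_norm Z" by (simp add: algebra_simps power2_eq_square)
    also have "\<dots> \<le> L * frob_norm Z" using L(3) by (intro mult_right_mono) auto
    finally show "frob_norm (hess Y Z) \<le> L * frob_norm Z" .
  next
    fix Y0 Y assume YD: "Y0 \<in> level_set n p m A b \<alpha>" "Y \<in> level_set n p m A b \<alpha>"
    have Y: "Y \<in> mats" "vnorm (res Y) \<le> \<alpha>" "frob_norm Y \<le> \<rho>"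
      and Y0: "Y0 \<in> mats" "vnorm (res Y0) \<le> \<alpha>" "frob_norm Y0 \<le> \<rho>"
      using YD \<rho> by (auto simp: level_set_def residual_def)
    define D where "D = Y0 - Y"
    have D: "D \<in> mats" and Y0D: "Y0 = Y + D" using Y Y0 by (auto simp: D_def add_diff_mats)
    have D2: "frob_norm D \<le> 2 * \<rho>" using frob_norm_diff_le[OF Y0(1) Y(1)] Y Y0 by (simp add: D_def)
    have inc: "vnorm (bil Y D + quad D) \<le> 4 * R * \<rho> * frob_norm D"
    proof -
      have "vnorm (bil Y D + quad D) \<le> R * (2 * frob_norm Y + frob_norm D) * frob_norm D"
        by (rule vnorm_increment_le[OF Y(1) D])
      also have "\<dots> \<le> R * (4 * \<rho>) * frob_norm D"
        using Y D2 nn by (intro mult_right_mono mult_left_mono) auto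
      finally show ?thesis by (simp add: mult_ac)
    qed
    let ?v = "bil Y D + quad D"
    have "objective m A b Y0 - objective m A b Y = ?v \<bullet> (res Y0 + res Y)"
    proof -
      have "?v \<bullet> (res Y0 + res Y) = (res Y0 - res Y) \<bullet> (res Y0 + res Y)"
      proof -
        have "res Y0 - res Y = ?v" unfolding Y0D res_add[OF Y(1) D] using b_carrier by (intro eq_vecI) auto
        then show ?thesis by simp
      qed
      also have "\<dots> = res Y0 \<bullet> res Y0 - res Y \<bullet> res Y"
        using comm_scalar_prod[OF res_carrier[of Y] res_carrier[of Y0]]
        by (simp add: minus_scalar_prod_distrib[OF res_carrier res_carrier, of "res Y0 + res Y"]
          scalar_prod_add_distrib[OF res_carrier res_carrier res_carrier])
      finally show ?thesis by (simp add: objective_eq)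
    qed
    then have "\<bar>objective m A b Y0 - objective m A b Y\<bar> \<le> vnorm ?v * vnorm (res Y0 + res Y)"
      using scalar_prod_abs_le[of ?v m "res Y0 + res Y"] by simp
    also have "\<dots> \<le> (4 * R * \<rho> * frob_norm D) * (2 * \<alpha>)"
      using inc vnorm_add_le[OF res_carrier[of Y0] res_carrier[of Y]] Y Y0 nn by (intro mult_mono) auto
    also have "\<dots> = (8 * R * \<rho> * \<alpha>) * frob_norm D" by simp
    also have "\<dots> \<le> L * frob_norm D" using L(4) by (intro mult_right_mono) auto
    finally show "\<bar>objective m A b Y0 - objective m A b Y\<bar> \<le> L * frob_norm (Y0 - Y)" by (simp add: D_def)
    have "frob_norm (grad Y0 - grad Y) \<le> 4 * (frob_norm (adj (res Y) * D) + frob_norm (adj ?v * Y0))"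
      unfolding grad_diff[OF Y(1) D, folded Y0D]
      using frob_norm_add_le[OF adj_mult_carrier[OF D, of "res Y"] adj_mult_carrier[OF Y0(1), of ?v]]
      by (simp add: frob_norm_smult)
    also have "\<dots> \<le> 4 * (R * vnorm (res Y) * frob_norm D + R * vnorm ?v * frob_norm Y0)"
      using Y0(1) D by (intro mult_left_mono add_mono frob_norm_adj_mult_le) auto
    also have "\<dots> \<le> 4 * (R * \<alpha> * frob_norm D + R * (4 * R * \<rho> * frob_norm D) * \<rho>)"
      using Y Y0 inc nn by (intro mult_left_mono add_mono mult_right_mono mult_mono) auto
    also have "\<dots> = (4 * (R * \<alpha> + 4 * R\<^sup>2 * \<rho>\<^sup>2)) * frob_norm D" by (simp add: algebra_simps power2_eq_square)
    also have "\<dots> \<le> L * frob_norm D" using L(5) by (intro mult_right_mono) auto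
    finally show "frob_norm (grad Y0 - grad Y) \<le> L * frob_norm (Y0 - Y)" by (simp add: D_def)
    fix Z assume Z: "Z \<in> mats"
    have "frob_norm (hess Y0 Z - hess Y Z) \<le>
        4 * R\<^sup>2 * (4 * frob_norm Y + frob_norm D + 2 * frob_norm Y0) * frob_norm D * frob_norm Z"
      unfolding Y0D by (rule frob_norm_hess_diff_le[OF Y(1) D Z])
    also have "\<dots> \<le> 4 * R\<^sup>2 * (8 * \<rho>) * frob_norm D * frob_norm Z"
      using Y Y0 D2 by (intro mult_right_mono mult_left_mono) auto
    also have "\<dots> = (32 * R\<^sup>2 * \<rho>) * frob_norm D * frob_norm Z" by simp
    also have "\<dots> \<le> L * frob_norm D * frob_norm Z" using L(6) by (intro mult_right_mono) auto
    finally show "frob_norm (hess Y0 Z - hess Y Z) \<le> L * frob_norm (Y0 - Y) * frob_norm Z" by (simp add: D_def)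
  qed
  then show ?thesis by blast
qed

lemma objective_bound_ex:
  assumes "0 \<le> \<alpha>" "0 \<le> \<rho>" "\<And>Y. Y \<in> level_set n p m A b \<alpha> \<Longrightarrow> frob_norm Y \<le> \<rho>"
  shows "\<exists>L. objective_bound n p m A b \<alpha> L"
  using bounded_lipschitz_objective[OF assms] C2_objective unfolding objective_bound_def by blast

end

section \<open>Near-singular combinations of random matrices\<close>

definition sym_weight :: "nat \<times> nat \<times> nat \<Rightarrow> real" where
  "sym_weight x = (if fst (snd x) = snd (snd x) then 1 else 2)"

definition upper_pairs :: "nat set \<Rightarrow> (nat \<times> nat) set" where
  "upper_pairs S = {(i, j). i \<in> S \<and> j \<in> S \<and> i \<le> j}"

lemma finite_upper_pairs [simp]: "finite S \<Longrightarrow> finite (upper_pairs S)"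
  by (rule finite_subset[of _ "S \<times> S"]) (auto simp: upper_pairs_def)

text \<open>Pairs strictly below the diagonal mirror those strictly above it, hence the weight 2.
  This is the origin of \<open>sym_weight\<close>.\<close>

lemma sum_min_max:
  assumes S: "finite (S :: nat set)"
  shows "(\<Sum>i\<in>S. \<Sum>j\<in>S. g (min i j) (max i j)) =
    (\<Sum>(i, j)\<in>upper_pairs S. (if i = j then 1 else 2) * (g i j :: real))"
proof -
  let ?L = "{(i, j). i \<in> S \<and> j \<in> S \<and> j < i}" and ?U = "{(i, j). i \<in> S \<and> j \<in> S \<and> i < j}"
  let ?h = "\<lambda>(i, j). g (min i j) (max i j)"
  have fin: "finite (upper_pairs S)" "finite ?L"
    using S by (auto intro: finite_subset[of _ "S \<times> S"])
  have "(\<Sum>i\<in>S. \<Sum>j\<in>S. g (min i j) (max i j)) = sum ?h (S \<times> S)"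
    by (simp add: sum.cartesian_product)
  also have "S \<times> S = upper_pairs S \<union> ?L" by (auto simp: upper_pairs_def)
  also have "sum ?h (upper_pairs S \<union> ?L) = sum ?h (upper_pairs S) + sum ?h ?L"
    using fin by (intro sum.union_disjoint) (auto simp: upper_pairs_def)
  also have "sum ?h ?L = (\<Sum>(i, j)\<in>?U. if i < j then g i j else 0)"
    by (rule sum.reindex_bij_witness[of _ prod.swap prod.swap]) auto
  also have "\<dots> = (\<Sum>(i, j)\<in>upper_pairs S. if i < j then g i j else 0)"
    using fin by (intro sum.mono_neutral_left) (auto simp: upper_pairs_def split: if_splits)
  also have "sum ?h (upper_pairs S) + \<dots> = (\<Sum>(i, j)\<in>upper_pairs S. (if i = j then 1 else 2) * g i j)"
    unfolding sum.distrib[symmetric] by (intro sum.cong) (auto simp: upper_pairs_def)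
  finally show ?thesis .
qed

text \<open>Counting the full square by \<open>sum_min_max\<close> gives |S|^2 = 2 u - |S| for the
  number u of upper pairs.\<close>

lemma card_upper_pairs:
  assumes "finite S"
  shows "card (upper_pairs S) = tau (card S)"
proof -
  have "real (card S) * real (card S) = (\<Sum>(i, j)\<in>upper_pairs S. (if i = j then 1 else 2) * 1)"
    using sum_min_max[OF assms, of "\<lambda>_ _. 1"] by simp
  also have "\<dots> = (\<Sum>x\<in>upper_pairs S. 2 - (if fst x = snd x then 1 else 0))"
    by (intro sum.cong) auto
  also have "\<dots> = 2 * real (card (upper_pairs S)) - (\<Sum>x\<in>upper_pairs S. if fst x = snd x then 1 else 0)"
    by (simp add: sum_subtractf)
  also have "(\<Sum>x\<in>upper_pairs S. if fst x = snd x then 1 else 0) = real (card {x \<in> upper_pairs S. fst x = snd x})"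
    using assms by (simp add: sum.If_cases Int_def)
  also have "{x \<in> upper_pairs S. fst x = snd x} = (\<lambda>i. (i, i)) ` S"
    by (auto simp: upper_pairs_def)
  also have "card ((\<lambda>i. (i, i)) ` S) = card S" by (intro card_image inj_onI) auto
  finally have "real (2 * card (upper_pairs S)) = real (card S * card S + card S)" by simp
  then have "2 * card (upper_pairs S) = card S * card S + card S" by (simp only: of_nat_eq_iff)
  then show ?thesis by (simp add: tau_def choose_two algebra_simps)
qed

lemma sym_index_eq: "sym_index n m = {..<m} \<times> upper_pairs {..<n}"
  by (auto simp: sym_index_def upper_pairs_def)

lemma finite_sym_index [simp]: "finite (sym_index n m)"
  by (simp add: sym_index_eq)

lemma card_sym_index_le: "card (sym_index n m) \<le> m * n\<^sup>2"
proof -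
  have "upper_pairs {..<n} \<subseteq> {..<n} \<times> {..<n}" by (auto simp: upper_pairs_def)
  then have "card (upper_pairs {..<n}) \<le> n\<^sup>2"
    using card_mono[of "{..<n} \<times> {..<n}"] by (fastforce simp: power2_eq_square card_cartesian_product)
  then show ?thesis by (simp add: sym_index_eq card_cartesian_product)
qed

lemma sym_tuple_sym: "sym_tuple n a k \<in> sym_mats n"
  by (intro sym_matsI) (auto simp: sym_tuple_def min.commute max.commute)

lemma sym_tuple_in_ball_iff:
  assumes Abar: "\<And>k. k < m \<Longrightarrow> Abar k \<in> sym_mats n" and \<sigma>: "0 \<le> \<sigma>"
  shows "sym_tuple n a \<in> tuple_ball n m Abar \<sigma> \<longleftrightarrow>
    (\<Sum>x\<in>sym_index n m. sym_weight x * (a x - Abar (fst x) $$ (snd x))\<^sup>2) \<le> \<sigma>\<^sup>2"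
proof -
  have "(frob_norm (sym_tuple n a k - Abar k))\<^sup>2 =
      (\<Sum>y\<in>upper_pairs {..<n}. sym_weight (k, y) * (a (k, y) - Abar k $$ y)\<^sup>2)" if k: "k < m" for k
  proof -
    have c: "Abar k \<in> carrier_mat n n" using Abar[OF k] by (rule sym_mats_carrier)
    have "sym_tuple n a k - Abar k \<in> carrier_mat n n" using c by (auto simp: minus_carrier_mat)
    then have "(frob_norm (sym_tuple n a k - Abar k))\<^sup>2 =
        (\<Sum>i<n. \<Sum>j<n. (a (k, min i j, max i j) - Abar k $$ (i, j))\<^sup>2)"
      using c by (simp add: frob_norm_square_sum sym_tuple_def)
    also have "\<dots> = (\<Sum>i<n. \<Sum>j<n. (a (k, min i j, max i j) - Abar k $$ (min i j, max i j))\<^sup>2)"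
      using sym_mats_entry[OF Abar[OF k]] by (intro sum.cong refl) (auto simp: min_def max_def)
    also have "\<dots> = (\<Sum>(i, j)\<in>upper_pairs {..<n}. (if i = j then 1 else 2) * (a (k, i, j) - Abar k $$ (i, j))\<^sup>2)"
      by (rule sum_min_max) simp
    finally show ?thesis by (simp add: sym_weight_def case_prod_unfold)
  qed
  then have "(\<Sum>k<m. (frob_norm (sym_tuple n a k - Abar k))\<^sup>2) =
      (\<Sum>k<m. \<Sum>y\<in>upper_pairs {..<n}. sym_weight (k, y) * (a (k, y) - Abar k $$ y)\<^sup>2)"
    by (intro sum.cong) auto
  also have "\<dots> = (\<Sum>x\<in>sym_index n m. sym_weight x * (a x - Abar (fst x) $$ (snd x))\<^sup>2)"
    by (simp add: sym_index_eq sum.cartesian_product case_prod_unfold)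
  finally have eq: "(\<Sum>k<m. (frob_norm (sym_tuple n a k - Abar k))\<^sup>2) =
      (\<Sum>x\<in>sym_index n m. sym_weight x * (a x - Abar (fst x) $$ (snd x))\<^sup>2)" .
  have "sqrt x \<le> \<sigma> \<longleftrightarrow> x \<le> \<sigma>\<^sup>2" for x
    using \<sigma> by (metis real_sqrt_le_iff real_sqrt_unique)
  then show ?thesis using sym_tuple_sym by (simp add: tuple_ball_def eq)
qed

definition ball_coords :: "nat \<Rightarrow> nat \<Rightarrow> (nat \<Rightarrow> real mat) \<Rightarrow> real \<Rightarrow> (nat \<times> nat \<times> nat \<Rightarrow> real) set" where
  "ball_coords n m Abar \<sigma> = {a \<in> space (coord_measure n m). sym_tuple n a \<in> tuple_ball n m Abar \<sigma>}"

lemma ball_coords_eq_ellipsoid: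
  assumes "\<And>k. k < m \<Longrightarrow> Abar k \<in> sym_mats n" and "0 \<le> \<sigma>"
  shows "ball_coords n m Abar \<sigma> =
    ellipsoid (sym_index n m) sym_weight (\<lambda>x. Abar (fst x) $$ (snd x)) \<sigma>"
  by (simp add: ball_coords_def ellipsoid_def coord_measure_def sym_tuple_in_ball_iff[OF assms])

text \<open>Restricting the frames to rational ones makes the event a countable union of measurable sets.\<close>

definition rational_frames :: "nat \<Rightarrow> nat \<Rightarrow> (nat \<Rightarrow> nat) \<Rightarrow> real mat set" where
  "rational_frames n p f = {F \<in> normalized_frames n p f. \<forall>i<n. \<forall>a<p. F $$ (i, a) \<in> \<rat>}"

text \<open>The direction \<open>u\<close> and the rows \<open>f\<close> are fixed outside, the
  frame \<open>F\<close> is quantified inside: one event covers all column spaces charted by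
  \<open>f\<close>. The inequality is strict so that it survives the passage from a real to a
  rational frame.\<close>

definition near_singular ::
  "nat \<Rightarrow> nat \<Rightarrow> nat \<Rightarrow> (nat \<Rightarrow> real) \<Rightarrow> (nat \<Rightarrow> nat) \<Rightarrow> real \<Rightarrow> (nat \<times> nat \<times> nat \<Rightarrow> real) set" where
  "near_singular n m p u f d = {a \<in> space (coord_measure n m).
     \<exists>F\<in>rational_frames n p f. frob_norm (adj_map n m (sym_tuple n a) (Matrix.vec m u) * F) < d}"

lemma countable_rational_frames: "countable (rational_frames n p f)"
proof (rule countable_subset)
  show "rational_frames n p f \<subseteq> (\<lambda>g. Matrix.mat n p g) ` (({..<n} \<times> {..<p}) \<rightarrow>\<^sub>E \<rat>)"
  proof
    fix F assume F: "F \<in> rational_frames n p f"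
    then have c: "F \<in> carrier_mat n p" by (simp add: rational_frames_def normalized_frames_def)
    have "F = Matrix.mat n p (restrict (\<lambda>x. F $$ x) ({..<n} \<times> {..<p}))"
      using c by (intro eq_matI) auto
    moreover have "restrict (\<lambda>x. F $$ x) ({..<n} \<times> {..<p}) \<in> ({..<n} \<times> {..<p}) \<rightarrow>\<^sub>E \<rat>"
      using F by (auto simp: rational_frames_def)
    ultimately show "F \<in> (\<lambda>g. Matrix.mat n p g) ` (({..<n} \<times> {..<p}) \<rightarrow>\<^sub>E \<rat>)" by blast
  qed
  show "countable ((\<lambda>g. Matrix.mat n p g) ` ((({..<n} \<times> {..<p}) \<rightarrow>\<^sub>E (\<rat> :: real set))))"
    by (intro countable_image countable_PiE) (auto simp: countable_rat)
qed

lemma sets_near_singular [measurable]: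
  "near_singular n m p u f d \<in> sets (coord_measure n m)"
proof -
  have "near_singular n m p u f d = (\<Union>F\<in>rational_frames n p f. {a \<in> space (coord_measure n m).
      frob_norm (adj_map n m (sym_tuple n a) (Matrix.vec m u) * F) < d})"
    by (auto simp: near_singular_def)
  also have "\<dots> \<in> sets (coord_measure n m)"
  proof (rule sets.countable_UN''[OF countable_rational_frames])
    fix F assume "F \<in> rational_frames n p f"
    then have F: "F \<in> carrier_mat n p" by (simp add: rational_frames_def normalized_frames_def)
    have eq: "frob_norm (adj_map n m (sym_tuple n a) (Matrix.vec m u) * F) =
        sqrt (\<Sum>i<n. \<Sum>j<p. (\<Sum>l<n. (\<Sum>k<m. u k * a (k, min i l, max i l)) * F $$ (l, j))\<^sup>2)" for a
    proof -
      have "adj_map n m (sym_tuple n a) (Matrix.vec m u) * F \<in> carrier_mat n p" using F by auto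
      then have "(frob_norm (adj_map n m (sym_tuple n a) (Matrix.vec m u) * F))\<^sup>2 =
          (\<Sum>i<n. \<Sum>j<p. (\<Sum>l<n. (\<Sum>k<m. u k * a (k, min i l, max i l)) * F $$ (l, j))\<^sup>2)"
        using F by (simp add: frob_norm_square_sum[of _ n p] adj_map_def sym_tuple_def scalar_prod_def atLeast0LessThan)
      then show ?thesis by (simp add: real_sqrt_unique)
    qed
    have [measurable]: "(\<lambda>a. a (k, min i l, max i l)) \<in> borel_measurable (coord_measure n m)"
      if "k \<in> {..<m}" "i \<in> {..<n}" "l \<in> {..<n}" for k i l
    proof -
      have "(k, min i l, max i l) \<in> sym_index n m" using that by (auto simp: sym_index_def)
      then have "(\<lambda>a. a (k, min i l, max i l)) \<in> measurable (coord_measure n m) lborel"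
        unfolding coord_measure_def by (rule measurable_component_singleton)
      then show ?thesis by simp
    qed
    have "(\<lambda>a. sqrt (\<Sum>i<n. \<Sum>j<p. (\<Sum>l<n. (\<Sum>k<m. u k * a (k, min i l, max i l)) * F $$ (l, j))\<^sup>2))
        \<in> borel_measurable (coord_measure n m)"
      by measurable
    then show "{a \<in> space (coord_measure n m).
        frob_norm (adj_map n m (sym_tuple n a) (Matrix.vec m u) * F) < d} \<in> sets (coord_measure n m)"
      unfolding eq by measurable
  qed
  finally show ?thesis .
qed

text \<open>Only block entries of the single matrix with index \<open>k\<close> may differ, so the
  combinations differ by \<open>u k\<close> times the difference of these entries. A coordinate with
  square at least 1 / m makes the division by \<open>u k\<close> cost only sqrt m; the factor 2 sqrt
  (p n) comes from the two frames.\<close>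

lemma near_singular_thin:
  assumes f: "f \<in> {..<p} \<rightarrow>\<^sub>E {..<n}" "inj_on f {..<p}" and k: "k < m" and uk: "1 \<le> real m * (u k)\<^sup>2"
    and a: "a \<in> near_singular n m p u f d" and a': "a' \<in> near_singular n m p u f d"
    and agree: "\<And>x. x \<in> sym_index n m - {k} \<times> upper_pairs (f ` {..<p}) \<Longrightarrow> a x = a' x"
  shows "(\<Sum>x\<in>{k} \<times> upper_pairs (f ` {..<p}). sym_weight x * (a x - a' x)\<^sup>2) \<le> (2 * sqrt (real (p * n * m)) * d)\<^sup>2"
proof -
  let ?S = "f ` {..<p}"
  define M M' where "M = adj_map n m (sym_tuple n a) (Matrix.vec m u)"
    and "M' = adj_map n m (sym_tuple n a') (Matrix.vec m u)"
  have Mc: "M \<in> carrier_mat n n" "M' \<in> carrier_mat n n" by (simp_all add: M_def M'_def)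
  have Mij: "M $$ (i, j) = (\<Sum>k<m. u k * a (k, min i j, max i j))"
    "M' $$ (i, j) = (\<Sum>k<m. u k * a' (k, min i j, max i j))" if "i < n" "j < n" for i j
    using that by (simp_all add: M_def M'_def adj_map_def sym_tuple_def)
  obtain F where F: "F \<in> rational_frames n p f" "frob_norm (M * F) < d"
    using a by (auto simp: near_singular_def M_def)
  obtain F' where F': "F' \<in> rational_frames n p f" "frob_norm (M' * F') < d"
    using a' by (auto simp: near_singular_def M'_def)
  have Fc: "F \<in> carrier_mat n p" "F' \<in> carrier_mat n p"
    using F F' by (auto simp: rational_frames_def normalized_frames_def)
  have Fn: "frob_norm F \<le> sqrt (real (p * n))" "frob_norm F' \<le> sqrt (real (p * n))"
    using F(1) F'(1) frob_norm_frame_le[OF Fc(1)] frob_norm_frame_le[OF Fc(2)]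
    by (auto simp: rational_frames_def normalized_frames_def)
  have Fid: "F $$ (f \<gamma>, \<alpha>) = (if \<gamma> = \<alpha> then 1 else 0)" "F' $$ (f \<gamma>, \<alpha>) = (if \<gamma> = \<alpha> then 1 else 0)"
    if "\<gamma> < p" "\<alpha> < p" for \<alpha> \<gamma>
    using F(1) F'(1) that by (auto simp: rational_frames_def normalized_frames_def)
  have fn: "f \<gamma> < n" if "\<gamma> < p" for \<gamma> using f(1) that by auto
  define E where "E i j = (if i \<in> ?S \<and> j \<in> ?S then u k * (a (k, min i j, max i j) - a' (k, min i j, max i j)) else 0)" for i j
  have E: "M $$ (i, j) - M' $$ (i, j) = E i j" if ij: "i < n" "j < n" for i j
  proof -
    have "M $$ (i, j) - M' $$ (i, j) = (\<Sum>k<m. u k * (a (k, min i j, max i j) - a' (k, min i j, max i j)))"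
      using ij by (simp add: Mij sum_subtractf algebra_simps)
    also have "\<dots> = (\<Sum>l<m. if l = k then E i j else 0)"
    proof (rule sum.cong)
      fix l assume l: "l \<in> {..<m}"
      have idx: "(l, min i j, max i j) \<in> sym_index n m" using l ij by (auto simp: sym_index_def)
      show "u l * (a (l, min i j, max i j) - a' (l, min i j, max i j)) = (if l = k then E i j else 0)"
      proof (cases "l = k \<and> i \<in> ?S \<and> j \<in> ?S")
        case False
        then have "(l, min i j, max i j) \<notin> {k} \<times> upper_pairs ?S"
          by (auto simp: upper_pairs_def min_def max_def split: if_splits)
        then have "a (l, min i j, max i j) = a' (l, min i j, max i j)" using idx agree by auto
        then show ?thesis using False by (auto simp: E_def)
      qed (auto simp: E_def)
    qed simp
    also have "\<dots> = E i j" using k by simp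
    finally show ?thesis .
  qed
  have M'sym: "M' $$ (i, j) = M' $$ (j, i)" if "i < n" "j < n" for i j
    using that by (simp add: Mij min.commute max.commute)
  \<comment> \<open>\<open>W = F'\<^sup>T (M - M') F\<close> is small because \<open>M F\<close> and \<open>M' F'\<close> are, and it equals the block of
    \<open>M - M'\<close> in the rows and columns \<open>f\<close>, since \<open>M - M'\<close> vanishes outside this block and \<open>F\<close>, \<open>F'\<close>
    restrict to the identity on the rows \<open>f\<close>.\<close>
  define W where "W = F'\<^sup>T * (M * F) - (M' * F')\<^sup>T * F"
  have Wc: "W \<in> carrier_mat p p" using Fc Mc by (auto simp: W_def)
  have W: "W $$ (\<alpha>, \<beta>) = E (f \<alpha>) (f \<beta>)" if ab: "\<alpha> < p" "\<beta> < p" for \<alpha> \<beta>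
  proof -
    have "(F'\<^sup>T * (M * F)) $$ (\<alpha>, \<beta>) = (\<Sum>i<n. \<Sum>j<n. F' $$ (i, \<alpha>) * M $$ (i, j) * F $$ (j, \<beta>))"
      using ab Fc Mc by (simp add: scalar_prod_def atLeast0LessThan sum_distrib_left mult.assoc)
    moreover have "((M' * F')\<^sup>T * F) $$ (\<alpha>, \<beta>) = (\<Sum>i<n. \<Sum>j<n. F' $$ (i, \<alpha>) * M' $$ (i, j) * F $$ (j, \<beta>))"
    proof -
      have "((M' * F')\<^sup>T * F) $$ (\<alpha>, \<beta>) = (\<Sum>j<n. \<Sum>i<n. M' $$ (j, i) * F' $$ (i, \<alpha>) * F $$ (j, \<beta>))"
        using ab Fc Mc by (simp add: scalar_prod_def atLeast0LessThan sum_distrib_right)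
      also have "\<dots> = (\<Sum>j<n. \<Sum>i<n. F' $$ (i, \<alpha>) * M' $$ (i, j) * F $$ (j, \<beta>))"
      proof (intro sum.cong refl)
        fix i j assume "j \<in> {..<n}" "i \<in> {..<n}"
        then have "M' $$ (j, i) = M' $$ (i, j)" using M'sym by auto
        then show "M' $$ (j, i) * F' $$ (i, \<alpha>) * F $$ (j, \<beta>) = F' $$ (i, \<alpha>) * M' $$ (i, j) * F $$ (j, \<beta>)" by simp
      qed
      also have "\<dots> = (\<Sum>i<n. \<Sum>j<n. F' $$ (i, \<alpha>) * M' $$ (i, j) * F $$ (j, \<beta>))" by (rule sum.swap)
      finally show ?thesis .
    qed
    ultimately have "W $$ (\<alpha>, \<beta>) = (\<Sum>i<n. \<Sum>j<n. F' $$ (i, \<alpha>) * (M $$ (i, j) - M' $$ (i, j)) * F $$ (j, \<beta>))"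
      using ab Fc Mc by (simp add: W_def sum_subtractf algebra_simps del: index_mult_mat(1))
    also have "\<dots> = (\<Sum>i<n. \<Sum>j<n. F' $$ (i, \<alpha>) * E i j * F $$ (j, \<beta>))"
      by (intro sum.cong refl) (auto simp: E)
    also have "\<dots> = (\<Sum>i\<in>?S. \<Sum>j<n. F' $$ (i, \<alpha>) * E i j * F $$ (j, \<beta>))"
      using fn by (intro sum.mono_neutral_right) (auto simp: E_def)
    also have "\<dots> = (\<Sum>i\<in>?S. \<Sum>j\<in>?S. F' $$ (i, \<alpha>) * E i j * F $$ (j, \<beta>))"
      using fn by (intro sum.cong refl sum.mono_neutral_right) (auto simp: E_def)
    also have "\<dots> = (\<Sum>\<gamma><p. \<Sum>\<delta><p. F' $$ (f \<gamma>, \<alpha>) * E (f \<gamma>) (f \<delta>) * F $$ (f \<delta>, \<beta>))"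
      using f(2) by (simp add: sum.reindex)
    also have "\<dots> = (\<Sum>\<gamma><p. \<Sum>\<delta><p. if \<gamma> = \<alpha> then if \<delta> = \<beta> then E (f \<gamma>) (f \<delta>) else 0 else 0)"
      using ab by (intro sum.cong refl) (auto simp: Fid)
    also have "\<dots> = (\<Sum>\<gamma><p. if \<gamma> = \<alpha> then E (f \<gamma>) (f \<beta>) else 0)"
      using ab by (intro sum.cong refl) auto
    also have "\<dots> = E (f \<alpha>) (f \<beta>)" using ab by simp
    finally show ?thesis .
  qed
  have Wn: "frob_norm W \<le> 2 * sqrt (real (p * n)) * d"
  proof -
    have "frob_norm W \<le> frob_norm (F'\<^sup>T * (M * F)) + frob_norm ((M' * F')\<^sup>T * F)"
      unfolding W_def using Fc Mc by (intro frob_norm_diff_le[of _ p p]) auto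
    also have "\<dots> \<le> frob_norm (F'\<^sup>T) * frob_norm (M * F) + frob_norm ((M' * F')\<^sup>T) * frob_norm F"
      using Fc Mc by (intro add_mono frob_norm_mult_le[of _ p n _ p]) auto
    also have "\<dots> \<le> sqrt (real (p * n)) * d + d * sqrt (real (p * n))"
      unfolding frob_norm_transpose using F(2) F'(2) Fn order_trans[OF frob_norm_nonneg less_imp_le[OF F(2)]]
      by (intro add_mono mult_mono) auto
    finally show ?thesis by (simp add: algebra_simps)
  qed
  let ?s = "\<Sum>x\<in>{k} \<times> upper_pairs ?S. sym_weight x * (a x - a' x)\<^sup>2"
  have "(frob_norm W)\<^sup>2 = (\<Sum>\<alpha><p. \<Sum>\<beta><p. (E (f \<alpha>) (f \<beta>))\<^sup>2)"
    by (simp add: frob_norm_square_sum[OF Wc] W)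
  also have "\<dots> = (\<Sum>i\<in>?S. \<Sum>j\<in>?S. (E i j)\<^sup>2)" using f(2) by (simp add: sum.reindex)
  also have "\<dots> = (\<Sum>i\<in>?S. \<Sum>j\<in>?S. (u k)\<^sup>2 * (a (k, min i j, max i j) - a' (k, min i j, max i j))\<^sup>2)"
    by (intro sum.cong refl) (simp add: E_def power_mult_distrib)
  also have "\<dots> = (\<Sum>(i, j)\<in>upper_pairs ?S. (if i = j then 1 else 2) * ((u k)\<^sup>2 * (a (k, i, j) - a' (k, i, j))\<^sup>2))"
    by (rule sum_min_max) simp
  also have "\<dots> = (u k)\<^sup>2 * (\<Sum>y\<in>upper_pairs ?S. sym_weight (k, y) * (a (k, y) - a' (k, y))\<^sup>2)"
    unfolding sum_distrib_left by (intro sum.cong refl) (auto simp: sym_weight_def)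
  also have "(\<Sum>y\<in>upper_pairs ?S. sym_weight (k, y) * (a (k, y) - a' (k, y))\<^sup>2) = ?s"
    by (rule sum.reindex_bij_witness[of _ snd "\<lambda>y. (k, y)"]) auto
  finally have Ws: "(frob_norm W)\<^sup>2 = (u k)\<^sup>2 * ?s" .
  have s0: "0 \<le> ?s" by (intro sum_nonneg mult_nonneg_nonneg) (auto simp: sym_weight_def)
  have "?s \<le> (real m * (u k)\<^sup>2) * ?s" using mult_right_mono[OF uk s0] by simp
  also have "\<dots> = real m * (frob_norm W)\<^sup>2" by (simp add: Ws)
  also have "\<dots> \<le> real m * (2 * sqrt (real (p * n)) * d)\<^sup>2"
    using Wn by (intro mult_left_mono power_mono) auto
  also have "\<dots> = (2 * sqrt (real (p * n * m)) * d)\<^sup>2"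
    by (simp add: power_mult_distrib real_sqrt_mult)
  finally show ?thesis .
qed

lemma unit_sphere_large_coordinate:
  assumes u: "u \<in> unit_sphere m" and m: "1 \<le> m"
  obtains k where "k < m" "1 \<le> real m * (u k)\<^sup>2"
proof (rule ccontr)
  assume "\<not> thesis"
  then have *: "\<And>k. k < m \<Longrightarrow> real m * (u k)\<^sup>2 < 1" using that by force
  have "(\<Sum>k<m. (u k)\<^sup>2) = 1"
    using u by (simp add: unit_sphere_def L2_set_def)
  then have "real m = (\<Sum>k<m. real m * (u k)\<^sup>2)" by (simp add: sum_distrib_left[symmetric])
  also have "\<dots> < (\<Sum>k<m. 1)" using m * by (intro sum_strict_mono) (auto simp: lessThan_empty_iff)
  finally show False by simp
qed

lemma tau_real: "2 * real (tau p) = real p * (real p + 1)"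
proof -
  have "2 * ((p + 1) * p div 2) = (p + 1) * p" by simp
  then have "2 * tau p = (p + 1) * p" by (simp add: tau_def choose_two)
  then have "real (2 * tau p) = real ((p + 1) * p)" by (simp only:)
  then show ?thesis by (simp add: algebra_simps)
qed

text \<open>The frames contribute \<open>p * n\<close> to the radius \<open>?r\<close>, and the
  quotient \<open>card ?I / card ?J\<close> is at most 2 m n^2 / p^2, whose root removes the
  \<open>p\<close> again. The constant 15 is 6 times 5 / 2: the 6 is the numerical factor of
  \<open>?r\<close>, and 5 / 2 bounds the root of 2 * 3, where 3 bounds
  \<open>exp 1\<close>.\<close>

lemma prob_near_singular_le:
  assumes Abar: "\<And>k. k < m \<Longrightarrow> Abar k \<in> sym_mats n" and \<sigma>: "0 < \<sigma>" and \<delta>: "0 < \<delta>"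
    and nmp: "1 \<le> n" "1 \<le> m" "1 \<le> p"
    and f: "f \<in> {..<p} \<rightarrow>\<^sub>E {..<n}" "inj_on f {..<p}" and u: "u \<in> unit_sphere m"
  shows "measure (uniform_ball n m Abar \<sigma>) (near_singular n m p u f (3 * sqrt (real (p * n)) * \<delta>)) \<le>
    (15 * real m * (real n)\<^sup>2 * \<delta> / \<sigma>) ^ tau p"
proof -
  obtain k where k: "k < m" "1 \<le> real m * (u k)\<^sup>2" using unit_sphere_large_coordinate[OF u nmp(2)] .
  let ?S = "f ` {..<p}" and ?d = "3 * sqrt (real (p * n)) * \<delta>"
  let ?J = "{k} \<times> upper_pairs ?S" and ?I = "sym_index n m"
  let ?r = "2 * sqrt (real (p * n * m)) * ?d"
  have cS: "card ?S = p" using f(2) by (simp add: card_image)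
  have cJ: "card ?J = tau p" by (simp add: card_cartesian_product card_upper_pairs cS)
  have JI: "?J \<subseteq> ?I" using k f(1) by (auto simp: sym_index_eq upper_pairs_def PiE_iff)
  have tp: "0 < tau p" using tau_real[of p] nmp by (intro Nat.gr0I) auto
  have Jne: "?J \<noteq> {}" using cJ tp by (metis card.empty less_irrefl)
  have r: "0 < ?r" using nmp \<delta> by simp
  have "measure (uniform_ball n m Abar \<sigma>) (near_singular n m p u f ?d) =
    measure (uniform_measure (lborel_on ?I) (ellipsoid ?I sym_weight (\<lambda>x. Abar (fst x) $$ (snd x)) \<sigma>))
      (near_singular n m p u f ?d)"
    using ball_coords_eq_ellipsoid[of m Abar n \<sigma>] Abar \<sigma>
    by (simp add: uniform_ball_def ball_coords_def coord_measure_def)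
  also have "\<dots> \<le> (sqrt (exp 1 * real (card ?I) / real (card ?J)) * ?r / \<sigma>) ^ card ?J"
  proof (rule prob_thin_sections_le[OF finite_sym_index JI Jne _ \<sigma> r])
    show "1 \<le> sym_weight x" for x by (simp add: sym_weight_def)
    show "near_singular n m p u f ?d \<in> sets (lborel_on ?I)"
      using sets_near_singular by (simp add: coord_measure_def)
    fix a a' assume "a \<in> near_singular n m p u f ?d" "a' \<in> near_singular n m p u f ?d"
      "\<And>x. x \<in> ?I - ?J \<Longrightarrow> a x = a' x"
    then show "(\<Sum>x\<in>?J. sym_weight x * (a x - a' x)\<^sup>2) \<le> ?r\<^sup>2"
      by (rule near_singular_thin[where u = u and a = a and a' = a', OF f k])
  qed
  also have "\<dots> \<le> (15 * real m * (real n)\<^sup>2 * \<delta> / \<sigma>) ^ tau p"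
    unfolding cJ
  proof (intro power_mono divide_right_mono)
    have "sqrt (exp 1 * real (card ?I) / real (tau p)) \<le> sqrt (6 * real m * (real n / real p)\<^sup>2)"
    proof (rule real_sqrt_le_mono)
      have "real (card ?I) \<le> real (m * n\<^sup>2)" using card_sym_index_le by (simp only: of_nat_le_iff)
      then have 1: "exp 1 * real (card ?I) \<le> 3 * (real m * (real n)\<^sup>2)"
        using exp_le by (intro mult_mono) auto
      have "(real p)\<^sup>2 \<le> 2 * real (tau p)" unfolding tau_real power2_eq_square by (simp add: algebra_simps)
      then have 2: "(real p)\<^sup>2 / 2 \<le> real (tau p)" by simp
      have "exp 1 * real (card ?I) / real (tau p) \<le> 3 * (real m * (real n)\<^sup>2) / ((real p)\<^sup>2 / 2)"
        using 1 2 nmp by (intro frac_le) auto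
      then show "exp 1 * real (card ?I) / real (tau p) \<le> 6 * real m * (real n / real p)\<^sup>2"
        by (simp add: power_divide)
    qed
    also have "\<dots> = sqrt 6 * sqrt (real m) * (real n / real p)"
      by (simp add: real_sqrt_mult real_sqrt_divide)
    also have "\<dots> \<le> (5 / 2) * sqrt (real m) * (real n / real p)"
    proof (intro mult_right_mono)
      show "sqrt 6 \<le> 5 / 2" by (rule real_le_lsqrt) (auto simp: power2_eq_square)
    qed auto
    finally have "sqrt (exp 1 * real (card ?I) / real (tau p)) * ?r \<le> (5 / 2) * sqrt (real m) * (real n / real p) * ?r"
      using r by (intro mult_right_mono) auto
    also have "\<dots> = 15 * (sqrt (real m) * sqrt (real m)) * (sqrt (real (p * n)) * sqrt (real (p * n))) * (real n / real p) * \<delta>"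
    proof -
      have "(5 / 2) * x * y * (2 * (q * x) * (3 * q * \<delta>)) = 15 * (x * x) * (q * q) * y * \<delta>" for x y q :: real
        by simp
      moreover have "sqrt (real (p * n * m)) = sqrt (real (p * n)) * sqrt (real m)" by (simp add: real_sqrt_mult)
      ultimately show ?thesis by metis
    qed
    also have "\<dots> = 15 * real m * real (p * n) * (real n / real p) * \<delta>" by simp
    also have "\<dots> = 15 * real m * (real n)\<^sup>2 * \<delta>" using nmp by (simp add: power2_eq_square)
    finally show "sqrt (exp 1 * real (card ?I) / real (tau p)) * ?r \<le> 15 * real m * (real n)\<^sup>2 * \<delta>" .
    show "0 \<le> sqrt (exp 1 * real (card ?I) / real (tau p)) * ?r / \<sigma>"
      using r \<sigma> \<delta> by (intro divide_nonneg_pos mult_nonneg_nonneg) auto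
  qed (use \<sigma> in simp)
  finally show ?thesis .
qed

section \<open>Passage to rational frames and to the net of directions\<close>

lemma ex_rational_near:
  assumes x: "\<bar>x::real\<bar> \<le> 1" and e: "0 < e"
  obtains y where "y \<in> \<rat>" "\<bar>y\<bar> \<le> 1" "\<bar>y - x\<bar> \<le> e"
\<comment> \<open>A nonnegative \<open>x\<close> is approximated from below and a negative one from
  above, each time by less than 1, so the approximation stays in [-1, 1].\<close>
proof (cases "0 \<le> x")
  case True
  obtain q where "q \<in> \<rat>" "x - min e 1 < q" "q < x" using Rats_dense_in_real[of "x - min e 1" x] e by auto
  then show ?thesis using that[of q] True x by auto
next
  case False
  obtain q where "q \<in> \<rat>" "x < q" "q < x + min e 1" using Rats_dense_in_real[of x "x + min e 1"] e by auto
  then show ?thesis using that[of q] False x by auto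
qed

text \<open>Entries that are already rational are kept, so the identity block on the rows
  \<open>f\<close> survives exactly; the strict inequality leaves room for perturbing the
  others.\<close>

lemma ex_rational_frame:
  assumes f: "f \<in> {..<p} \<rightarrow>\<^sub>E {..<n}" and F: "F \<in> normalized_frames n p f"
    and M: "M \<in> carrier_mat n n" and d: "frob_norm (M * F) < d"
  obtains F' where "F' \<in> rational_frames n p f" "frob_norm (M * F') < d"
proof -
  have Fc: "F \<in> carrier_mat n p" using F by (simp add: normalized_frames_def)
  \<comment> \<open>Half the gap up to \<open>d\<close>, divided by an upper bound for the effect of
    an entrywise perturbation; the added ones keep the denominator positive.\<close>
  define e where "e = (d - frob_norm (M * F)) / (2 * ((frob_norm M + 1) * (sqrt (real (p * n)) + 1)))"
  have pos: "0 < (frob_norm M + 1) * (sqrt (real (p * n)) + 1)"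
    by (intro mult_pos_pos add_nonneg_pos) auto
  have e: "0 < e" unfolding e_def
  proof (rule divide_pos_pos)
    show "0 < 2 * ((frob_norm M + 1) * (sqrt (real (p * n)) + 1))" using pos by linarith
  qed (use d in simp)
  have "\<exists>y. y \<in> \<rat> \<and> \<bar>y\<bar> \<le> 1 \<and> \<bar>y - F $$ (i, a)\<bar> \<le> e \<and> (F $$ (i, a) \<in> \<rat> \<longrightarrow> y = F $$ (i, a))"
    if "i < n" "a < p" for i a
  proof (cases "F $$ (i, a) \<in> \<rat>")
    case True
    then show ?thesis using F e that by (intro exI[of _ "F $$ (i, a)"]) (auto simp: normalized_frames_def)
  next
    case False
    have "\<bar>F $$ (i, a)\<bar> \<le> 1" using F that by (auto simp: normalized_frames_def)
    then obtain y where "y \<in> \<rat>" "\<bar>y\<bar> \<le> 1" "\<bar>y - F $$ (i, a)\<bar> \<le> e" using ex_rational_near e by blast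
    then show ?thesis using False by blast
  qed
  then obtain g where g: "\<And>i a. i < n \<Longrightarrow> a < p \<Longrightarrow> g i a \<in> \<rat> \<and> \<bar>g i a\<bar> \<le> 1 \<and> \<bar>g i a - F $$ (i, a)\<bar> \<le> e \<and>
      (F $$ (i, a) \<in> \<rat> \<longrightarrow> g i a = F $$ (i, a))"
    by metis
  define F' where "F' = Matrix.mat n p (\<lambda>(i, a). g i a)"
  have F'c: "F' \<in> carrier_mat n p" by (simp add: F'_def)
  have "F' $$ (f a, b) = (if a = b then 1 else 0)" if ab: "a < p" "b < p" for a b
  proof -
    have fa: "f a < n" using f ab by auto
    have "F $$ (f a, b) = (if a = b then 1 else 0)" using F ab by (simp add: normalized_frames_def)
    moreover from this have "F $$ (f a, b) \<in> \<rat>" by simp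
    ultimately show ?thesis using g[OF fa ab(2)] fa ab by (simp add: F'_def)
  qed
  then have F'r: "F' \<in> rational_frames n p f"
    using g by (auto simp: rational_frames_def normalized_frames_def F'_def)
  have "frob_norm (M * F') < d"
  proof -
    have dc: "F' - F \<in> carrier_mat n p" using F'c Fc by auto
    have "(frob_norm (F' - F))\<^sup>2 = (\<Sum>i<n. \<Sum>a<p. (g i a - F $$ (i, a))\<^sup>2)"
      using Fc by (subst frob_norm_square_sum[OF dc]) (simp add: F'_def)
    also have "\<dots> \<le> (\<Sum>i<n. \<Sum>a<p. e\<^sup>2)"
    proof (intro sum_mono)
      fix i a assume "i \<in> {..<n}" "a \<in> {..<p}"
      then have "\<bar>g i a - F $$ (i, a)\<bar> \<le> e" using g by auto
      then show "(g i a - F $$ (i, a))\<^sup>2 \<le> e\<^sup>2" by (metis abs_ge_zero power2_abs power_mono)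
    qed
    also have "\<dots> = (sqrt (real (p * n)) * e)\<^sup>2" by (simp add: power_mult_distrib)
    finally have 1: "frob_norm (F' - F) \<le> sqrt (real (p * n)) * e"
      by (rule power2_le_imp_le) (use e in simp)
    have "M * F' = M * F + M * (F' - F)"
    proof -
      have "F' = F + (F' - F)" using F'c Fc by (intro eq_matI) auto
      then have "M * F' = M * (F + (F' - F))" by simp
      also have "\<dots> = M * F + M * (F' - F)" by (rule mult_add_distrib_mat[OF M Fc dc])
      finally show ?thesis .
    qed
    then have "frob_norm (M * F') \<le> frob_norm (M * F) + frob_norm (M * (F' - F))"
      using frob_norm_add_le[of "M * F" n p "M * (F' - F)"] M Fc dc by auto
    also have "frob_norm (M * (F' - F)) \<le> frob_norm M * (sqrt (real (p * n)) * e)"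
      using frob_norm_mult_le[OF M dc] 1 by (meson frob_norm_nonneg mult_left_mono order_trans)
    also have "\<dots> \<le> ((frob_norm M + 1) * (sqrt (real (p * n)) + 1)) * e"
      using e by (simp add: algebra_simps)
    also have "\<dots> = (d - frob_norm (M * F)) / 2"
    proof -
      have *: "x * (y / (2 * x)) = y / 2" if "0 < x" for x y :: real using that by simp
      show ?thesis unfolding e_def by (rule *[OF pos])
    qed
    finally have "frob_norm (M * F') \<le> frob_norm (M * F) + (d - frob_norm (M * F)) / 2" by simp
    then show ?thesis using d by argo
  qed
  then show ?thesis using that F'r by blast
qed

text \<open>The tolerance has three parts, each \<delta> sqrt (p n): one for the direction
  \<open>l\<close> itself, one for moving \<open>l\<close> to a net point at distance at most
  \<delta> / R, and one that makes the inequality strict, as rational frames require.\<close>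

lemma near_singular_cover:
  assumes a: "a \<in> space (coord_measure n m)" and np: "1 \<le> n" "1 \<le> p"
    and R: "0 < R" "\<And>w. w \<in> carrier_vec m \<Longrightarrow> frob_norm (adj_map n m (sym_tuple n a) w) \<le> R * vnorm w"
    and l: "l \<in> carrier_vec m" "vnorm l = 1"
    and Y: "Y \<in> carrier_mat n p" and s: "0 < s" "\<And>v. v \<in> carrier_vec p \<Longrightarrow> s * vnorm v \<le> vnorm (Y *\<^sub>v v)"
    and \<delta>: "0 < \<delta>" "frob_norm (adj_map n m (sym_tuple n a) l * Y) \<le> s * \<delta>"
    and T: "\<And>u. u \<in> unit_sphere m \<Longrightarrow> \<exists>v\<in>T. L2_set (\<lambda>i. u i - v i) {..<m} \<le> \<delta> / R"
  shows "\<exists>u\<in>T. \<exists>f\<in>{..<p} \<rightarrow>\<^sub>E {..<n}. inj_on f {..<p} \<and>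
    a \<in> near_singular n m p u f (3 * sqrt (real (p * n)) * \<delta>)"
proof -
  let ?adj = "adj_map n m (sym_tuple n a)"
  obtain f F where f: "f \<in> {..<p} \<rightarrow>\<^sub>E {..<n}" "inj_on f {..<p}" and F: "F \<in> normalized_frames n p f"
    and SF: "\<And>S. S \<in> carrier_mat n n \<Longrightarrow> frob_norm (S * F) \<le> frob_norm (S * Y) * (sqrt (real (p * n)) / s)"
    using frame_factorization[OF Y s] by blast
  have Fc: "F \<in> carrier_mat n p" using F by (simp add: normalized_frames_def)
  have Fn: "frob_norm F \<le> sqrt (real (p * n))"
    using F by (intro frob_norm_frame_le) (auto simp: normalized_frames_def)
  define u where "u = restrict (\<lambda>i. l $ i) {..<m}"
  have "u \<in> unit_sphere m"
    using l by (simp add: u_def unit_sphere_def vnorm_L2 L2_set_def)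
  then obtain v where v: "v \<in> T" "L2_set (\<lambda>i. u i - v i) {..<m} \<le> \<delta> / R" using T by blast
  let ?v = "Matrix.vec m v" and ?w = "Matrix.vec m v - l"
  have w: "?w \<in> carrier_vec m" using l by simp
  have "vnorm ?w = L2_set (\<lambda>i. u i - v i) {..<m}"
    using l by (simp add: vnorm_L2[OF w] L2_set_def u_def power2_commute)
  then have wn: "vnorm ?w \<le> \<delta> / R" using v by simp
  have "?v = l + ?w" using l by (intro eq_vecI) auto
  then have "?adj ?v = ?adj l + ?adj ?w" using adj_map_add[OF l(1) w] by metis
  then have "?adj ?v * F = ?adj l * F + ?adj ?w * F"
    using Fc by (simp add: add_mult_distrib_mat[of _ n n _ _ p])
  then have "frob_norm (?adj ?v * F) \<le> frob_norm (?adj l * F) + frob_norm (?adj ?w * F)"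
    using frob_norm_add_le[of "?adj l * F" n p "?adj ?w * F"] mult_carrier_mat[OF adj_map_carrier(1) Fc] by simp
  also have "frob_norm (?adj l * F) \<le> (s * \<delta>) * (sqrt (real (p * n)) / s)"
    by (rule order_trans[OF SF mult_right_mono[OF \<delta>(2)]]) (use s(1) in auto)
  also have "frob_norm (?adj ?w * F) \<le> (R * (\<delta> / R)) * sqrt (real (p * n))"
  proof -
    have "frob_norm (?adj ?w * F) \<le> frob_norm (?adj ?w) * frob_norm F"
      using Fc by (intro frob_norm_mult_le) auto
    also have "\<dots> \<le> (R * vnorm ?w) * sqrt (real (p * n))"
      using R(2)[OF w] Fn R(1) by (intro mult_mono) auto
    also have "\<dots> \<le> (R * (\<delta> / R)) * sqrt (real (p * n))"
      using wn R(1) by (intro mult_right_mono mult_left_mono) auto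
    finally show ?thesis .
  qed
  finally have "frob_norm (?adj ?v * F) \<le> 2 * sqrt (real (p * n)) * \<delta>"
    using s(1) R(1) by (simp add: algebra_simps)
  also have "\<dots> < 3 * sqrt (real (p * n)) * \<delta>"
    using np \<delta>(1) by simp
  finally obtain F' where "F' \<in> rational_frames n p f"
      "frob_norm (?adj ?v * F') < 3 * sqrt (real (p * n)) * \<delta>"
    using ex_rational_frame[OF f(1) F, of "?adj ?v"] by auto
  then have "a \<in> near_singular n m p v f (3 * sqrt (real (p * n)) * \<delta>)"
    using a by (auto simp: near_singular_def)
  then show ?thesis using v(1) f by blast
qed

section \<open>The failure probability\<close>

lemma tau_mono: "p \<le> q \<Longrightarrow> tau p \<le> tau q"
  by (simp add: tau_def binomial_right_mono)

definition failure_const :: real where "failure_const = 3 ^ 351"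

lemma failure_const_ge_1: "1 \<le> failure_const"
  unfolding failure_const_def by (rule one_le_power) simp

text \<open>For \<open>n \<ge> 27\<close> the power of \<open>n\<close> wins; for \<open>n < 27\<close> the exponent \<open>tau p\<close> is at most \<open>tau 26 = 351\<close>.\<close>

lemma three_power_tau_le:
  assumes p: "2 \<le> p" "p \<le> n"
  shows "3 ^ tau p * real n ^ p \<le> failure_const * real n ^ tau p"
proof -
  have "3 * p \<le> 2 * tau p"
  proof -
    have "real p * 3 \<le> real p * (real p + 1)" using p by (intro mult_left_mono) auto
    then have "real (3 * p) \<le> real (2 * tau p)" using tau_real[of p] by simp
    then show ?thesis by (simp only: of_nat_le_iff)
  qed
  then have D: "p \<le> tau p" "tau p \<le> 3 * (tau p - p)" by auto
  show ?thesis
  proof (cases "27 \<le> n")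
    case True
    have "(3::real) ^ tau p \<le> 3 ^ (3 * (tau p - p))" using D by (intro power_increasing) auto
    also have "\<dots> = 27 ^ (tau p - p)" by (simp add: power_mult)
    also have "\<dots> \<le> real n ^ (tau p - p)" using True by (intro power_mono) auto
    finally have "3 ^ tau p * real n ^ p \<le> real n ^ (tau p - p) * real n ^ p"
      by (intro mult_right_mono) auto
    also have "\<dots> = 1 * real n ^ tau p" using D by (simp add: power_add[symmetric])
    also have "\<dots> \<le> failure_const * real n ^ tau p"
      using failure_const_ge_1 by (intro mult_right_mono) auto
    finally show ?thesis .
  next
    case False
    then have "tau p \<le> tau 26" using p by (intro tau_mono) auto
    also have "tau 26 = 351" by (simp add: tau_def choose_two)
    finally have "tau p \<le> 351" .
    then have "(3::real) ^ tau p \<le> failure_const"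
      unfolding failure_const_def by (rule power_increasing) simp
    moreover have "real n ^ p \<le> real n ^ tau p" using D p by (intro power_increasing) auto
    ultimately show ?thesis using failure_const_ge_1 by (intro mult_mono) auto
  qed
qed

text \<open>In terms of z = x / (3 \<kappa>) and w = z^(1/\<eta>), \<epsilon> equals w x / R. The
  net factor is at most (3/2) / (z w) per dimension and the block factor at most 2 w / n per
  coordinate. The exponent of z is then \<tau>(p) / \<eta> - (1 + 1/\<eta>) m, which the hypothesis
  on \<tau>(p), divided by \<eta>, bounds below by t.\<close>

lemma failure_bound:
  fixes n m p :: nat and \<eta> t \<sigma> \<rho> \<kappa> R K \<epsilon> :: real
  assumes \<eta>: "0 < \<eta>" and t: "0 < t" and m: "1 \<le> m" and p: "2 \<le> p" "p \<le> n"
    and tau: "(1 + \<eta>) * real m + \<eta> * t \<le> real (tau p)"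
    and \<sigma>: "0 < \<sigma>" "\<sigma> \<le> R" and \<kappa>: "0 < \<kappa>" and \<rho>: "0 < \<rho>" and small: "\<rho> * \<sigma> * R \<le> \<kappa> / 2"
    and \<rho>1: "\<rho> \<le> 1"
    and K: "K = R * (3 * \<kappa>) powr (1 / \<eta>)"
    and \<epsilon>: "\<epsilon> = inverse K * (\<rho> * \<sigma>\<^sup>2 / (2 * real n ^ 3 * real m)) powr (1 + 1 / \<eta>)"
  shows "(1 + 2 / (\<epsilon> / (4 * \<rho> * \<sigma>))) ^ m * real n ^ p *
      (15 * real m * (real n)\<^sup>2 * (\<epsilon> * R / (4 * \<rho> * \<sigma>)) / \<sigma>) ^ tau p
    \<le> (failure_const powr (1 / t) / (6 * \<kappa>) * \<sigma>\<^sup>2 / (real n ^ 3 * real m)) powr t" (is "?lhs \<le> ?rhs powr t")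
proof -
  have R: "0 < R" using \<sigma> by simp
  have n: "1 \<le> real n" "1 \<le> real m" using p m by auto
  have nm: "0 < real n ^ 3 * real m" "1 \<le> real n ^ 3 * real m"
    using n by (auto intro!: mult_pos_pos mult_ge1_I one_le_power)
  define x where "x = \<rho> * \<sigma>\<^sup>2 / (2 * real n ^ 3 * real m)"
  define z where "z = x / (3 * \<kappa>)"
  define w where "w = z powr (1 / \<eta>)"
  have x: "0 < x" using \<rho> \<sigma> n by (simp add: x_def)
  have x_eq: "x * (2 * (real n ^ 3 * real m)) = \<rho> * \<sigma>\<^sup>2"
  proof -
    have *: "a / b * b = a" if "b \<noteq> 0" for a b :: real using that by simp
    show ?thesis unfolding x_def mult.assoc by (rule *) (use n in auto)
  qed
  have z: "0 < z" using x \<kappa> by (simp add: z_def)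
  have x_le: "x \<le> \<rho> * \<sigma>\<^sup>2"
  proof -
    have "x * 1 \<le> x * (2 * (real n ^ 3 * real m))" using x nm by (intro mult_left_mono) auto
    then show ?thesis using x_eq by simp
  qed
  have rs: "\<rho> * \<sigma>\<^sup>2 \<le> \<kappa> / 2"
  proof -
    have "\<rho> * \<sigma>\<^sup>2 \<le> \<rho> * \<sigma> * R" using \<sigma> \<rho> by (simp add: power2_eq_square)
    then show ?thesis using small by simp
  qed
  \<comment> \<open>This is what \<open>small\<close> is for: only for z \<le> 1 does lowering the
    exponent of z to t enlarge the bound.\<close>
  have z1: "z \<le> 1"
  proof -
    have "x \<le> 3 * \<kappa>" using x_le rs \<kappa> by linarith
    then show ?thesis using \<kappa> by (simp add: z_def)
  qed
  have w: "0 < w" "w \<le> 1" using z z1 \<eta> by (auto simp: w_def powr_le1)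
  have eps: "\<epsilon> = w * x / R"
  proof -
    have "w = x powr (1 / \<eta>) / (3 * \<kappa>) powr (1 / \<eta>)"
      using x \<kappa> by (simp add: w_def z_def powr_divide)
    moreover have "x powr (1 + 1 / \<eta>) = x * x powr (1 / \<eta>)" using x by (simp add: powr_add)
    moreover have "\<epsilon> = inverse K * x powr (1 + 1 / \<eta>)" unfolding \<epsilon> x_def ..
    ultimately have "\<epsilon> = inverse (R * (3 * \<kappa>) powr (1 / \<eta>)) * (x * x powr (1 / \<eta>))"
      and "w * x / R = x powr (1 / \<eta>) / (3 * \<kappa>) powr (1 / \<eta>) * x / R" by (simp_all only: K)
    then show ?thesis by (simp only: divide_inverse inverse_mult_distrib mult_ac)
  qed
  have e0: "0 < \<epsilon>" using eps w x R by simp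
  have e_le: "\<epsilon> \<le> \<rho> * \<sigma>"
  proof -
    have "w * x \<le> 1 * (\<rho> * \<sigma>\<^sup>2)" using w x x_le by (intro mult_mono) auto
    also have "\<dots> \<le> \<rho> * \<sigma> * R" using \<sigma> \<rho> by (simp add: power2_eq_square)
    finally show ?thesis using R by (simp add: eps divide_le_eq)
  qed
  \<comment> \<open>The quotient is 8 \<rho>\<sigma> / \<epsilon>, and the summand 1 is at most
    \<rho>\<sigma> / \<epsilon>, whence the 9.\<close>
  have net: "1 + 2 / (\<epsilon> / (4 * \<rho> * \<sigma>)) \<le> 3 / 2 * (1 / (z * w))"
  proof -
    have "1 \<le> \<rho> * \<sigma> / \<epsilon>" using e_le e0 by simp
    then have "1 + 2 / (\<epsilon> / (4 * \<rho> * \<sigma>)) \<le> 9 * (\<rho> * \<sigma> / \<epsilon>)" by simp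
    also have "\<dots> = 9 * (\<rho> * \<sigma> * R) / (w * x)" by (simp add: eps)
    also have "\<dots> \<le> 9 * (\<kappa> / 2) / (w * x)"
      using small w x by (intro divide_right_mono mult_left_mono) auto
    also have "\<dots> = 3 / 2 * (1 / (z * w))" using \<kappa> x by (simp add: z_def)
    finally show ?thesis .
  qed
  \<comment> \<open>Substituting \<rho>\<sigma>^2 = 2 n^3 m x cancels \<open>m\<close> and two of
    the three powers of \<open>n\<close>. The remaining 1 / n is kept to pay for the choices of
    rows; 15 / 8 is rounded up to 2.\<close>
  have base: "15 * real m * (real n)\<^sup>2 * (\<epsilon> * R / (4 * \<rho> * \<sigma>)) / \<sigma> \<le> 2 / real n * w"
  proof -
    have "15 * real m * (real n)\<^sup>2 * (\<epsilon> * R / (4 * \<rho> * \<sigma>)) / \<sigma> =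
        15 * real m * (real n)\<^sup>2 * w * x / (4 * (\<rho> * \<sigma>\<^sup>2))"
      using R by (simp add: eps power2_eq_square)
    also have "\<dots> = 15 * real m * (real n)\<^sup>2 * w * x / (4 * (x * (2 * (real n ^ 3 * real m))))"
      by (simp only: x_eq)
    also have "\<dots> = 15 / 8 * (w / real n)"
      using x n by (simp add: power2_eq_square power3_eq_cube)
    also have "\<dots> \<le> 2 * (w / real n)" using w n by (intro mult_right_mono) auto
    finally show ?thesis by simp
  qed
  let ?D = "tau p"
  have mD: "m \<le> ?D"
  proof -
    have "real m + (\<eta> * real m + \<eta> * t) \<le> real ?D" using tau by (simp add: algebra_simps)
    moreover have "0 \<le> \<eta> * real m + \<eta> * t" using \<eta> t by simp
    ultimately show ?thesis by linarith
  qed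
  have powers: "(1 / (z * w)) ^ m * w ^ ?D \<le> z powr t"
  proof -
    have "(1 / (z * w)) ^ m = z powr (- (1 + 1 / \<eta>) * real m)"
    proof -
      have "z powr (1 + 1 / \<eta>) = z * w" using z by (simp add: w_def powr_add)
      then have "1 / (z * w) = z powr (- (1 + 1 / \<eta>))" by (simp only: powr_minus_divide)
      then have "(1 / (z * w)) ^ m = (z powr (- (1 + 1 / \<eta>))) ^ m" by (simp only:)
      also have "\<dots> = (z powr (- (1 + 1 / \<eta>))) powr real m" using z by (intro powr_realpow[symmetric]) simp
      also have "\<dots> = z powr (- (1 + 1 / \<eta>) * real m)" by (rule powr_powr)
      finally show ?thesis .
    qed
    moreover have "w ^ ?D = z powr (real ?D / \<eta>)"
      using z w by (simp add: powr_realpow[symmetric] w_def powr_powr)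
    ultimately have "(1 / (z * w)) ^ m * w ^ ?D = z powr (- (1 + 1 / \<eta>) * real m + real ?D / \<eta>)"
      by (simp add: powr_add)
    also have "\<dots> \<le> z powr t"
    proof (rule powr_mono')
      have "((1 + \<eta>) * real m + \<eta> * t) / \<eta> \<le> real ?D / \<eta>" using tau \<eta> by (intro divide_right_mono) auto
      moreover have "((1 + \<eta>) * real m + \<eta> * t) / \<eta> = (1 + 1 / \<eta>) * real m + t"
        using \<eta> by (simp add: field_simps)
      ultimately show "t \<le> - (1 + 1 / \<eta>) * real m + real ?D / \<eta>" by (simp add: algebra_simps)
    qed (use z z1 in auto)
    finally show ?thesis .
  qed
  have "?lhs \<le>
      (3 / 2 * (1 / (z * w))) ^ m * real n ^ p * (2 / real n * w) ^ ?D"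
    using net base e0 \<rho> \<sigma> R z w
    by (intro mult_mono power_mono mult_nonneg_nonneg zero_le_power) auto
  also have "\<dots> = (3 / 2) ^ m * 2 ^ ?D * (real n ^ p / real n ^ ?D) * ((1 / (z * w)) ^ m * w ^ ?D)"
  proof -
    have "(2 / real n * w) ^ ?D = 2 ^ ?D / real n ^ ?D * w ^ ?D"
      by (simp only: power_mult_distrib power_divide)
    moreover have "(3 / 2 * (1 / (z * w))) ^ m = (3 / 2) ^ m * (1 / (z * w)) ^ m"
      by (rule power_mult_distrib)
    ultimately show ?thesis by (simp only: divide_inverse mult_ac)
  qed
  \<comment> \<open>Since \<open>m \<le> tau p\<close>, the 3 / 2 of the net may be raised to the
    power \<open>tau p\<close>, where it merges with the 2 of the block factor into a 3.\<close>
  also have "\<dots> \<le> (3 / 2) ^ ?D * 2 ^ ?D * (real n ^ p / real n ^ ?D) * z powr t"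
    using powers mD z w by (intro mult_mono power_increasing mult_nonneg_nonneg) auto
  also have "(3 / 2) ^ ?D * 2 ^ ?D = (3::real) ^ ?D" by (simp add: power_mult_distrib[symmetric])
  also have "3 ^ ?D * (real n ^ p / real n ^ ?D) \<le> failure_const"
    using three_power_tau_le[OF p] n by (simp add: divide_le_eq)
  finally have "?lhs \<le> failure_const * z powr t"
    by (simp add: mult_right_mono)
  \<comment> \<open>The constant moves inside the power, because the claimed bound is the t-th power
    of a multiple of \<sigma>^2 / (n^3 m).\<close>
  also have "failure_const * z powr t = (failure_const powr (1 / t) * z) powr t"
    using t z failure_const_ge_1 by (simp add: powr_mult powr_powr)
  also have "\<dots> \<le> ?rhs powr t"
  proof (rule powr_mono2)
    have "z = \<rho> * (\<sigma>\<^sup>2 / (6 * \<kappa> * (real n ^ 3 * real m)))" by (simp add: z_def x_def)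
    also have "\<dots> \<le> 1 * (\<sigma>\<^sup>2 / (6 * \<kappa> * (real n ^ 3 * real m)))"
      using \<rho>1 \<kappa> nm by (intro mult_right_mono divide_nonneg_nonneg mult_nonneg_nonneg) auto
    finally have "failure_const powr (1 / t) * z \<le> failure_const powr (1 / t) * (\<sigma>\<^sup>2 / (6 * \<kappa> * (real n ^ 3 * real m)))"
      by (intro mult_left_mono) auto
    then show "failure_const powr (1 / t) * z \<le> failure_const powr (1 / t) / (6 * \<kappa>) * \<sigma>\<^sup>2 / (real n ^ 3 * real m)"
      by (simp add: mult_ac)
  qed (use t z in auto)
  finally show ?thesis .
qed

section \<open>Approximate optimality of critical points\<close>

lemma frob_norm_outer:
  assumes "v \<in> carrier_vec n" "w \<in> carrier_vec p"
  shows "frob_norm (Matrix.mat n p (\<lambda>(i, j). v $ i * w $ j)) = vnorm v * vnorm w"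
proof -
  have "(frob_norm (Matrix.mat n p (\<lambda>(i, j). v $ i * w $ j)))\<^sup>2 = (vnorm v * vnorm w)\<^sup>2"
    using assms
    by (simp add: frob_norm_square_sum[of _ n p] power_mult_distrib vnorm_square_sum sum_product)
  then show ?thesis by (simp add: power2_eq_iff_nonneg)
qed

lemma smult_mat_mult_vec:
  fixes c :: real
  assumes "B \<in> carrier_mat n q" "v \<in> carrier_vec q"
  shows "(c \<cdot>\<^sub>m B) *\<^sub>v v = c \<cdot>\<^sub>v (B *\<^sub>v v)"
  using assms by (intro eq_vecI) (auto simp: scalar_prod_def sum_distrib_left mult.assoc)

context least_squares
begin

lemma slack_eq: "slack n m A b (Y * Y\<^sup>T) = 2 \<cdot>\<^sub>m adj (res Y)"
  by (simp add: slack_def)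

lemma adj_res_sym: "adj (res Y) \<in> sym_mats n"
  using A_sym by (rule adj_map_sym)

lemma psd_gram:
  assumes Y: "Y \<in> mats"
  shows "psd n (Y * Y\<^sup>T)"
  unfolding psd_def
proof (intro conjI ballI mult_transpose_sym[OF Y])
  fix v :: "real Matrix.vec" assume v: "v \<in> carrier_vec n"
  have YT: "Y\<^sup>T \<in> carrier_mat p n" using Y by simp
  have w: "Y\<^sup>T *\<^sub>v v \<in> carrier_vec p" using YT v by auto
  have "v \<bullet> ((Y * Y\<^sup>T) *\<^sub>v v) = v \<bullet> (Y *\<^sub>v (Y\<^sup>T *\<^sub>v v))"
    using Y YT v by simp
  also have "\<dots> = (Y\<^sup>T *\<^sub>v v) \<bullet> (Y\<^sup>T *\<^sub>v v)"
    by (rule transpose_vec_mult_scalar[OF Y w v, symmetric])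
  finally show "0 \<le> v \<bullet> ((Y * Y\<^sup>T) *\<^sub>v v)"
    using vnorm_square[of "Y\<^sup>T *\<^sub>v v"] by (metis zero_le_power2)
qed

lemma psd_shifted_slack:
  assumes "\<And>v. v \<in> carrier_vec n \<Longrightarrow> - c * (vnorm v)\<^sup>2 \<le> 2 * (v \<bullet> (adj (res Y) *\<^sub>v v))"
  shows "psd n (slack n m A b (Y * Y\<^sup>T) + c \<cdot>\<^sub>m 1\<^sub>m n)"
  unfolding psd_def slack_eq
proof (intro conjI ballI)
  have "1\<^sub>m n \<in> sym_mats n" by (intro sym_matsI) auto
  then show "2 \<cdot>\<^sub>m adj (res Y) + c \<cdot>\<^sub>m 1\<^sub>m n \<in> sym_mats n"
    by (intro sym_mats_add sym_mats_smult adj_res_sym)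
  fix v :: "real Matrix.vec" assume v: "v \<in> carrier_vec n"
  have Av: "adj (res Y) *\<^sub>v v \<in> carrier_vec n" using v by (intro mult_mat_vec_carrier) auto
  have "(2 \<cdot>\<^sub>m adj (res Y) + c \<cdot>\<^sub>m 1\<^sub>m n) *\<^sub>v v = (2 \<cdot>\<^sub>m adj (res Y)) *\<^sub>v v + (c \<cdot>\<^sub>m 1\<^sub>m n) *\<^sub>v v"
    using v by (intro add_mult_distrib_mat_vec[of _ n n]) auto
  also have "(2 \<cdot>\<^sub>m adj (res Y)) *\<^sub>v v = 2 \<cdot>\<^sub>v (adj (res Y) *\<^sub>v v)"
    using v by (intro smult_mat_mult_vec[of _ n n]) auto
  also have "(c \<cdot>\<^sub>m 1\<^sub>m n) *\<^sub>v v = c \<cdot>\<^sub>v (1\<^sub>m n *\<^sub>v v)"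
    using v by (intro smult_mat_mult_vec[of _ n n]) auto
  also have "1\<^sub>m n *\<^sub>v v = v" using v by simp
  finally have "v \<bullet> ((2 \<cdot>\<^sub>m adj (res Y) + c \<cdot>\<^sub>m 1\<^sub>m n) *\<^sub>v v) = 2 * (v \<bullet> (adj (res Y) *\<^sub>v v)) + c * (v \<bullet> v)"
    using v Av by (simp add: scalar_prod_add_distrib[of _ n])
  then show "0 \<le> v \<bullet> ((2 \<cdot>\<^sub>m adj (res Y) + c \<cdot>\<^sub>m 1\<^sub>m n) *\<^sub>v v)"
    using assms[OF v] by (simp add: vnorm_square)
qed

text \<open>Testing the Hessian with \<open>v u\<^sup>T\<close>, where \<open>Y u\<close> is short, makes its quartic term negligible.\<close>

lemma slack_lower_bound:
  assumes Y: "Y \<in> mats" and u: "u \<in> carrier_vec p" "vnorm u = 1"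
    and short: "R\<^sup>2 * (vnorm (Y *\<^sub>v u))\<^sup>2 \<le> \<epsilon>"
    and hess: "\<And>Z. Z \<in> mats \<Longrightarrow> - \<epsilon> * (frob_norm Z)\<^sup>2 \<le> frob_inner Z (hess Y Z)"
    and v: "v \<in> carrier_vec n"
  shows "- (5 * \<epsilon>) * (vnorm v)\<^sup>2 \<le> 2 * (v \<bullet> (adj (res Y) *\<^sub>v v))"
proof -
  define Z where "Z = Matrix.mat n p (\<lambda>(i, j). v $ i * u $ j)"
  have Z: "Z \<in> mats" by (simp add: Z_def)
  have Zn: "frob_norm Z = vnorm v" using frob_norm_outer[OF v u(1)] u(2) by (simp add: Z_def)
  have Yu: "Y *\<^sub>v u \<in> carrier_vec n" using Y u by auto
  have e0: "0 \<le> \<epsilon>" using order_trans[OF _ short, of 0] by simp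
  have YZ: "Y * Z\<^sup>T = Matrix.mat n n (\<lambda>(i, j). (Y *\<^sub>v u) $ i * v $ j)"
    using Y u v by (intro eq_matI) (auto simp: Z_def scalar_prod_def sum_distrib_left sum_distrib_right mult_ac intro!: sum.cong)
  then have YZn: "frob_norm (Y * Z\<^sup>T) = vnorm (Y *\<^sub>v u) * vnorm v"
    using frob_norm_outer[OF Yu v] by simp
  have ZY: "Z * Y\<^sup>T = (Y * Z\<^sup>T)\<^sup>T"
    using Y Z by (subst transpose_mult[of _ n p _ n]) auto
  have bil: "vnorm (bil Y Z) \<le> R * (2 * (vnorm (Y *\<^sub>v u) * vnorm v))"
  proof -
    have "vnorm (bil Y Z) \<le> R * frob_norm (Y * Z\<^sup>T + Z * Y\<^sup>T)"
      by (intro lin_bound sym_product_carrier Y Z)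
    also have "\<dots> \<le> R * (frob_norm (Y * Z\<^sup>T) + frob_norm (Z * Y\<^sup>T))"
      using Y Z R_nonneg by (intro mult_left_mono frob_norm_add_le[of _ n n]) auto
    finally show ?thesis by (simp add: ZY YZn mult_ac)
  qed
  have "(vnorm (bil Y Z))\<^sup>2 \<le> (R * (2 * (vnorm (Y *\<^sub>v u) * vnorm v)))\<^sup>2"
    using bil by (intro power_mono) auto
  also have "\<dots> = 4 * (R\<^sup>2 * (vnorm (Y *\<^sub>v u))\<^sup>2) * (vnorm v)\<^sup>2" by (simp add: power_mult_distrib)
  also have "\<dots> \<le> 4 * \<epsilon> * (vnorm v)\<^sup>2" using short by (intro mult_right_mono) auto
  finally have bil2: "(vnorm (bil Y Z))\<^sup>2 \<le> 4 * \<epsilon> * (vnorm v)\<^sup>2" .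
  have "frob_inner Z (adj (res Y) * Z) = v \<bullet> (adj (res Y) *\<^sub>v v)"
  proof -
    have "adj (res Y) * Z = Matrix.mat n p (\<lambda>(i, j). (adj (res Y) *\<^sub>v v) $ i * u $ j)"
      using v u by (intro eq_matI) (auto simp: Z_def scalar_prod_def sum_distrib_left sum_distrib_right mult_ac intro!: sum.cong)
    then have "frob_inner Z (adj (res Y) * Z) = (\<Sum>i<n. \<Sum>j<p. (v $ i * u $ j) * ((adj (res Y) *\<^sub>v v) $ i * u $ j))"
      by (simp add: frob_inner_eq[of _ n p] Z_def del: index_mult_mat_vec)
    also have "\<dots> = (\<Sum>i<n. v $ i * (adj (res Y) *\<^sub>v v) $ i) * (\<Sum>j<p. (u $ j)\<^sup>2)"
      unfolding sum_product by (intro sum.cong refl) (simp add: power2_eq_square mult_ac del: index_mult_mat_vec)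
    also have "(\<Sum>j<p. (u $ j)\<^sup>2) = 1" using vnorm_square_sum[OF u(1)] u(2) by simp
    also have "(\<Sum>i<n. v $ i * (adj (res Y) *\<^sub>v v) $ i) = v \<bullet> (adj (res Y) *\<^sub>v v)"
      using v by (simp add: scalar_prod_def atLeast0LessThan)
    finally show ?thesis by simp
  qed
  then have "- \<epsilon> * (vnorm v)\<^sup>2 \<le> 4 * (v \<bullet> (adj (res Y) *\<^sub>v v)) + 2 * (vnorm (bil Y Z))\<^sup>2"
    using hess[OF Z] by (simp add: frob_inner_hess[OF Y Z] Zn)
  \<comment> \<open>Origin of the 5: the Hessian bound gives -\<epsilon> and twice the square of
    \<open>bil\<close> another -8 \<epsilon>. Since four times the form is twice that of the slack,
    the slack is bounded by -9/2 \<epsilon>, rounded to -5 \<epsilon>.\<close>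
  then have "- 9 * (\<epsilon> * (vnorm v)\<^sup>2) \<le> 2 * (2 * (v \<bullet> (adj (res Y) *\<^sub>v v)))" using bil2 by simp
  moreover have "0 \<le> \<epsilon> * (vnorm v)\<^sup>2" using e0 by simp
  ultimately show ?thesis by simp
qed

lemma frob_norm_adj_res_mult_le:
  assumes "Y \<in> mats" "frob_norm (grad Y) \<le> g"
  shows "frob_norm (adj (res Y) * Y) \<le> g / 4"
  using assms by (simp add: grad_def frob_norm_smult)

text \<open>The first-order condition needs only the gradient: the slack times Y Y^T is the slack
  times \<open>Y\<close>, which is half the gradient, multiplied by Y^T.\<close>

lemma approx_optimal_of_short:
  assumes Y: "Y \<in> mats" "frob_norm Y \<le> \<rho>" and g: "frob_norm (grad Y) \<le> g" "0 \<le> g"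
    and u: "u \<in> carrier_vec p" "vnorm u = 1" and short: "R\<^sup>2 * (vnorm (Y *\<^sub>v u))\<^sup>2 \<le> \<epsilon>"
    and hess: "\<And>Z. Z \<in> mats \<Longrightarrow> - \<epsilon> * (frob_norm Z)\<^sup>2 \<le> frob_inner Z (hess Y Z)"
  shows "approx_optimal n m A b e0 (g * \<rho>) (5 * \<epsilon>) (Y * Y\<^sup>T)"
proof -
  have "frob_norm (slack n m A b (Y * Y\<^sup>T) * (Y * Y\<^sup>T)) = 2 * frob_norm ((adj (res Y) * Y) * Y\<^sup>T)"
  proof -
    have "(2 \<cdot>\<^sub>m adj (res Y)) * (Y * Y\<^sup>T) = 2 \<cdot>\<^sub>m (adj (res Y) * (Y * Y\<^sup>T))"
      using Y by (intro mult_smult_assoc_mat[of _ n n _ n]) auto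
    also have "adj (res Y) * (Y * Y\<^sup>T) = (adj (res Y) * Y) * Y\<^sup>T"
      using Y by (intro assoc_mult_mat[symmetric, of _ n n _ p _ n]) auto
    finally show ?thesis by (simp add: slack_eq frob_norm_smult)
  qed
  also have "\<dots> \<le> 2 * (frob_norm (adj (res Y) * Y) * frob_norm Y)"
    using frob_norm_mult_le[OF adj_mult_carrier[OF Y(1)], of "Y\<^sup>T" n "res Y"] Y by simp
  also have "\<dots> \<le> 2 * (g / 4 * \<rho>)"
    using frob_norm_adj_res_mult_le[OF Y(1) g(1)] Y g by (intro mult_left_mono mult_mono) auto
  also have "\<dots> \<le> g * \<rho>"
    using g(2) order_trans[OF frob_norm_nonneg Y(2)] by simp
  finally have "frob_norm (slack n m A b (Y * Y\<^sup>T) * (Y * Y\<^sup>T)) \<le> g * \<rho>" .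
  moreover have "psd n (slack n m A b (Y * Y\<^sup>T) + (5 * \<epsilon>) \<cdot>\<^sub>m 1\<^sub>m n)"
    by (intro psd_shifted_slack slack_lower_bound[OF Y(1) u short hess]) auto
  ultimately show ?thesis
    unfolding approx_optimal_def using psd_gram[OF Y(1)] by simp
qed

text \<open>For \<open>R = R_A\<close> and \<rho> = \<open>R_Y\<close> the bound is \<kappa> / (2
  R_A), which explains the definition of \<kappa>. It settles the case in which \<rho>\<sigma>
  exceeds every possible residual.\<close>

lemma vnorm_res_le:
  assumes "Y \<in> mats" "frob_norm Y \<le> \<rho>"
  shows "vnorm (res Y) \<le> R * \<rho>\<^sup>2 + vnorm b"
proof -
  have "vnorm (res Y) \<le> vnorm (quad Y) + vnorm b"
    using b_carrier by (intro vnorm_diff_le) auto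
  also have "vnorm (quad Y) \<le> R * (frob_norm Y)\<^sup>2" using assms(1) by (rule vnorm_quad_le)
  also have "\<dots> \<le> R * \<rho>\<^sup>2" using assms(2) R_nonneg by (intro mult_left_mono power_mono) auto
  finally show ?thesis by simp
qed

end

text \<open>Either alternative of approximate optimality can only fail if the residual exceeds
  \<open>d\<close> and no unit vector is short under \<open>Y\<close>. Then normalizing the residual
  gives a direction that nearly annihilates the well conditioned \<open>Y\<close>.\<close>

lemma approx_optimal_or_near_singular:
  assumes ls: "least_squares n m (sym_tuple n a) b R" and R: "0 < R"
    and a: "a \<in> space (coord_measure n m)" and np: "1 \<le> n" "1 \<le> p"
    and Y: "Y \<in> carrier_mat n p" "frob_norm Y \<le> \<rho>Y" and \<epsilon>: "0 < \<epsilon>" and d: "0 < d"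
    and grad: "frob_norm (least_squares.grad n m (sym_tuple n a) b Y) \<le> \<epsilon> powr (3 / 2)"
    and hess: "\<And>Z. Z \<in> carrier_mat n p \<Longrightarrow>
      - \<epsilon> * (frob_norm Z)\<^sup>2 \<le> frob_inner Z (least_squares.hess n m (sym_tuple n a) b Y Z)"
    and T: "\<And>u. u \<in> unit_sphere m \<Longrightarrow> \<exists>v\<in>T. L2_set (\<lambda>i. u i - v i) {..<m} \<le> \<epsilon> / (4 * d)"
  shows "approx_optimal n m (sym_tuple n a) b d (\<epsilon> powr (3 / 2) * \<rho>Y) (5 * \<epsilon>) (Y * Y\<^sup>T) \<or>
    (\<exists>u\<in>T. \<exists>f\<in>{..<p} \<rightarrow>\<^sub>E {..<n}. inj_on f {..<p} \<and>
      a \<in> near_singular n m p u f (3 * sqrt (real (p * n)) * (\<epsilon> * R / (4 * d))))"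
proof -
  interpret least_squares n p m "sym_tuple n a" b R using ls .
  show ?thesis
  proof (cases "vnorm (res Y) \<le> d \<or> (\<exists>u\<in>carrier_vec p. vnorm u = 1 \<and> R\<^sup>2 * (vnorm (Y *\<^sub>v u))\<^sup>2 \<le> \<epsilon>)")
    case True
    then show ?thesis
    proof
      assume "vnorm (res Y) \<le> d"
      then show ?thesis using psd_gram[OF Y(1)] by (simp add: approx_optimal_def)
    next
      assume "\<exists>u\<in>carrier_vec p. vnorm u = 1 \<and> R\<^sup>2 * (vnorm (Y *\<^sub>v u))\<^sup>2 \<le> \<epsilon>"
      then show ?thesis using approx_optimal_of_short[OF Y grad _ _ _ _ hess] by auto
    qed
  next
    case False
    \<comment> \<open>\<open>s\<close> is the threshold of the failed shortness condition. The
      choice of \<delta> makes s \<delta> = \<epsilon>^(3/2) / (4 d), which is a quarter of the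
      gradient tolerance divided by the least residual.\<close>
    define s where "s = sqrt \<epsilon> / R"
    define \<delta> where "\<delta> = \<epsilon> * R / (4 * d)"
    have s: "0 < s" using \<epsilon> R by (simp add: s_def)
    have lower: "s * vnorm v \<le> vnorm (Y *\<^sub>v v)" if v: "v \<in> carrier_vec p" for v
    proof (cases "vnorm v = 0")
      case False
      then have pos: "0 < vnorm v" by (simp add: order_less_le)
      let ?u = "(1 / vnorm v) \<cdot>\<^sub>v v"
      have "vnorm ?u = 1" using pos by (simp add: vnorm_smult)
      then have "\<epsilon> < R\<^sup>2 * (vnorm (Y *\<^sub>v ?u))\<^sup>2"
        using \<open>\<not> (_ \<or> _)\<close> v by (auto simp: not_le)
      then have "sqrt \<epsilon> \<le> R * vnorm (Y *\<^sub>v ?u)"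
        using R by (intro real_le_lsqrt) (auto simp: power_mult_distrib)
      also have "Y *\<^sub>v ?u = (1 / vnorm v) \<cdot>\<^sub>v (Y *\<^sub>v v)"
        using Y(1) v by (rule mult_mat_vec)
      finally show ?thesis using pos R by (simp add: s_def vnorm_smult field_simps)
    qed simp
    have big: "d < vnorm (res Y)" using False by simp
    define l where "l = (1 / vnorm (res Y)) \<cdot>\<^sub>v res Y"
    have l: "l \<in> carrier_vec m" "vnorm l = 1" using big d by (simp_all add: l_def vnorm_smult)
    have \<delta>0: "0 < \<delta>" using \<epsilon> R d by (simp add: \<delta>_def)
    have "adj l * Y = (1 / vnorm (res Y)) \<cdot>\<^sub>m (adj (res Y) * Y)"
      unfolding l_def using Y(1)
      by (subst adj_map_smult[of _ m]) (auto intro!: mult_smult_assoc_mat[of _ n n _ p])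
    then have "frob_norm (adj l * Y) = frob_norm (adj (res Y) * Y) / vnorm (res Y)"
      using big d by (simp add: frob_norm_smult)
    also have "\<dots> \<le> (\<epsilon> powr (3 / 2) / 4) / d"
      using frob_norm_adj_res_mult_le[OF Y(1) grad] big d by (intro frac_le) auto
    also have "\<dots> = s * \<delta>"
    proof -
      have "\<epsilon> powr (3 / 2) = \<epsilon> powr (1 + 1 / 2)" by simp
      also have "\<dots> = \<epsilon> * sqrt \<epsilon>" using \<epsilon> by (simp only: powr_add powr_half_sqrt[OF less_imp_le] powr_one)
      finally show ?thesis using R by (simp add: s_def \<delta>_def)
    qed
    finally have small: "frob_norm (adj l * Y) \<le> s * \<delta>" .
    have "\<delta> / R = \<epsilon> / (4 * d)" using R by (simp add: \<delta>_def)
    then show ?thesis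
      using near_singular_cover[OF a np R frob_norm_adj_le l Y(1) s lower \<delta>0 small, of T] T
      by (simp add: \<delta>_def)
  qed
qed

section \<open>Runs of the ARC iteration\<close>

lemma sets_uniform_ball [simp]: "sets (uniform_ball n m Abar \<sigma>) = sets (coord_measure n m)"
  by (simp add: uniform_ball_def)

lemma uniform_ball_properties:
  assumes "\<And>k. k < m \<Longrightarrow> Abar k \<in> sym_mats n" and \<sigma>: "0 < \<sigma>"
  shows "ball_coords n m Abar \<sigma> \<in> sets (uniform_ball n m Abar \<sigma>)"
    and "prob_space (uniform_ball n m Abar \<sigma>)"
    and "measure (uniform_ball n m Abar \<sigma>) (ball_coords n m Abar \<sigma>) = 1"
proof -
  let ?E = "ellipsoid (sym_index n m) sym_weight (\<lambda>x. Abar (fst x) $$ (snd x)) \<sigma>"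
  have E: "ball_coords n m Abar \<sigma> = ?E"
    using assms by (intro ball_coords_eq_ellipsoid) auto
  have U: "uniform_ball n m Abar \<sigma> = uniform_measure (coord_measure n m) ?E"
    unfolding uniform_ball_def ball_coords_def[symmetric] E ..
  have sets: "?E \<in> sets (coord_measure n m)"
    unfolding coord_measure_def by (intro sets_ellipsoid finite_sym_index)
  then show "ball_coords n m Abar \<sigma> \<in> sets (uniform_ball n m Abar \<sigma>)" by (simp add: E)
  let ?V = "emeasure (coord_measure n m) (ellipsoid (sym_index n m) sym_weight (\<lambda>_. 0) 1)"
  have eq: "emeasure (coord_measure n m) ?E = ennreal (\<sigma> ^ card (sym_index n m)) * ?V"
    unfolding coord_measure_def using \<sigma> by (intro emeasure_ellipsoid finite_sym_index) simp
  have V: "?V < \<infinity>" "0 < ?V"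
    unfolding coord_measure_def
    by (intro emeasure_unit_ellipsoid finite_sym_index; simp add: sym_weight_def)+
  have fin: "emeasure (coord_measure n m) ?E \<noteq> \<infinity>" "emeasure (coord_measure n m) ?E \<noteq> 0"
    using V \<sigma> by (auto simp: eq ennreal_mult_eq_top_iff)
  show P: "prob_space (uniform_ball n m Abar \<sigma>)"
    unfolding U using fin by (intro prob_space_uniform_measure) auto
  have "emeasure (uniform_measure (coord_measure n m) ?E) ?E = 1"
    using fin sets by (simp add: emeasure_uniform_measure ennreal_divide_self top.not_eq_extremum)
  then show "measure (uniform_ball n m Abar \<sigma>) (ball_coords n m Abar \<sigma>) = 1"
    by (simp add: U E measure_def)
qed

text \<open>The event is the ball without the near-singular sets, not the set of good tuples, so no
  measurability of \<open>good\<close>, and hence of the output of the method, is asked for. If p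
  exceeds n, there is no injective choice of rows and nothing is removed.\<close>

lemma good_event:
  assumes Abar: "\<And>k. k < m \<Longrightarrow> Abar k \<in> sym_mats n" and \<sigma>: "0 < \<sigma>" and nmp: "1 \<le> n" "1 \<le> m" "1 \<le> p"
    and \<delta>: "0 < \<delta>" and T: "finite T" "T \<subseteq> unit_sphere m"
    and dichotomy: "\<And>a. a \<in> ball_coords n m Abar \<sigma> \<Longrightarrow> good a \<or>
      (\<exists>u\<in>T. \<exists>f\<in>{..<p} \<rightarrow>\<^sub>E {..<n}. inj_on f {..<p} \<and> a \<in> near_singular n m p u f (3 * sqrt (real (p * n)) * \<delta>))"
  shows "\<exists>E\<in>sets (uniform_ball n m Abar \<sigma>). (\<forall>a\<in>E. good a) \<and>
    1 - (if p \<le> n then real (card T) * real n ^ p * (15 * real m * (real n)\<^sup>2 * \<delta> / \<sigma>) ^ tau p else 0)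
      \<le> measure (uniform_ball n m Abar \<sigma>) E"
proof -
  let ?U = "uniform_ball n m Abar \<sigma>" and ?S = "ball_coords n m Abar \<sigma>"
  let ?q = "(15 * real m * (real n)\<^sup>2 * \<delta> / \<sigma>) ^ tau p"
  let ?N = "\<lambda>(u, f). near_singular n m p u f (3 * sqrt (real (p * n)) * \<delta>)"
  interpret prob_space ?U using Abar \<sigma> by (rule uniform_ball_properties(2))
  define Fs where "Fs = {f \<in> {..<p} \<rightarrow>\<^sub>E {..<n}. inj_on f {..<p}}"
  have finP: "finite ({..<p} \<rightarrow>\<^sub>E {..<n})" by (intro finite_PiE) auto
  have finF: "finite Fs" unfolding Fs_def using finP by simp
  have "card Fs \<le> card ({..<p} \<rightarrow>\<^sub>E {..<n})"
    unfolding Fs_def by (intro card_mono finP) auto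
  then have cF: "card Fs \<le> n ^ p" by (simp add: card_PiE)
  have F0: "p \<le> n" if "f \<in> Fs" for f
  proof -
    have "card {..<p} \<le> card {..<n}"
      using that by (intro card_inj_on_le[of f]) (auto simp: Fs_def)
    then show ?thesis by simp
  qed
  define Bad where "Bad = (\<Union>x\<in>T \<times> Fs. ?N x)"
  have Ns: "?N x \<in> sets ?U" for x by (auto simp: case_prod_unfold)
  have Bs: "Bad \<in> sets ?U" unfolding Bad_def using T finF Ns by (intro sets.finite_UN) auto
  have Ss: "?S \<in> sets ?U" using Abar \<sigma> by (rule uniform_ball_properties(1))
  have q0: "0 \<le> ?q" using \<delta> \<sigma> by simp
  have bad: "prob Bad \<le> (if p \<le> n then real (card T) * real n ^ p * ?q else 0)"
  proof -
    have "prob Bad \<le> (\<Sum>x\<in>T \<times> Fs. prob (?N x))"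
      unfolding Bad_def using T finF Ns by (intro measure_UNION_le) auto
    also have "\<dots> \<le> (\<Sum>x\<in>T \<times> Fs. ?q)"
    proof (intro sum_mono)
      fix x assume x: "x \<in> T \<times> Fs"
      then obtain u f where uf: "x = (u, f)" "u \<in> unit_sphere m" "f \<in> {..<p} \<rightarrow>\<^sub>E {..<n}" "inj_on f {..<p}"
        using T by (auto simp: Fs_def)
      show "prob (?N x) \<le> ?q"
        using prob_near_singular_le[OF Abar \<sigma> \<delta> nmp uf(3,4,2)] by (simp add: uf(1))
    qed
    also have "\<dots> = real (card T) * real (card Fs) * ?q" by (simp add: card_cartesian_product)
    also have "\<dots> \<le> (if p \<le> n then real (card T) * real n ^ p * ?q else 0)"
    proof (cases "p \<le> n")
      case True
      have "real (card Fs) \<le> real n ^ p" using cF by (simp only: of_nat_power[symmetric] of_nat_le_iff)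
      then show ?thesis using True q0 by (auto intro!: mult_right_mono mult_left_mono)
    next
      case False
      then have "Fs = {}" using F0 by auto
      then show ?thesis using False by simp
    qed
    finally show ?thesis .
  qed
  have "1 \<le> prob (?S - Bad) + prob Bad"
  proof -
    have "prob ?S \<le> prob ((?S - Bad) \<union> Bad)" using Ss Bs by (intro finite_measure_mono) auto
    also have "\<dots> \<le> prob (?S - Bad) + prob Bad" using Ss Bs by (intro measure_Un_le) auto
    finally show ?thesis using uniform_ball_properties(3)[of m Abar n \<sigma>] Abar \<sigma> by simp
  qed
  moreover have "good a" if "a \<in> ?S - Bad" for a
    using dichotomy[of a] that by (fastforce simp: Bad_def Fs_def)
  ultimately show ?thesis
    using Ss Bs bad by (intro bexI[of _ "?S - Bad"]) auto
qed

text \<open>The guarantee with \<open>C\<close> and \<open>q\<close> made explicit, so that one pair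
  can be carried through all instances. The descent of the iterates is condensed into the returned
  point staying in the sublevel set, where its norm is bounded.\<close>

definition returns_critical_point :: "opt_method \<Rightarrow> (real \<Rightarrow> real \<Rightarrow> real) \<Rightarrow> nat \<Rightarrow> bool" where
  "returns_critical_point M C q \<longleftrightarrow>
    (\<forall>n p g G H a L e1 e2 Y0 r. r = M n p g e1 e2 Y0 \<longrightarrow> Y0 \<in> carrier_mat n p \<longrightarrow> 1 \<le> n \<longrightarrow> 1 \<le> p \<longrightarrow>
      0 < e1 \<longrightarrow> 0 < e2 \<longrightarrow> C2_fun n p g G H \<longrightarrow> g Y0 \<le> a \<longrightarrow> bounded_lipschitz n p g G H a L \<longrightarrow>
      iterations r \<noteq> \<infinity> \<and> returned_point r \<in> carrier_mat n p \<and> g (returned_point r) \<le> a \<and>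
      real (evaluations r) \<le> C a L * max (e1 powr (- 2)) (e2 powr (- 3)) * real q \<and>
      frob_norm (G (returned_point r)) \<le> e1 \<and>
      (\<forall>Z\<in>carrier_mat n p. frob_inner Z (H (returned_point r) Z) \<ge> - e2 * (frob_norm Z)\<^sup>2))"

lemma arc_method_returns:
  assumes "arc_method M"
  obtains C q where "returns_critical_point M C q"
  using assms[unfolded arc_method_def, THEN conjunct2]
proof (elim exE, goal_cases)
  case guarantee: (1 C q)
  show ?thesis
  proof (rule that[of C q], unfold returns_critical_point_def, intro allI impI)
    fix n p g G H a L e1 e2 Y0 r
    assume r: "r = M n p g e1 e2 Y0" and hyps: "Y0 \<in> carrier_mat n p" "1 \<le> n" "1 \<le> p" "0 < e1" "0 < e2"
      "C2_fun n p g G H" "g Y0 \<le> a" "bounded_lipschitz n p g G H a L"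
    define N where "N = the_enat (iterations r)"
    have *: "iterations r \<noteq> \<infinity>" "iterate r 0 = Y0" "\<And>k. k \<le> N \<Longrightarrow> iterate r k \<in> carrier_mat n p"
      "\<And>k. k < N \<Longrightarrow> g (iterate r (k + 1)) \<le> g (iterate r k)"
      "real N \<le> C a L * max (e1 powr (- 2)) (e2 powr (- 3))"
      "\<And>k. k < N \<Longrightarrow> length (queries r k) \<le> q"
      "frob_norm (G (returned_point r)) \<le> e1"
      "\<forall>Z\<in>carrier_mat n p. frob_inner Z (H (returned_point r) Z) \<ge> - e2 * (frob_norm Z)\<^sup>2"
      using guarantee(2)[rule_format, OF hyps] by (simp_all add: Let_def r N_def)
    have ret: "returned_point r = iterate r N" by (simp add: returned_point_def N_def)
    have "k \<le> N \<Longrightarrow> g (iterate r k) \<le> a" for k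
    proof (induction k)
      case 0
      then show ?case using * hyps by simp
    next
      case (Suc k)
      then have "g (iterate r (k + 1)) \<le> g (iterate r k)" by (intro *) simp
      then show ?case using Suc by simp
    qed
    then have dec: "g (returned_point r) \<le> a" by (simp add: ret)
    have "evaluations r \<le> (\<Sum>k<N. q)"
      unfolding evaluations_def N_def[symmetric] using *(6) by (intro sum_mono) auto
    then have "real (evaluations r) \<le> real (N * q)" by (simp only: sum_constant card_lessThan of_nat_id of_nat_le_iff)
    also have "\<dots> = real N * real q" by simp
    also have "\<dots> \<le> C a L * max (e1 powr (- 2)) (e2 powr (- 3)) * real q"
      using *(5) by (intro mult_right_mono) auto
    finally show "iterations r \<noteq> \<infinity> \<and> returned_point r \<in> carrier_mat n p \<and> g (returned_point r) \<le> a \<and>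
      real (evaluations r) \<le> C a L * max (e1 powr (- 2)) (e2 powr (- 3)) * real q \<and>
      frob_norm (G (returned_point r)) \<le> e1 \<and>
      (\<forall>Z\<in>carrier_mat n p. frob_inner Z (H (returned_point r) Z) \<ge> - e2 * (frob_norm Z)\<^sup>2)"
      using * dec ret by auto
  qed
qed

text \<open>If \<open>b = 0\<close>, all short matrices lie in the level set, so the bound on their norms is positive.\<close>

lemma (in least_squares) level_set_radius_pos:
  assumes np: "1 \<le> n" "1 \<le> p" and \<alpha>: "0 < \<alpha>"
    and \<rho>: "\<And>Y. Y \<in> level_set n p m A b \<alpha> \<Longrightarrow> frob_norm Y \<le> \<rho>"
  shows "0 < \<rho> \<or> 0 < vnorm b"
proof (rule disjCI)
  assume "\<not> 0 < vnorm b"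
  then have "vnorm b = 0" using vnorm_nonneg[of b] by (simp add: order_antisym)
  define W :: "real mat" where "W = Matrix.mat n p (\<lambda>_. 1)"
  have W: "W \<in> mats" by (simp add: W_def)
  have W0: "0 < frob_norm W"
    using entry_le_frob_norm[OF W, of 0 0] np by (simp add: W_def)
  define M where "M = R * (frob_norm W)\<^sup>2 + 1"
  have M: "0 < M" using R_nonneg by (simp add: M_def add_nonneg_pos)
  \<comment> \<open>Since \<open>c \<le> 1\<close>, the quadratic map gains a factor c^2 \<le> c,
    and c M \<le> \<alpha>. The 1 in \<open>M\<close> keeps the quotient defined when
    \<open>R\<close> is 0.\<close>
  define c where "c = min 1 (\<alpha> / M)"
  have c: "0 < c" "c \<le> 1" "c \<le> \<alpha> / M" using \<alpha> M by (simp_all add: c_def)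
  have cW: "c \<cdot>\<^sub>m W \<in> mats" using W by simp
  have cWn: "frob_norm (c \<cdot>\<^sub>m W) = c * frob_norm W" using c by (simp add: frob_norm_smult)
  have "vnorm (res (c \<cdot>\<^sub>m W)) \<le> vnorm (quad (c \<cdot>\<^sub>m W)) + vnorm b"
    using b_carrier by (intro vnorm_diff_le) auto
  also have "\<dots> \<le> R * (frob_norm (c \<cdot>\<^sub>m W))\<^sup>2"
    using vnorm_quad_le[OF cW] \<open>vnorm b = 0\<close> by simp
  also have "\<dots> = (c * c) * (R * (frob_norm W)\<^sup>2)" by (simp add: cWn power2_eq_square)
  also have "\<dots> \<le> (c * 1) * M" using c R_nonneg by (intro mult_mono mult_left_mono) (auto simp: M_def)
  also have "\<dots> \<le> \<alpha>" using c M by (simp add: field_simps)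
  finally have "c \<cdot>\<^sub>m W \<in> level_set n p m A b \<alpha>" using cW by (simp add: level_set_def residual_def)
  from \<rho>[OF this] show "0 < \<rho>" using c W0 by (simp add: cWn) (meson mult_pos_pos order_less_le_trans)
qed

lemma least_squares_ball:
  assumes "\<And>k. k < m \<Longrightarrow> Abar k \<in> sym_mats n" "0 \<le> \<sigma>" "A \<in> tuple_ball n m Abar \<sigma>" "b \<in> carrier_vec m" "1 \<le> n"
  shows "least_squares n m A b (op_norm n m Abar + \<sigma>)"
proof
  show "\<And>k. k < m \<Longrightarrow> A k \<in> sym_mats n" using assms(3) by (simp add: tuple_ball_def)
  show "0 \<le> op_norm n m Abar + \<sigma>" using op_norm_nonneg[of m Abar n] assms by simp
  show "\<And>X. X \<in> sym_mats n \<Longrightarrow> vnorm (lin_map m A X) \<le> (op_norm n m Abar + \<sigma>) * frob_norm X"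
    using assms(1,3) by (intro vnorm_lin_map_ball_le) auto
qed fact

text \<open>One instance with all constants explicit: positivity of \<kappa>, by which the failure
  bound divides, then the statement for every tuple in the ball, and then the statement for most of
  them.\<close>

lemma arc_run_guarantees:
  fixes n m p :: nat
  assumes arc: "returns_critical_point ARC C q"
    and \<eta>: "0 < \<eta>" and t: "0 < t" and nmp: "1 \<le> n" "1 \<le> m" "1 \<le> p"
    and tau: "(1 + \<eta>) * real m + \<eta> * t \<le> real (tau p)"
    and b: "b \<in> carrier_vec m" and "\<forall>k<m. Abar k \<in> sym_mats n"
    and \<sigma>: "0 < \<sigma>" and \<alpha>: "0 < \<alpha>" and Yc: "Y0 \<in> carrier_mat n p"
    and level: "\<forall>A\<in>tuple_ball n m Abar \<sigma>. compactin (mat_topology n p) (level_set n p m A b \<alpha>) \<and>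
      Y0 \<in> level_set n p m A b \<alpha>"
    and RY0: "0 \<le> R_Y"
    and RY: "\<forall>A\<in>tuple_ball n m Abar \<sigma>. \<forall>Y\<in>level_set n p m A b \<alpha>. frob_norm Y \<le> R_Y"
    and RA: "R_A = op_norm n m Abar + \<sigma>" and \<kappa>: "\<kappa> = 2 * (R_A * R_Y\<^sup>2 + vnorm b) * R_A"
    and K: "K = R_A * (3 * \<kappa>) powr (1 / \<eta>)" and \<rho>: "0 < \<rho>" "\<rho> \<le> 1"
    and \<epsilon>: "\<epsilon> = inverse K * (\<rho> * \<sigma>\<^sup>2 / (2 * real n ^ 3 * real m)) powr (1 + 1 / \<eta>)"
    and run: "run = (\<lambda>A. ARC n p (objective m A b) (\<epsilon> powr (3 / 2)) \<epsilon> Y0)"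
  shows "0 < \<kappa>"
    and "\<And>A. A \<in> tuple_ball n m Abar \<sigma> \<Longrightarrow> iterations (run A) \<noteq> \<infinity> \<and>
           returned_point (run A) \<in> carrier_mat n p \<and> (\<exists>L. objective_bound n p m A b \<alpha> L) \<and>
           (\<forall>L. objective_bound n p m A b \<alpha> L \<longrightarrow>
              real (evaluations (run A)) \<le> C (\<alpha>\<^sup>2) L * real q * \<epsilon> powr (- 3))"
    and "\<exists>E\<in>sets (uniform_ball n m Abar \<sigma>).
          1 - (failure_const powr (1 / t) / (6 * \<kappa>) * \<sigma>\<^sup>2 / (real n ^ 3 * real m)) powr t
            \<le> measure (uniform_ball n m Abar \<sigma>) E \<and>
          (\<forall>a\<in>E. approx_optimal n m (sym_tuple n a) b (\<rho> * \<sigma>) (\<epsilon> powr (3 / 2) * R_Y) (5 * \<epsilon>)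
             (returned_point (run (sym_tuple n a)) * transpose_mat (returned_point (run (sym_tuple n a)))))"
proof -
  have Abar: "Abar k \<in> sym_mats n" if "k < m" for k
    using \<open>\<forall>k<m. Abar k \<in> sym_mats n\<close> that by blast
  note returns = arc[unfolded returns_critical_point_def, rule_format, OF _ Yc nmp(1,3)]
  have R\<sigma>: "\<sigma> \<le> R_A" using op_norm_nonneg[of m Abar n] Abar nmp by (simp add: RA)
  then have R: "0 < R_A" using \<sigma> by simp
  have ls: "least_squares n m A b R_A" if "A \<in> tuple_ball n m Abar \<sigma>" for A
    unfolding RA using Abar less_imp_le[OF \<sigma>] that b nmp(1) by (rule least_squares_ball)
  have center: "Abar \<in> tuple_ball n m Abar \<sigma>"
  proof -
    have "frob_norm (Abar k - Abar k) = 0" if "k < m" for k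
    proof -
      have "Abar k - Abar k = 0\<^sub>m n n" using sym_mats_carrier[OF Abar[OF that]] by (intro eq_matI) auto
      then show ?thesis by simp
    qed
    then show ?thesis using Abar \<sigma> by (simp add: tuple_ball_def)
  qed
  \<comment> \<open>If \<open>R_Y\<close> and \<open>b\<close> were both zero, \<kappa>,
    \<open>K\<close> and \<epsilon> would vanish and the tolerances would not be positive. The
    center of the ball already rules this out.\<close>
  show \<kappa>0: "0 < \<kappa>"
  proof -
    have "0 < R_Y \<or> 0 < vnorm b"
      using least_squares.level_set_radius_pos[OF ls[OF center] nmp(1,3) \<alpha>] RY center by blast
    then have "0 < R_A * R_Y\<^sup>2 + vnorm b"
      using R by (auto intro: add_pos_nonneg add_nonneg_pos)
    then show ?thesis using R by (simp add: \<kappa>)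
  qed
  have K0: "0 < K" using R \<kappa>0 by (simp add: K)
  have \<epsilon>0: "0 < \<epsilon>" using K0 \<rho> \<sigma> nmp by (simp add: \<epsilon>)
  have e1: "0 < \<epsilon> powr (3 / 2)" using \<epsilon>0 by simp
  have sublevel: "objective m A b Y0 \<le> \<alpha>\<^sup>2" if "A \<in> tuple_ball n m Abar \<sigma>" for A
    using bspec[OF level that] least_squares.level_set_eq[OF ls[OF that], of \<alpha> p] \<alpha> by auto
  have run_eq: "run A = ARC n p (objective m A b) (\<epsilon> powr (3 / 2)) \<epsilon> Y0" for A
    by (simp add: run)
  \<comment> \<open>The tolerance \<epsilon>^(3/2) for the gradient is tuned so that both terms of
    the iteration bound equal \<epsilon>^(-3).\<close>
  have max_eq: "max ((\<epsilon> powr (3 / 2)) powr (- 2)) (\<epsilon> powr (- 3)) = \<epsilon> powr (- 3)"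
    by (simp add: powr_powr)
  have bound_ex: "\<exists>L. objective_bound n p m A b \<alpha> L" if "A \<in> tuple_ball n m Abar \<sigma>" for A
    using least_squares.objective_bound_ex[OF ls[OF that], of \<alpha> R_Y p] \<alpha> RY0 RY that by auto
  have result: "iterations (run A) \<noteq> \<infinity> \<and> returned_point (run A) \<in> carrier_mat n p \<and>
      objective m A b (returned_point (run A)) \<le> \<alpha>\<^sup>2 \<and>
      real (evaluations (run A)) \<le> C (\<alpha>\<^sup>2) L * \<epsilon> powr (- 3) * real q"
    if A: "A \<in> tuple_ball n m Abar \<sigma>" and L: "objective_bound n p m A b \<alpha> L" for A L
  proof -
    obtain G H where GH: "C2_fun n p (objective m A b) G H"
        "bounded_lipschitz n p (objective m A b) G H (\<alpha>\<^sup>2) L"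
      using L by (auto simp: objective_bound_def)
    show ?thesis
      using returns[OF run_eq e1 \<epsilon>0 GH(1) sublevel[OF A] GH(2)] unfolding max_eq by blast
  qed
  show "iterations (run A) \<noteq> \<infinity> \<and> returned_point (run A) \<in> carrier_mat n p \<and>
      (\<exists>L. objective_bound n p m A b \<alpha> L) \<and>
      (\<forall>L. objective_bound n p m A b \<alpha> L \<longrightarrow> real (evaluations (run A)) \<le> C (\<alpha>\<^sup>2) L * real q * \<epsilon> powr (- 3))"
    if "A \<in> tuple_ball n m Abar \<sigma>" for A
    using bound_ex[OF that] result[OF that] by (fastforce simp: mult_ac)
  let ?good = "\<lambda>a. approx_optimal n m (sym_tuple n a) b (\<rho> * \<sigma>) (\<epsilon> powr (3 / 2) * R_Y) (5 * \<epsilon>)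
     (returned_point (run (sym_tuple n a)) * transpose_mat (returned_point (run (sym_tuple n a))))"
  \<comment> \<open>The evaluation count uses whatever derivatives come with a given
    \<open>L\<close>. Here the guarantee is applied with the explicit \<open>grad\<close> and
    \<open>hess\<close>, whose formulas the optimality argument needs.\<close>
  have critical: "frob_norm (least_squares.grad n m A b (returned_point (run A))) \<le> \<epsilon> powr (3 / 2)"
      "Z \<in> carrier_mat n p \<Longrightarrow> - \<epsilon> * (frob_norm Z)\<^sup>2 \<le>
        frob_inner Z (least_squares.hess n m A b (returned_point (run A)) Z)"
      "returned_point (run A) \<in> carrier_mat n p" "frob_norm (returned_point (run A)) \<le> R_Y"
    if A: "A \<in> tuple_ball n m Abar \<sigma>" for A Z
  proof -
    interpret least_squares n p m A b R_A using ls[OF A] .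
    obtain L where L: "bounded_lipschitz n p (objective m A b) grad hess (\<alpha>\<^sup>2) L"
      using bounded_lipschitz_objective[of \<alpha> R_Y] \<alpha> RY0 RY A by auto
    have *: "returned_point (run A) \<in> carrier_mat n p \<and> objective m A b (returned_point (run A)) \<le> \<alpha>\<^sup>2 \<and>
        frob_norm (grad (returned_point (run A))) \<le> \<epsilon> powr (3 / 2) \<and>
        (\<forall>Z\<in>carrier_mat n p. - \<epsilon> * (frob_norm Z)\<^sup>2 \<le> frob_inner Z (hess (returned_point (run A)) Z))"
      using returns[OF run_eq e1 \<epsilon>0 C2_objective sublevel[OF A] L] by blast
    then show "frob_norm (grad (returned_point (run A))) \<le> \<epsilon> powr (3 / 2)"
      "Z \<in> carrier_mat n p \<Longrightarrow> - \<epsilon> * (frob_norm Z)\<^sup>2 \<le> frob_inner Z (hess (returned_point (run A)) Z)"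
      "returned_point (run A) \<in> carrier_mat n p" by auto
    have "returned_point (run A) \<in> level_set n p m A b \<alpha>"
      using * level_set_eq[of \<alpha>] \<alpha> by auto
    then show "frob_norm (returned_point (run A)) \<le> R_Y" by (rule RY[rule_format, OF A])
  qed
  have d: "0 < \<rho> * \<sigma>" using \<rho> \<sigma> by simp
  let ?fail = "(failure_const powr (1 / t) / (6 * \<kappa>) * \<sigma>\<^sup>2 / (real n ^ 3 * real m)) powr t"
  show "\<exists>E\<in>sets (uniform_ball n m Abar \<sigma>). 1 - ?fail \<le> measure (uniform_ball n m Abar \<sigma>) E \<and> (\<forall>a\<in>E. ?good a)"
  \<comment> \<open>If the inequality fails, the a priori bound \<kappa> / (2 R_A) on the residual
    is below \<rho>\<sigma>, so every tuple in the ball is good. Otherwise the inequality is the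
    smallness that the failure bound requires.\<close>
  proof (cases "\<rho> * \<sigma> * R_A \<le> \<kappa> / 2")
    case False
    have good: "?good a" if "a \<in> ball_coords n m Abar \<sigma>" for a
    proof -
      have A: "sym_tuple n a \<in> tuple_ball n m Abar \<sigma>" using that by (simp add: ball_coords_def)
      interpret least_squares n p m "sym_tuple n a" b R_A using ls[OF A] .
      have "vnorm (res (returned_point (run (sym_tuple n a)))) \<le> R_A * R_Y\<^sup>2 + vnorm b"
        using critical(3,4)[OF A] by (rule vnorm_res_le)
      moreover have "(R_A * R_Y\<^sup>2 + vnorm b) * R_A \<le> (\<rho> * \<sigma>) * R_A"
      proof -
        have "(R_A * R_Y\<^sup>2 + vnorm b) * R_A = \<kappa> / 2" by (simp add: \<kappa>)
        then show ?thesis using False by linarith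
      qed
      ultimately have "vnorm (res (returned_point (run (sym_tuple n a)))) \<le> \<rho> * \<sigma>"
        using R by (simp add: mult_le_cancel_right)
      then show ?thesis
        using psd_gram[OF critical(3)[OF A]] by (simp add: approx_optimal_def)
    qed
    show ?thesis
      using uniform_ball_properties[of m Abar n \<sigma>] Abar \<sigma> good
      by (intro bexI[of _ "ball_coords n m Abar \<sigma>"]) auto
  next
    case True
    \<comment> \<open>\<theta> is the mesh of the net and equals \<delta> / R_A: moving a direction
      by \<theta> changes the combined matrix by at most \<delta>.\<close>
    define \<theta> where "\<theta> = \<epsilon> / (4 * \<rho> * \<sigma>)"
    define \<delta> where "\<delta> = \<epsilon> * R_A / (4 * \<rho> * \<sigma>)"
    have \<theta>: "0 < \<theta>" and \<delta>: "0 < \<delta>" using \<epsilon>0 R \<rho> \<sigma> by (simp_all add: \<theta>_def \<delta>_def)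
    obtain T where T: "finite T" "T \<subseteq> unit_sphere m" "real (card T) \<le> (1 + 2 / \<theta>) ^ m"
      "\<And>u. u \<in> unit_sphere m \<Longrightarrow> \<exists>v\<in>T. L2_set (\<lambda>i. u i - v i) {..<m} \<le> \<theta>"
      using sphere_net[OF \<theta>, of m] by blast
    have dichotomy: "?good a \<or> (\<exists>u\<in>T. \<exists>f\<in>{..<p} \<rightarrow>\<^sub>E {..<n}. inj_on f {..<p} \<and>
        a \<in> near_singular n m p u f (3 * sqrt (real (p * n)) * \<delta>))"
      if a: "a \<in> ball_coords n m Abar \<sigma>" for a
    proof -
      have A: "sym_tuple n a \<in> tuple_ball n m Abar \<sigma>" and as: "a \<in> space (coord_measure n m)"
        using a by (simp_all add: ball_coords_def)
      show ?thesis
        using approx_optimal_or_near_singular[OF ls[OF A] R as nmp(1,3) critical(3,4)[OF A] \<epsilon>0 d critical(1,2)[OF A], of T] T(4)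
        by (simp add: \<theta>_def \<delta>_def mult.assoc)
    qed
    let ?P = "if p \<le> n then real (card T) * real n ^ p * (15 * real m * (real n)\<^sup>2 * \<delta> / \<sigma>) ^ tau p else 0"
    have "\<exists>E\<in>sets (uniform_ball n m Abar \<sigma>). (\<forall>a\<in>E. ?good a) \<and> 1 - ?P \<le> measure (uniform_ball n m Abar \<sigma>) E"
      by (rule good_event[where good = ?good, OF Abar \<sigma> nmp \<delta> T(1,2) dichotomy])
    then obtain E where E: "E \<in> sets (uniform_ball n m Abar \<sigma>)" "\<forall>a\<in>E. ?good a"
      "1 - ?P \<le> measure (uniform_ball n m Abar \<sigma>) E"
      by (elim bexE conjE)
    have "?P \<le> ?fail"
    proof (cases "p \<le> n")
      case pn: True
      \<comment> \<open>\<open>three_power_tau_le\<close> asks for p \<ge> 2. The dimension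
        condition excludes p = 1, because \<open>tau 1 = 1\<close> while m \<ge> 1 and \<eta> >
        0.\<close>
      have p2: "2 \<le> p"
      proof (rule ccontr)
        assume "\<not> 2 \<le> p"
        then have "p = 1" using nmp by simp
        then have "tau p = 1" by (simp add: tau_def choose_two)
        then have "(1 + \<eta>) * real m + \<eta> * t \<le> 1" using tau by simp
        moreover have "1 \<le> real m" "0 < \<eta> * real m" "0 < \<eta> * t" using nmp \<eta> t by auto
        ultimately show False by (simp add: algebra_simps)
      qed
      have "real (card T) * real n ^ p * (15 * real m * (real n)\<^sup>2 * \<delta> / \<sigma>) ^ tau p \<le>
          (1 + 2 / \<theta>) ^ m * real n ^ p * (15 * real m * (real n)\<^sup>2 * \<delta> / \<sigma>) ^ tau p"
        using T(3) \<delta> \<sigma> by (intro mult_right_mono) auto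
      also have "\<dots> \<le> ?fail"
        unfolding \<theta>_def \<delta>_def
        by (rule failure_bound[OF \<eta> t nmp(2) p2 pn tau \<sigma> R\<sigma> \<kappa>0 \<rho>(1) True \<rho>(2) K \<epsilon>])
      finally show ?thesis using pn by simp
    qed simp
    then have "1 - ?fail \<le> measure (uniform_ball n m Abar \<sigma>) E" using E(3) by linarith
    then show ?thesis using E(1,2) by (intro bexI[of _ E] conjI)
  qed
qed

theorem theorem5p3:
  shows "\<exists>c :: real \<Rightarrow> real \<Rightarrow> real \<Rightarrow> real. (\<forall>\<kappa> \<eta> t. 0 < c \<kappa> \<eta> t) \<and>
    (\<forall>ARC. arc_method ARC \<longrightarrow>
      (\<exists>C :: real \<Rightarrow> real \<Rightarrow> real.
        \<forall>(n::nat) (m::nat) (p::nat) (\<eta>::real) (t::real) (b::real Matrix.vec)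
          (Abar::nat \<Rightarrow> real mat) (\<sigma>::real) (\<alpha>::real) (Y0::real mat) (R_Y::real) (\<rho>::real)
          (R_A::real) (\<kappa>::real) (K::real) (\<epsilon>::real) (\<epsilon>1::real) (\<epsilon>2::real).
          0 < \<eta> \<longrightarrow> 0 < t \<longrightarrow> 1 \<le> n \<longrightarrow> 1 \<le> m \<longrightarrow> 1 \<le> p \<longrightarrow>
          real (tau p) \<ge> (1 + \<eta>) * real m + \<eta> * t \<longrightarrow>
          b \<in> carrier_vec m \<longrightarrow>
          (\<forall>k<m. Abar k \<in> sym_mats n) \<longrightarrow>
          0 < \<sigma> \<longrightarrow> 0 < \<alpha> \<longrightarrow>
          Y0 \<in> carrier_mat n p \<longrightarrow>
          (\<forall>A\<in>tuple_ball n m Abar \<sigma>.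
             compactin (mat_topology n p) (level_set n p m A b \<alpha>) \<and>
             Y0 \<in> level_set n p m A b \<alpha>) \<longrightarrow>
          0 \<le> R_Y \<longrightarrow>
          (\<forall>A\<in>tuple_ball n m Abar \<sigma>. \<forall>Y\<in>level_set n p m A b \<alpha>. frob_norm Y \<le> R_Y) \<longrightarrow>
          R_A = op_norm n m Abar + \<sigma> \<longrightarrow>
          \<kappa> = 2 * (R_A * R_Y\<^sup>2 + vnorm b) * R_A \<longrightarrow>
          K = R_A * (3 * \<kappa>) powr (1 / \<eta>) \<longrightarrow>
          0 < \<rho> \<longrightarrow> \<rho> \<le> 1 \<longrightarrow>
          \<epsilon> = inverse K * (\<rho> * \<sigma>\<^sup>2 / (2 * real n ^ 3 * real m)) powr (1 + 1 / \<eta>) \<longrightarrow>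
          \<epsilon>1 = \<epsilon> powr (3 / 2) \<longrightarrow>
          \<epsilon>2 = \<epsilon> \<longrightarrow>
          (let run = (\<lambda>A. ARC n p (objective m A b) \<epsilon>1 \<epsilon>2 Y0);
               U = uniform_ball n m Abar \<sigma>
           in (\<forall>A\<in>tuple_ball n m Abar \<sigma>.
                 iterations (run A) \<noteq> \<infinity> \<and>
                 returned_point (run A) \<in> carrier_mat n p \<and>
                 (\<exists>L. objective_bound n p m A b \<alpha> L) \<and>
                 (\<forall>L. objective_bound n p m A b \<alpha> L \<longrightarrow>
                    real (evaluations (run A)) \<le> C \<alpha> L * \<epsilon> powr (- 3))) \<and>
              (\<exists>E\<in>sets U.
                 measure U E \<ge> 1 - (c \<kappa> \<eta> t * \<sigma>\<^sup>2 / (real n ^ 3 * real m)) powr t \<and>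
                 (\<forall>a\<in>E.
                    let A = sym_tuple n a; Y = returned_point (run A)
                    in approx_optimal n m A b (\<rho> * \<sigma>) (\<epsilon> powr (3 / 2) * R_Y) (5 * \<epsilon>)
                         (Y * transpose_mat Y))))))"
proof -
  \<comment> \<open>The value 1 for nonpositive \<kappa> is a default that keeps \<open>c\<close>
    positive everywhere; under the hypotheses \<kappa> is positive.\<close>
  define c :: "real \<Rightarrow> real \<Rightarrow> real \<Rightarrow> real"
    where "c \<kappa> \<eta> t = (if 0 < \<kappa> then failure_const powr (1 / t) / (6 * \<kappa>) else 1)" for \<kappa> \<eta> t
  have c0: "\<forall>\<kappa> \<eta> t. 0 < c \<kappa> \<eta> t" using failure_const_ge_1 by (simp add: c_def)
  show ?thesis
  proof (intro exI[of _ c] conjI c0 allI impI, goal_cases)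
    case (1 ARC)
    then obtain C q where arc: "returns_critical_point ARC C q" by (rule arc_method_returns)
    show ?case
    \<comment> \<open>The level set at \<alpha> is the sublevel set of the squared residual at
      \<alpha>^2, and each iteration makes at most \<open>q\<close> evaluations.\<close>
    proof (intro exI[of _ "\<lambda>\<alpha> L. C (\<alpha>\<^sup>2) L * real q"] allI impI, goal_cases)
      case (1 n m p \<eta> t b Abar \<sigma> \<alpha> Y0 R_Y \<rho> R_A \<kappa> K \<epsilon> \<epsilon>1 \<epsilon>2)
      note core = arc_run_guarantees[OF arc 1(1-20) refl]
      have "c \<kappa> \<eta> t = failure_const powr (1 / t) / (6 * \<kappa>)"
        using core(1) by (simp add: c_def)
      then show ?case
        using core(2,3) unfolding Let_def 1(21) 1(22) by simp
    qed
  qed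
qed

end
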